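(* Let $T>0$, $\nu>0$, let $\Omega\subset\mathbb{R}^3$ be a bounded open set with smooth boundary, and let $f\in L^2(0,T;V')$. If $u$ and $v$ are two weak solutions on $[0,T]$ of the 3D Navier-Stokes equations in $\Omega$ (with the same viscosity $\nu$ and the same force $f$, and with initial data $u(0),v(0)\in H$) such that $u,v\in L^{3}(0,T;V)$, then $w=u-v$ is a continuous function $[0,T]\rightarrow H$ (with respect to the norm of $H$).
   Context: The 3D Navier-Stokes equations are $$\frac{\partial u}{\partial t}+u\cdot\nabla u=\nu\Delta u+\nabla p+f,\quad \operatorname{div}u=0 \ \text{ in }\Omega\times(0,\infty),\qquad u=0\ \text{ on }\partial\Omega\times(0,\infty),\qquad u(x,0)=u_0(x)\ \text{ in }\Omega,$$ where $u$ is the velocity vector field, $p$ the scalar pressure, $f$ a given force field and $\nu>0$ the viscosity. Function spaces: $\mathcal{V}=\{u\in C_0^\infty(\Omega)^3:\operatorname{div}u=0\}$; $V$ is the closure of $\mathcal{V}$ in $H_0^1(\Omega)^3$, with norm $\|\cdot\|_{H^1}$; $H$ is the closure of $\mathcal{V}$ in $L^2(\Omega)^3$, with the scalar product $(\cdot,\cdot)$ and norm $\|\cdot\|_{L^2}$ induced by $L^2$; $V'$ is the dual space of $V$. A (Leray) weak solution on $[0,T]$ with initial datum $u_0\in H$ is a function $u\in L^2(0,T;V)\cap L^\infty(0,T;H)$ that is weakly continuous from $[0,T]$ into $H$, satisfies $u(0)=u_0$, satisfies for every $\phi\in V$ the identity $\frac{d}{dt}(u,\phi)+\nu(\nabla u,\nabla\phi)+(u\cdot\nabla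 u,\phi)=\langle f,\phi\rangle$ in the sense of distributions on $(0,T)$, and satisfies the energy inequality $\frac12\|u(t)\|_{L^2}^2+\nu\int_0^t\|\nabla u\|_{L^2}^2\,ds\le\frac12\|u_0\|_{L^2}^2+\int_0^t\langle f,u\rangle\,ds$ for $t\in[0,T]$. *)

theory Defs
  imports "HOL-Analysis.Analysis"
begin

section \<open>Smooth functions, test functions and smooth domains\<close>

text \<open>\<open>C^k\<close> on an open set through iterated partial derivatives.\<close>

fun Ck_on :: "nat \<Rightarrow> 'a set \<Rightarrow> ('a::euclidean_space \<Rightarrow> 'b::real_normed_vector) \<Rightarrow> bool" where
  "Ck_on 0 S f \<longleftrightarrow> continuous_on S f"
| "Ck_on (Suc k) S f \<longleftrightarrow>
     (\<forall>x\<in>S. f differentiable (at x)) \<and>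
     (\<forall>i\<in>Basis. Ck_on k S (\<lambda>x. frechet_derivative f (at x) i))"

definition smooth_on :: "'a set \<Rightarrow> ('a::euclidean_space \<Rightarrow> 'b::real_normed_vector) \<Rightarrow> bool" where
  "smooth_on S f \<longleftrightarrow> (\<forall>k. Ck_on k S f)"

text \<open>Test functions on an open set \<open>\<Omega>\<close> are represented by their extension by zero to the
  whole space.\<close>

definition test_functions :: "'a set \<Rightarrow> ('a::euclidean_space \<Rightarrow> 'b::real_normed_vector) set" where
  "test_functions \<Omega> =
     {\<phi>. smooth_on UNIV \<phi> \<and> compact (closure {x. \<phi> x \<noteq> 0}) \<and> closure {x. \<phi> x \<noteq> 0} \<subseteq> \<Omega>}"

text \<open>Near each boundary point a smooth diffeomorphism straightens \<open>\<Omega>\<close> to a half space; in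
  particular \<open>\<Omega>\<close> lies locally on one side of its boundary.\<close>

definition smooth_boundary :: "(real^3) set \<Rightarrow> bool" where
  "smooth_boundary \<Omega> \<longleftrightarrow>
     (\<forall>p\<in>frontier \<Omega>. \<exists>U W \<Phi> \<Psi>. open U \<and> p \<in> U \<and> open W \<and>
        homeomorphism U W \<Phi> \<Psi> \<and> smooth_on U \<Phi> \<and> smooth_on W \<Psi> \<and>
        \<Phi> ` (U \<inter> \<Omega>) = W \<inter> {y::real^3. y $ 3 > 0} \<and>
        \<Phi> ` (U \<inter> frontier \<Omega>) = W \<inter> {y. y $ 3 = 0})"

section \<open>Seminormed function spaces\<close>

text \<open>A function space is a carrier set \<open>X\<close> of representatives together with a seminorm \<open>N\<close>;
  elements at seminorm distance zero stand for the same element of the normed space. Subtraction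
  of functions is pointwise.\<close>

definition closure_wrt :: "'a set \<Rightarrow> ('a::minus \<Rightarrow> real) \<Rightarrow> 'a set \<Rightarrow> 'a set" where
  "closure_wrt X N A = {x\<in>X. \<forall>\<epsilon>>0. \<exists>a\<in>A. N (x - a) < \<epsilon>}"

definition dual_space ::
    "('a \<Rightarrow> 'b::real_vector) set \<Rightarrow> (('a \<Rightarrow> 'b) \<Rightarrow> real) \<Rightarrow> (('a \<Rightarrow> 'b) \<Rightarrow> real) set" where
  "dual_space X N =
     {F. (\<forall>u\<in>X. \<forall>v\<in>X. F (\<lambda>x. u x + v x) = F u + F v) \<and>
         (\<forall>c. \<forall>u\<in>X. F (\<lambda>x. c *\<^sub>R u x) = c * F u) \<and>
         (\<exists>C. \<forall>u\<in>X. \<bar>F u\<bar> \<le> C * N u)}"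

definition dual_norm ::
    "('a \<Rightarrow> 'b) set \<Rightarrow> (('a \<Rightarrow> 'b) \<Rightarrow> real) \<Rightarrow> (('a \<Rightarrow> 'b) \<Rightarrow> real) \<Rightarrow> real" where
  "dual_norm X N F = (SUP u\<in>{u\<in>X. N u \<le> 1}. \<bar>F u\<bar>)"

definition strongly_measurable ::
    "real set \<Rightarrow> 'a set \<Rightarrow> ('a::minus \<Rightarrow> real) \<Rightarrow> (real \<Rightarrow> 'a) \<Rightarrow> bool" where
  "strongly_measurable I X N u \<longleftrightarrow>
     (\<exists>s. (\<forall>n. simple_function (lebesgue_on I) (s n) \<and> s n ` I \<subseteq> X) \<and>
          (AE t in lebesgue_on I. (\<lambda>n. N (s n t - u t)) \<longlonglongrightarrow> 0))"

definition Bochner_Lp ::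
    "nat \<Rightarrow> real set \<Rightarrow> 'a set \<Rightarrow> ('a::minus \<Rightarrow> real) \<Rightarrow> (real \<Rightarrow> 'a) set" where
  "Bochner_Lp p I X N =
     {u. (AE t in lebesgue_on I. u t \<in> X) \<and> strongly_measurable I X N u \<and>
         integrable (lebesgue_on I) (\<lambda>t. N (u t) ^ p)}"

definition Bochner_Linf ::
    "real set \<Rightarrow> 'a set \<Rightarrow> ('a::minus \<Rightarrow> real) \<Rightarrow> (real \<Rightarrow> 'a) set" where
  "Bochner_Linf I X N =
     {u. (AE t in lebesgue_on I. u t \<in> X) \<and> strongly_measurable I X N u \<and>
         (\<exists>C. AE t in lebesgue_on I. N (u t) \<le> C)}"

definition continuous_into ::
    "real set \<Rightarrow> 'a set \<Rightarrow> ('a::minus \<Rightarrow> real) \<Rightarrow> (real \<Rightarrow> 'a) \<Rightarrow> bool" where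
  "continuous_into I X N u \<longleftrightarrow>
     (\<forall>t\<in>I. u t \<in> X) \<and> (\<forall>t\<in>I. ((\<lambda>s. N (u s - u t)) \<longlongrightarrow> 0) (at t within I))"

definition weakly_continuous_into ::
    "real set \<Rightarrow> ('a \<Rightarrow> 'b::real_vector) set \<Rightarrow> (('a \<Rightarrow> 'b) \<Rightarrow> real) \<Rightarrow> (real \<Rightarrow> 'a \<Rightarrow> 'b) \<Rightarrow> bool"
  where
  "weakly_continuous_into I X N u \<longleftrightarrow>
     (\<forall>t\<in>I. u t \<in> X) \<and> (\<forall>F\<in>dual_space X N. continuous_on I (\<lambda>t. F (u t)))"

section \<open>Lebesgue and Sobolev spaces\<close>

definition L2_space :: "(real^3) set \<Rightarrow> (real^3 \<Rightarrow> 'b::euclidean_space) set" where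
  "L2_space \<Omega> = {u. u \<in> borel_measurable (lebesgue_on \<Omega>) \<and>
                    integrable (lebesgue_on \<Omega>) (\<lambda>x. (norm (u x))\<^sup>2)}"

definition L2_inner ::
    "(real^3) set \<Rightarrow> (real^3 \<Rightarrow> 'b::euclidean_space) \<Rightarrow> (real^3 \<Rightarrow> 'b) \<Rightarrow> real" where
  "L2_inner \<Omega> u v = (\<integral>x. u x \<bullet> v x \<partial>lebesgue_on \<Omega>)"

definition L2_norm :: "(real^3) set \<Rightarrow> (real^3 \<Rightarrow> 'b::euclidean_space) \<Rightarrow> real" where
  "L2_norm \<Omega> u = sqrt (L2_inner \<Omega> u u)"

text \<open>Entry \<open>(i, j)\<close> of the weak gradient is \<open>\<partial>\<^sub>j u\<^sub>i\<close>. The inner product of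
  \<^typ>\<open>real^3^3\<close> is the Frobenius one, so \<^const>\<open>L2_inner\<close> also gives \<open>(\<nabla>u, \<nabla>v)\<close>.\<close>

definition is_weak_grad ::
    "(real^3) set \<Rightarrow> (real^3 \<Rightarrow> real^3) \<Rightarrow> (real^3 \<Rightarrow> real^3^3) \<Rightarrow> bool" where
  "is_weak_grad \<Omega> u G \<longleftrightarrow>
     (\<forall>\<phi>\<in>test_functions \<Omega>. \<forall>i j.
        (\<integral>x. u x $ i * frechet_derivative \<phi> (at x) (axis j 1) \<partial>lebesgue_on \<Omega>) =
        - (\<integral>x. G x $ i $ j * \<phi> x \<partial>lebesgue_on \<Omega>))"

text \<open>On \<open>H\<^sup>1\<close> this choice is unique up to null sets.\<close>

definition weak_grad :: "(real^3) set \<Rightarrow> (real^3 \<Rightarrow> real^3) \<Rightarrow> real^3 \<Rightarrow> real^3^3" where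
  "weak_grad \<Omega> u = (SOME G. G \<in> L2_space \<Omega> \<and> is_weak_grad \<Omega> u G)"

definition H1_space :: "(real^3) set \<Rightarrow> (real^3 \<Rightarrow> real^3) set" where
  "H1_space \<Omega> = {u \<in> L2_space \<Omega>. \<exists>G \<in> L2_space \<Omega>. is_weak_grad \<Omega> u G}"

definition H1_norm :: "(real^3) set \<Rightarrow> (real^3 \<Rightarrow> real^3) \<Rightarrow> real" where
  "H1_norm \<Omega> u = sqrt ((L2_norm \<Omega> u)\<^sup>2 + (L2_norm \<Omega> (weak_grad \<Omega> u))\<^sup>2)"

definition H10_space :: "(real^3) set \<Rightarrow> (real^3 \<Rightarrow> real^3) set" where
  "H10_space \<Omega> = closure_wrt (H1_space \<Omega>) (H1_norm \<Omega>) (test_functions \<Omega>)"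

section \<open>Spaces of divergence-free fields\<close>

definition divergence :: "(real^3 \<Rightarrow> real^3) \<Rightarrow> real^3 \<Rightarrow> real" where
  "divergence u x = (\<Sum>i\<in>UNIV. frechet_derivative u (at x) (axis i 1) $ i)"

definition div_free_test :: "(real^3) set \<Rightarrow> (real^3 \<Rightarrow> real^3) set" where
  "div_free_test \<Omega> = {u \<in> test_functions \<Omega>. \<forall>x\<in>\<Omega>. divergence u x = 0}"

definition V_space :: "(real^3) set \<Rightarrow> (real^3 \<Rightarrow> real^3) set" where
  "V_space \<Omega> = closure_wrt (H10_space \<Omega>) (H1_norm \<Omega>) (div_free_test \<Omega>)"

definition H_space :: "(real^3) set \<Rightarrow> (real^3 \<Rightarrow> real^3) set" where
  "H_space \<Omega> = closure_wrt (L2_space \<Omega>) (L2_norm \<Omega>) (div_free_test \<Omega>)"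

abbreviation V_dual :: "(real^3) set \<Rightarrow> ((real^3 \<Rightarrow> real^3) \<Rightarrow> real) set" where
  "V_dual \<Omega> \<equiv> dual_space (V_space \<Omega>) (H1_norm \<Omega>)"

abbreviation V_dual_norm :: "(real^3) set \<Rightarrow> ((real^3 \<Rightarrow> real^3) \<Rightarrow> real) \<Rightarrow> real" where
  "V_dual_norm \<Omega> \<equiv> dual_norm (V_space \<Omega>) (H1_norm \<Omega>)"

section \<open>Weak solutions of the Navier-Stokes equations\<close>

text \<open>\<open>u \<cdot> \<nabla>u = \<Sum>\<^sub>j u\<^sub>j \<partial>\<^sub>j u\<close>\<close>

definition convection :: "(real^3) set \<Rightarrow> (real^3 \<Rightarrow> real^3) \<Rightarrow> real^3 \<Rightarrow> real^3" where
  "convection \<Omega> u x = weak_grad \<Omega> u x *v u x"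

text \<open>The distribution on \<open>(0, T)\<close> given by an integrable function, and the derivative of a
  distribution.\<close>

definition regular_distr :: "real \<Rightarrow> (real \<Rightarrow> real) \<Rightarrow> (real \<Rightarrow> real) \<Rightarrow> real" where
  "regular_distr T g \<psi> = (\<integral>t. g t * \<psi> t \<partial>lebesgue_on {0<..<T})"

definition distr_deriv :: "((real \<Rightarrow> real) \<Rightarrow> real) \<Rightarrow> (real \<Rightarrow> real) \<Rightarrow> real" where
  "distr_deriv D \<psi> = - D (deriv \<psi>)"

text \<open>All time and space integrals below converge for \<open>u\<close> and \<open>f\<close> in the stated spaces. Initial values
  are compared in \<open>H\<close>, that is almost everywhere. The duality pairing
  \<open>\<langle>f, \<phi>\<rangle>\<close> is the application \<open>f t \<phi>\<close>.\<close>

definition NS_weak_solution ::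
    "(real^3) set \<Rightarrow> real \<Rightarrow> real \<Rightarrow> (real \<Rightarrow> (real^3 \<Rightarrow> real^3) \<Rightarrow> real) \<Rightarrow>
     (real^3 \<Rightarrow> real^3) \<Rightarrow> (real \<Rightarrow> real^3 \<Rightarrow> real^3) \<Rightarrow> bool" where
  "NS_weak_solution \<Omega> T \<nu> f u0 u \<longleftrightarrow>
     u \<in> Bochner_Lp 2 {0..T} (V_space \<Omega>) (H1_norm \<Omega>) \<and>
     u \<in> Bochner_Linf {0..T} (H_space \<Omega>) (L2_norm \<Omega>) \<and>
     weakly_continuous_into {0..T} (H_space \<Omega>) (L2_norm \<Omega>) u \<and>
     (AE x in lebesgue_on \<Omega>. u 0 x = u0 x) \<and>
     (\<forall>\<phi>\<in>V_space \<Omega>. \<forall>\<psi>\<in>test_functions {0<..<T}.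
        distr_deriv (regular_distr T (\<lambda>t. L2_inner \<Omega> (u t) \<phi>)) \<psi>
        + \<nu> * regular_distr T (\<lambda>t. L2_inner \<Omega> (weak_grad \<Omega> (u t)) (weak_grad \<Omega> \<phi>)) \<psi>
        + regular_distr T (\<lambda>t. L2_inner \<Omega> (convection \<Omega> (u t)) \<phi>) \<psi>
        = regular_distr T (\<lambda>t. f t \<phi>) \<psi>) \<and>
     (\<forall>t\<in>{0..T}.
        1/2 * (L2_norm \<Omega> (u t))\<^sup>2
        + \<nu> * (\<integral>s. (L2_norm \<Omega> (weak_grad \<Omega> (u s)))\<^sup>2 \<partial>lebesgue_on {0..t})
        \<le> 1/2 * (L2_norm \<Omega> u0)\<^sup>2 + (\<integral>s. f s (u s) \<partial>lebesgue_on {0..t}))"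

end

theory Submission
  imports Defs
begin

text \<open>Each of the two solutions is continuous into \<open>H\<close>.
  By the Sobolev inequality the convection term is bounded in \<open>V'\<close> by
  \<open>C \<parallel>u\<parallel>\<^bsub>L2\<^esub>\<^sup>1\<^sup>/\<^sup>2 \<parallel>u\<parallel>\<^bsub>H1\<^esub>\<^sup>3\<^sup>/\<^sup>2\<close>, so a solution in \<open>L\<^sup>3(V) \<inter> L\<^sup>\<infinity>(H)\<close> has its time derivative in
  \<open>L\<^sup>2(V')\<close>. That gives \<open>\<bar>(u(t) - u(s), \<phi>)\<bar> \<le> \<parallel>\<phi>\<parallel>\<^bsub>H1\<^esub> \<integral>\<^sub>s\<^sup>t G\<close> with \<open>G\<close> square integrable.
  For \<open>d(\<tau>) = u(x + \<tau>) - u(y + \<tau>)\<close>, testing increments of \<open>d\<close> with \<open>d\<close> itself shows that averages of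
  \<open>\<parallel>d\<parallel>\<^bsub>L2\<^esub>\<^sup>2\<close> over short windows near \<open>0\<close> are controlled by the average over a longer window; weak lower
  semicontinuity bounds \<open>\<parallel>d(0)\<parallel>\<^bsub>L2\<^esub>\<^sup>2\<close> by the former, and the latter is small when \<open>x\<close> is
  close to \<open>y\<close>.\<close>

section \<open>Smooth bump functions\<close>

text \<open>The obstacle is that u(t) lies in V only for almost every time, while the claim concerns
  every time, and that weak continuity controls (u(s), u(t)) only in each variable separately, so
  part of the norm could be lost in the limit. A direct derivative of the squared norm would need a
  chain rule for V'-valued derivatives and a regularisation in time. The argument stays with real
  functions instead: only the scalar functions (u(t), p) with p in V are differentiated weakly, and
  everything else happens on the Gram kernel (u(s), u(t)). The test field p is itself a value u(s),
  admissible for almost every s, and integration over time windows removes the exceptional times.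
  Integrability of U^2 and G^2, with U the H1 norm of u, suffices because the product of U(s) with
  the integral of G is split by the AM-GM inequality. The windows run forward in time, so times near
  T are reached by reversing time. The power 1/2 of the L2 norm in the convection bound comes from
  interpolating between L2 and L6, and this is why squaring the bound leaves exactly the third power
  of the H1 norm.\<close>

definition flat_exp :: "real poly \<Rightarrow> real \<Rightarrow> real" where
  "flat_exp p s = (if s \<le> 0 then 0 else poly p (inverse s) * exp (- inverse s))"

lemma poly_exp_decay: "((\<lambda>x::real. poly p x * exp (- x)) \<longlongrightarrow> 0) at_top"
proof -
  have "((\<lambda>x. \<Sum>i\<le>degree p. coeff p i * (x ^ i / exp x)) \<longlongrightarrow> (\<Sum>i\<le>degree p. coeff p i * 0)) at_top"
    by (intro tendsto_intros tendsto_power_div_exp_0)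
  moreover have "(\<lambda>x. \<Sum>i\<le>degree p. coeff p i * (x ^ i / exp x)) = (\<lambda>x. poly p x * exp (- x))"
    by (auto simp: poly_altdef exp_minus sum_distrib_right sum_divide_distrib field_simps)
  ultimately show ?thesis by simp
qed

text \<open>With y = 1/s the chain rule gives y^2 (p(y) - p'(y)) exp(-y), again of the form
  \<open>flat_exp\<close>; this closure yields smoothness of all orders at once. At 0 the difference
  quotient is y p(y) exp(-y), which decays as y tends to infinity.\<close>

lemma flat_exp_has_derivative:
  "(flat_exp p has_real_derivative flat_exp ((p - pderiv p) * monom 1 2) s) (at s)"
proof -
  consider "s < 0" | "s > 0" | "s = 0" by linarith
  then show ?thesis
  proof cases
    case 1
    have "((\<lambda>_. 0) has_real_derivative 0) (at s)" by simp
    then have "(flat_exp p has_real_derivative 0) (at s)"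
      by (rule DERIV_cong_ev[THEN iffD1, rotated 3])
         (use 1 eventually_nhds_in_open[of "{..<0}" s] in
           \<open>auto simp: flat_exp_def elim!: eventually_mono\<close>)
    with 1 show ?thesis by (simp add: flat_exp_def)
  next
    case 2
    have "((\<lambda>s. poly p (inverse s) * exp (- inverse s)) has_real_derivative
        flat_exp ((p - pderiv p) * monom 1 2) s) (at s)"
      using 2 by (auto intro!: derivative_eq_intros DERIV_chain'[where g = "poly p"] poly_DERIV
          simp: flat_exp_def poly_monom field_simps power2_eq_square)
    then show ?thesis
      by (rule DERIV_cong_ev[THEN iffD1, rotated 3])
         (use 2 eventually_nhds_in_open[of "{0<..}" s] in
           \<open>auto simp: flat_exp_def elim!: eventually_mono\<close>)
  next
    case 3
    have "((\<lambda>h. poly (pCons 0 p) (inverse h) * exp (- inverse h)) \<longlongrightarrow> 0) (at_right 0)"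
      by (rule filterlim_compose[OF poly_exp_decay filterlim_inverse_at_top_right])
    then have r: "((\<lambda>h. flat_exp p h / h) \<longlongrightarrow> 0) (at_right 0)"
      by (rule Lim_transform_eventually)
         (auto simp: eventually_at_filter flat_exp_def field_simps)
    have l: "((\<lambda>h. flat_exp p h / h) \<longlongrightarrow> 0) (at_left 0)"
      by (rule Lim_transform_eventually[OF tendsto_const])
         (auto simp: eventually_at_filter flat_exp_def)
    have "((\<lambda>h. flat_exp p h / h) \<longlongrightarrow> 0) (at 0)"
      using l r by (simp add: filterlim_at_split)
    then show ?thesis using 3 by (simp add: DERIV_def flat_exp_def)
  qed
qed

text \<open>A class of functions that is closed under partial derivatives, so that all its members are smooth.\<close>

inductive flat_algebra :: "('a::euclidean_space \<Rightarrow> real) \<Rightarrow> bool" where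
  const: "flat_algebra (\<lambda>x. c)"
| flat: "flat_algebra (\<lambda>x. flat_exp p (c + x \<bullet> d))"
| add: "flat_algebra f \<Longrightarrow> flat_algebra g \<Longrightarrow> flat_algebra (\<lambda>x. f x + g x)"
| mult: "flat_algebra f \<Longrightarrow> flat_algebra g \<Longrightarrow> flat_algebra (\<lambda>x. f x * g x)"

lemma flat_algebra_derivative:
  assumes "flat_algebra f"
  shows "\<exists>f'. (\<forall>x. (f has_derivative f' x) (at x)) \<and> (\<forall>i. flat_algebra (\<lambda>x. f' x i))"
  using assms
proof induction
  case (const c)
  show ?case by (intro exI[of _ "\<lambda>x i. 0"]) (auto intro: flat_algebra.const)
next
  case (flat p c d)
  let ?q = "(p - pderiv p) * monom 1 2"
  have "((\<lambda>x. flat_exp p (c + x \<bullet> d)) has_derivative (\<lambda>i. flat_exp ?q (c + x \<bullet> d) * (i \<bullet> d))) (at x)" for x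
    by (rule has_derivative_compose[where g = "flat_exp p",
        OF _ flat_exp_has_derivative[unfolded has_field_derivative_def]])
       (auto intro!: derivative_eq_intros)
  then show ?case
    by (intro exI[of _ "\<lambda>x i. flat_exp ?q (c + x \<bullet> d) * (i \<bullet> d)"])
       (auto intro!: flat_algebra.intros)
next
  case (add f g)
  then obtain f' g' where "\<And>x. (f has_derivative f' x) (at x)" "\<And>i. flat_algebra (\<lambda>x. f' x i)"
    "\<And>x. (g has_derivative g' x) (at x)" "\<And>i. flat_algebra (\<lambda>x. g' x i)" by blast
  then show ?case
    by (intro exI[of _ "\<lambda>x i. f' x i + g' x i"])
       (auto intro!: flat_algebra.intros derivative_eq_intros)
next
  case (mult f g)
  then obtain f' g' where "\<And>x. (f has_derivative f' x) (at x)" "\<And>i. flat_algebra (\<lambda>x. f' x i)"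
    "\<And>x. (g has_derivative g' x) (at x)" "\<And>i. flat_algebra (\<lambda>x. g' x i)" by blast
  with mult show ?case
    by (intro exI[of _ "\<lambda>x i. f x * g' x i + f' x i * g x"])
       (auto intro!: flat_algebra.intros derivative_eq_intros)
qed

lemma flat_algebra_Ck: "flat_algebra f \<Longrightarrow> Ck_on k UNIV f"
proof (induction k arbitrary: f)
  case 0
  then show ?case using flat_algebra_derivative[OF 0]
    by (auto intro!: continuous_at_imp_continuous_on dest!: spec has_derivative_continuous)
next
  case (Suc k)
  obtain f' where f': "\<And>x. (f has_derivative f' x) (at x)" "\<And>i. flat_algebra (\<lambda>x. f' x i)"
    using flat_algebra_derivative[OF Suc.prems] by blast
  have "frechet_derivative f (at x) = f' x" for x
    using f'(1) by (metis frechet_derivative_at)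
  then show ?case using f' Suc.IH by (auto simp: differentiable_def)
qed

lemma flat_algebra_prod:
  "finite I \<Longrightarrow> (\<And>i. i \<in> I \<Longrightarrow> flat_algebra (f i)) \<Longrightarrow> flat_algebra (\<lambda>x. \<Prod>i\<in>I. f i x)"
  by (induction rule: finite_induct) (auto intro: flat_algebra.intros)

text \<open>The factor \<open>Suc n\<close> dilates the profile exp(-1/s) without moving its zero,
  so the bumps keep vanishing outside the box while they increase to 1 inside it. They serve as
  smooth approximations of the indicator of an open box.\<close>

definition box_bump :: "nat \<Rightarrow> 'a \<Rightarrow> 'a \<Rightarrow> 'a::euclidean_space \<Rightarrow> real" where
  "box_bump n a b x = (\<Prod>i\<in>Basis. flat_exp 1 (Suc n * ((x - a) \<bullet> i)) * flat_exp 1 (Suc n * ((b - x) \<bullet> i)))"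

lemma box_bump_smooth: "smooth_on UNIV (box_bump n a b)"
proof -
  \<comment> \<open>Each factor is written as \<open>flat_exp 1\<close> of an affine form
    \<open>c + x \<bullet> d\<close>, the shape of the generators of
    \<open>flat_algebra\<close>.\<close>
  have "flat_algebra (\<lambda>x. \<Prod>i\<in>Basis. flat_exp 1 (- (Suc n * (a \<bullet> i)) + x \<bullet> (Suc n *\<^sub>R i))
        * flat_exp 1 (Suc n * (b \<bullet> i) + x \<bullet> (- (Suc n *\<^sub>R i))))"
    by (intro flat_algebra_prod flat_algebra.intros) auto
  also have "(\<lambda>x. \<Prod>i\<in>Basis. flat_exp 1 (- (Suc n * (a \<bullet> i)) + x \<bullet> (Suc n *\<^sub>R i))
        * flat_exp 1 (Suc n * (b \<bullet> i) + x \<bullet> (- (Suc n *\<^sub>R i)))) = box_bump n a b"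
    by (simp add: box_bump_def fun_eq_iff algebra_simps)
  finally show ?thesis by (simp add: smooth_on_def flat_algebra_Ck)
qed

lemma flat_exp_1: "flat_exp 1 s = (if s \<le> 0 then 0 else exp (- inverse s))"
  by (simp add: flat_exp_def)

lemma flat_exp_1_range: "0 \<le> flat_exp 1 s" "flat_exp 1 s \<le> 1"
  by (auto simp: flat_exp_1)

lemma box_bump_range: "0 \<le> box_bump n a b x" "box_bump n a b x \<le> 1"
  unfolding box_bump_def
  by (intro prod_nonneg prod_le_1; simp add: flat_exp_1_range mult_le_one)+

lemma box_bump_outside: "x \<notin> box a b \<Longrightarrow> box_bump n a b x = 0"
proof -
  assume "x \<notin> box a b"
  then obtain i where "i \<in> Basis" "\<not> (a \<bullet> i < x \<bullet> i \<and> x \<bullet> i < b \<bullet> i)" by (auto simp: box_def)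
  then have "flat_exp 1 (Suc n * ((x - a) \<bullet> i)) * flat_exp 1 (Suc n * ((b - x) \<bullet> i)) = 0"
    by (auto simp: flat_exp_1 inner_diff_left mult_le_0_iff not_less)
  with \<open>i \<in> Basis\<close> show ?thesis unfolding box_bump_def by (intro prod_zero) auto
qed

lemma flat_exp_dilate_tendsto: "0 < s \<Longrightarrow> (\<lambda>n. flat_exp 1 (real (Suc n) * s)) \<longlonglongrightarrow> 1"
proof -
  assume s: "0 < s"
  have "(\<lambda>n. exp (- (inverse (real (Suc n)) * inverse s))) \<longlonglongrightarrow> exp (- (0 * inverse s))"
    by (intro tendsto_intros LIMSEQ_inverse_real_of_nat)
  then show ?thesis using s by (simp add: flat_exp_1 mult_le_0_iff flip: of_nat_Suc del: of_nat_Suc)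
qed

lemma box_bump_tendsto:
  assumes "x \<in> box a b" shows "(\<lambda>n. box_bump n a b x) \<longlonglongrightarrow> 1"
proof -
  have "(\<lambda>n. box_bump n a b x) \<longlonglongrightarrow> (\<Prod>i\<in>(Basis::'a set). 1 * 1)"
    unfolding box_bump_def
    by (intro tendsto_prod tendsto_mult flat_exp_dilate_tendsto)
       (use assms in \<open>auto simp: box_def inner_diff_left\<close>)
  then show ?thesis by simp
qed

lemma box_bump_test_function:
  assumes "cbox a b \<subseteq> \<Omega>" shows "box_bump n a b \<in> test_functions \<Omega>"
proof -
  have "{x. box_bump n a b x \<noteq> 0} \<subseteq> cbox a b" using box_bump_outside box_subset_cbox by blast
  then have "closure {x. box_bump n a b x \<noteq> 0} \<subseteq> cbox a b" by (rule closure_minimal[OF _ closed_cbox])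
  moreover from this have "compact (closure {x. box_bump n a b x \<noteq> 0})"
    by (meson bounded_cbox bounded_subset closed_closure compact_eq_bounded_closed)
  ultimately show ?thesis
    using assms by (auto simp: test_functions_def box_bump_smooth)
qed

section \<open>Vanishing against test functions\<close>

text \<open>A pi-lambda argument: open boxes are an intersection-stable generator of the Borel sets,
  so the integral of g cut off to \<open>box p q\<close> vanishes over every Borel set. The sets
  where this function is positive or negative must then be null.\<close>

lemma integral_zero_on_boxes_imp_AE_zero:
  fixes g :: "'a::euclidean_space \<Rightarrow> real"
  assumes g: "integrable lebesgue g"
    and box: "\<And>a b. cbox a b \<subseteq> cbox p q \<Longrightarrow> (LINT x:box a b|lebesgue. g x) = 0"
  shows "AE x in lebesgue. x \<in> box p q \<longrightarrow> g x = 0"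
proof -
  define h where "h x = indicator (box p q) x * g x" for x
  have h: "integrable lebesgue h"
    unfolding h_def using integrable_mult_indicator[OF _ g, of "box p q"] by simp
  have hs: "set_integrable lebesgue A h" if "A \<in> sets lebesgue" for A
    using integrable_mult_indicator[OF that h] by (simp only: set_integrable_def)
  have zero: "(LINT x:A|lebesgue. h x) = 0" if "A \<in> sets borel" for A
  proof -
    have box_zero: "(LINT x:box a b|lebesgue. h x) = 0" for a b
    proof -
      obtain c d where cd: "box a b \<inter> box p q = box c d" using box_Int_box[of a b p q] by blast
      have "(LINT x:box a b|lebesgue. h x) = (LINT x:box c d|lebesgue. g x)"
        unfolding set_lebesgue_integral_def cd[symmetric]
        by (intro Bochner_Integration.integral_cong) (auto simp: h_def indicator_def)
      also have "\<dots> = 0"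
      proof (cases "box c d = {}")
        case True
        then show ?thesis by (simp add: set_lebesgue_integral_def)
      next
        case False
        have "cbox c d = closure (box c d)" using False by (simp add: closure_box)
        also have "\<dots> \<subseteq> cbox p q"
          unfolding cd[symmetric] by (intro closure_minimal) (auto simp: box_subset_cbox[THEN subsetD])
        finally show ?thesis by (rule box)
      qed
      finally show ?thesis .
    qed
    \<comment> \<open>The complement case subtracts from the integral over the whole space, which is
      an integral over a box because of the cut-off.\<close>
    have UNIV_zero: "(LINT x:UNIV|lebesgue. h x) = 0"
    proof -
      have "(LINT x:UNIV|lebesgue. h x) = (LINT x:box p q|lebesgue. h x)"
        unfolding set_lebesgue_integral_def
        by (intro Bochner_Integration.integral_cong) (auto simp: h_def indicator_def)
      then show ?thesis using box_zero by simp
    qed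
    have sb: "sigma_sets UNIV (range (\<lambda>(a, b). box a b)) = sets (borel :: 'a measure)"
      by (subst borel_eq_box) simp
    have "Int_stable (range (\<lambda>(a, b). box a b :: 'a set))"
      by (auto simp: Int_stable_def box_Int_box)
    moreover have "range (\<lambda>(a, b). box a b :: 'a set) \<subseteq> Pow UNIV" by simp
    moreover have "A \<in> sigma_sets UNIV (range (\<lambda>(a, b). box a b))" using that unfolding sb .
    ultimately show ?thesis
    proof (induction rule: sigma_sets_induct_disjoint)
      case (basic A)
      then show ?case using box_zero by auto
    next
      case empty
      show ?case by (simp add: set_lebesgue_integral_def)
    next
      case (compl A)
      then have A: "A \<in> sets lebesgue" unfolding sb by auto
      have "(LINT x:UNIV|lebesgue. h x) = (LINT x:A \<union> (UNIV - A)|lebesgue. h x)" by simp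
      also have "\<dots> = (LINT x:A|lebesgue. h x) + (LINT x:UNIV - A|lebesgue. h x)"
        using sets.compl_sets[OF A] by (intro set_integral_Un hs A) auto
      finally show ?case using compl UNIV_zero by simp
    next
      case (union A)
      then have A: "A i \<in> sets lebesgue" for i unfolding sb by (auto intro!: sets_completionI_sets)
      have "(LINT x:(\<Union>i. A i)|lebesgue. h x) = (\<Sum>i. (LINT x:(A i)|lebesgue. h x))"
        using A union(1) by (intro lebesgue_integral_countable_add hs) (auto simp: disjoint_family_on_def)
      then show ?case using union by simp
    qed
  qed
  \<comment> \<open>\<open>zero\<close> covers Borel sets only, while h is merely Lebesgue
    measurable; the sign sets are therefore taken from a Borel version of h.\<close>
  obtain h' where h': "h' \<in> borel_measurable lborel" "AE x in lborel. h x = h' x"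
    using completion_ex_borel_measurable_real[of h lborel] h by auto
  have hh': "AE x in lebesgue. h x = h' x" using h'(2) by (rule AE_completion)
  have sets: "{x. h' x > 0} \<in> sets borel" "{x. h' x < 0} \<in> sets borel"
    using h'(1) by auto
  have ae: "AE x in lebesgue. \<not> s * h' x > 0" if s: "s \<in> {1, -1}" for s
  proof -
    let ?A = "{x. s * h' x > 0}"
    have A: "?A \<in> sets borel" using s sets by auto
    have i: "integrable lebesgue (\<lambda>x. indicator ?A x *\<^sub>R (s * h x))"
      using A by (intro integrable_mult_indicator integrable_mult_right h) auto
    have "(\<integral>x. indicator ?A x *\<^sub>R (s * h x) \<partial>lebesgue) = s * (LINT x:?A|lebesgue. h x)"
      unfolding set_lebesgue_integral_def by (subst integral_mult_right_zero[symmetric]) (simp add: mult_ac)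
    also have "\<dots> = 0" using zero[OF A] by simp
    finally have "AE x in lebesgue. indicator ?A x *\<^sub>R (s * h x) = 0"
      using hh' by (subst integral_nonneg_eq_0_iff_AE[OF i, symmetric]) (auto simp: indicator_def elim!: eventually_mono)
    with hh' show ?thesis by eventually_elim (auto simp: indicator_def split: if_splits)
  qed
  have "AE x in lebesgue. \<not> h' x > 0" "AE x in lebesgue. \<not> - h' x > 0"
    using ae[of 1] ae[of "-1"] by simp_all
  with hh' show ?thesis
    by eventually_elim (auto simp: h_def not_less)
qed

text \<open>The fundamental lemma of the calculus of variations. The bumps converge boundedly to the
  indicator of a box, so the integrals over boxes inside \<Omega> vanish; \<Omega> is a countable
  union of closed boxes, whose boundaries are null sets.\<close>

lemma test_function_integrals_zero_imp_AE_zero: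
  fixes G :: "'a::euclidean_space \<Rightarrow> real"
  assumes \<Omega>: "open \<Omega>" and G: "integrable (lebesgue_on \<Omega>) G"
    and zero: "\<And>\<phi>. \<phi> \<in> test_functions \<Omega> \<Longrightarrow> (\<integral>x. G x * \<phi> x \<partial>lebesgue_on \<Omega>) = 0"
  shows "AE x in lebesgue_on \<Omega>. G x = 0"
proof -
  have sets: "\<Omega> \<inter> space lebesgue \<in> sets lebesgue" using \<Omega> by simp
  define g where "g x = indicator \<Omega> x * G x" for x
  have g: "integrable lebesgue g"
    using G unfolding integrable_restrict_space[OF sets] g_def by simp
  have box: "(LINT x:box a b|lebesgue. g x) = 0" if "cbox a b \<subseteq> \<Omega>" for a b
  proof -
    have "(\<lambda>n. \<integral>x. box_bump n a b x * g x \<partial>lebesgue) \<longlonglongrightarrow> (LINT x:box a b|lebesgue. g x)"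
      unfolding set_lebesgue_integral_def
    proof (rule integral_dominated_convergence[where w = "\<lambda>x. norm (g x)"])
      show "integrable lebesgue (\<lambda>x. norm (g x))" using g by (rule integrable_norm)
      have "box_bump n a b \<in> borel_measurable borel" for n
        using box_bump_smooth[of n a b]
        by (intro borel_measurable_continuous_onI) (auto simp: smooth_on_def dest!: spec[of _ 0])
      then show "(\<lambda>x. box_bump n a b x * g x) \<in> borel_measurable lebesgue" for n
        by (intro borel_measurable_times borel_measurable_integrable[OF g]) (simp add: measurable_completion)
      show "(\<lambda>x. indicator (box a b) x *\<^sub>R g x) \<in> borel_measurable lebesgue"
        by (intro borel_measurable_integrable integrable_mult_indicator g) simp
      show "AE x in lebesgue. norm (box_bump n a b x * g x) \<le> norm (g x)" for n
        using box_bump_range[of n a b] by (auto simp: abs_mult mult_left_le_one_le)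
      show "AE x in lebesgue. (\<lambda>n. box_bump n a b x * g x) \<longlonglongrightarrow> indicator (box a b) x *\<^sub>R g x"
      proof (intro AE_I2)
        fix x
        show "(\<lambda>n. box_bump n a b x * g x) \<longlonglongrightarrow> indicator (box a b) x *\<^sub>R g x"
          using tendsto_mult[OF box_bump_tendsto tendsto_const, of x a b "g x"]
          by (cases "x \<in> box a b") (auto simp: box_bump_outside)
      qed
    qed
    moreover have "(\<integral>x. box_bump n a b x * g x \<partial>lebesgue) = 0" for n
      using zero[OF box_bump_test_function[OF that, of n]]
      unfolding integral_restrict_space[OF sets] g_def by (simp add: mult_ac)
    ultimately show ?thesis by (simp add: LIMSEQ_const_iff)
  qed
  obtain \<D> where D: "countable \<D>" "\<D> \<subseteq> Pow \<Omega>" "\<And>X. X \<in> \<D> \<Longrightarrow> \<exists>a b. X = cbox a b" "\<Union>\<D> = \<Omega>"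
    by (rule open_countable_Union_open_cbox[OF \<Omega>], rule that)
  have "AE x in lebesgue. x \<in> X \<longrightarrow> g x = 0" if XD: "X \<in> \<D>" for X
  proof -
    obtain p q where X: "X = cbox p q" using D(3)[OF XD] by auto
    have "X \<subseteq> \<Omega>" using D(2) XD by auto
    then have "AE x in lebesgue. x \<in> box p q \<longrightarrow> g x = 0"
      by (intro integral_zero_on_boxes_imp_AE_zero g box) (auto simp: X)
    moreover have "AE x in lebesgue. x \<notin> cbox p q - box p q"
      using negligible_frontier_interval[of p q] by (intro AE_not_in) (simp add: negligible_iff_null_sets)
    ultimately show ?thesis unfolding X by eventually_elim auto
  qed
  then have "AE x in lebesgue. \<forall>X\<in>\<D>. x \<in> X \<longrightarrow> g x = 0"
    by (subst AE_ball_countable[OF D(1)]) auto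
  then show ?thesis
    unfolding AE_restrict_space_iff[OF sets]
  proof eventually_elim
    case (elim x)
    show ?case
    proof
      assume "x \<in> \<Omega>"
      then obtain X where "X \<in> \<D>" "x \<in> X" using D(4) by blast
      then have "g x = 0" using elim by blast
      then show "G x = 0" using \<open>x \<in> \<Omega>\<close> by (simp add: g_def)
    qed
  qed
qed

section \<open>Integrals of derivatives of compactly supported functions\<close>

lemma compact_support_bounded:
  fixes f :: "'a::real_normed_vector \<Rightarrow> 'b::real_normed_vector"
  assumes "continuous_on UNIV f" "compact K" "\<And>x. x \<notin> K \<Longrightarrow> f x = 0"
  obtains B where "0 \<le> B" "\<And>x. norm (f x) \<le> B * indicator K x"
proof -
  have "bounded (f ` K)"
    using assms by (intro compact_imp_bounded compact_continuous_image continuous_on_subset[OF assms(1)]) auto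
  then obtain B where "0 < B" "\<forall>x\<in>K. norm (f x) \<le> B" by (auto simp: bounded_pos)
  then show ?thesis using assms(3) by (intro that[of B]) (auto simp: indicator_def)
qed

lemma compact_support_integrable:
  fixes f :: "'a::euclidean_space \<Rightarrow> real"
  assumes "continuous_on UNIV f" "compact K" "\<And>x. x \<notin> K \<Longrightarrow> f x = 0"
  shows "integrable lborel f"
proof -
  obtain B where B: "0 \<le> B" "\<And>x. norm (f x) \<le> B * indicator K x"
    using compact_support_bounded[OF assms] by blast
  have "integrable lborel (\<lambda>x. B * indicator K x)"
    using assms(2) emeasure_bounded_finite[OF compact_imp_bounded[OF assms(2)]]
    by (intro integrable_mult_right integrable_real_indicator) (auto simp: borel_compact)
  then show ?thesis
    by (rule Bochner_Integration.integrable_bound)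
       (use assms(1) B in \<open>auto intro: borel_measurable_continuous_onI\<close>)
qed

text \<open>By translation invariance every difference quotient of h has integral 0. The mean value
  theorem bounds the quotients by the maximum of |h'|, so dominated convergence passes to the
  derivative.\<close>

lemma integral_directional_derivative_zero:
  fixes h h' :: "'a::euclidean_space \<Rightarrow> real"
  assumes der: "\<And>x. ((\<lambda>t. h (x + t *\<^sub>R e)) has_real_derivative h' x) (at 0)"
    and h: "continuous_on UNIV h" and h': "continuous_on UNIV h'"
    and K: "compact K" "\<And>x. x \<notin> K \<Longrightarrow> h x = 0" "\<And>x. x \<notin> K \<Longrightarrow> h' x = 0"
  shows "(\<integral>x. h' x \<partial>lborel) = 0"
proof -
  define d where "d n = inverse (real (Suc n))" for n
  have d: "0 < d n" "d n \<le> 1" for n by (auto simp: d_def field_simps)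
  have d0: "filterlim d (at 0) sequentially"
    unfolding filterlim_at d_def using LIMSEQ_inverse_real_of_nat by auto
  obtain r where r: "\<And>x. x \<in> K \<Longrightarrow> norm x \<le> r"
    using compact_imp_bounded[OF K(1)] by (auto simp: bounded_iff)
  \<comment> \<open>The steps satisfy \<open>d n \<le> 1\<close>, so for x outside this ball both x
    and its translate lie outside K and the quotient is 0.\<close>
  define L where "L = cball (0 :: 'a) (r + norm e)"
  obtain B where B: "0 \<le> B" "\<And>x. norm (h' x) \<le> B * indicator K x"
    using compact_support_bounded[OF h' K(1,3)] by blast
  have B': "\<bar>h' x\<bar> \<le> B" for x using B(2)[of x] B(1) by (cases "x \<in> K") auto
  have line: "((\<lambda>s. h (x + s *\<^sub>R e)) has_real_derivative h' (x + t *\<^sub>R e)) (at t)" for x t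
  proof -
    have "((\<lambda>s. h (x + (s + t) *\<^sub>R e)) has_real_derivative h' (x + t *\<^sub>R e)) (at 0)"
      using der[of "x + t *\<^sub>R e"] by (simp add: algebra_simps)
    then show ?thesis using DERIV_shift[of "\<lambda>s. h (x + s *\<^sub>R e)" "h' (x + t *\<^sub>R e)" 0 t] by simp
  qed
  define q where "q n x = (h (x + d n *\<^sub>R e) - h x) / d n" for n x
  have "(\<lambda>n. \<integral>x. q n x \<partial>lborel) \<longlonglongrightarrow> (\<integral>x. h' x \<partial>lborel)"
  proof (rule integral_dominated_convergence[where w = "\<lambda>x. B * indicator L x"])
    show "h' \<in> borel_measurable lborel" using h' by (simp add: borel_measurable_continuous_onI)
    show "q n \<in> borel_measurable lborel" for n
      unfolding q_def measurable_lborel2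
      by (intro borel_measurable_continuous_onI continuous_intros continuous_on_compose2[OF h])
         (use d[of n] in auto)
    show "integrable lborel (\<lambda>x. B * indicator L x)"
      unfolding L_def using emeasure_bounded_finite[of "cball (0 :: 'a) (r + norm e)"]
      by (intro integrable_mult_right integrable_real_indicator) auto
    show "AE x in lborel. (\<lambda>n. q n x) \<longlonglongrightarrow> h' x"
    proof (intro AE_I2)
      fix x
      have "((\<lambda>t. (h (x + t *\<^sub>R e) - h x) / t) \<longlongrightarrow> h' x) (at 0)"
        using der[of x] by (simp add: DERIV_def)
      from filterlim_compose[OF this d0] show "(\<lambda>n. q n x) \<longlonglongrightarrow> h' x" unfolding q_def .
    qed
    show "AE x in lborel. norm (q n x) \<le> B * indicator L x" for n
    proof (intro AE_I2)
      fix x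
      show "norm (q n x) \<le> B * indicator L x"
      proof (cases "x \<in> L")
        case True
        obtain z where "h (x + d n *\<^sub>R e) - h (x + 0 *\<^sub>R e) = (d n - 0) * h' (x + z *\<^sub>R e)"
          using MVT2[OF d(1)[of n], of "\<lambda>s. h (x + s *\<^sub>R e)" "\<lambda>t. h' (x + t *\<^sub>R e)"] line by blast
        then have "q n x = h' (x + z *\<^sub>R e)" using d(1)[of n] by (simp add: q_def)
        then show ?thesis using True B' by simp
      next
        case False
        have "norm (d n *\<^sub>R e) \<le> norm e" using d[of n] by (simp add: mult_left_le_one_le)
        then have "norm x - norm e \<le> norm (x + d n *\<^sub>R e)"
          using norm_triangle_ineq4[of "x + d n *\<^sub>R e" "d n *\<^sub>R e"] by simp
        then have "x \<notin> K" "x + d n *\<^sub>R e \<notin> K"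
          using False r[of x] r[of "x + d n *\<^sub>R e"] norm_ge_zero[of e] by (auto simp: L_def simp del: norm_ge_zero)
        then show ?thesis using K(2) B(1) by (simp add: q_def)
      qed
    qed
  qed
  moreover have "(\<integral>x. q n x \<partial>lborel) = 0" for n
  proof -
    have i: "integrable lborel h" by (rule compact_support_integrable[OF h K(1,2)])
    have m: "h \<in> borel_measurable borel" using h by (rule borel_measurable_continuous_onI)
    have "integrable (distr lborel borel ((+) (d n *\<^sub>R e))) h" using i unfolding lborel_distr_plus .
    then have i': "integrable lborel (\<lambda>x. h (d n *\<^sub>R e + x))"
      using integrable_distr_eq[of "(+) (d n *\<^sub>R e)" lborel borel h] m by simp
    have "(\<integral>x. h x \<partial>lborel) = (\<integral>x. h x \<partial>distr lborel borel ((+) (d n *\<^sub>R e)))"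
      unfolding lborel_distr_plus ..
    also have "\<dots> = (\<integral>x. h (d n *\<^sub>R e + x) \<partial>lborel)" using m by (subst integral_distr) auto
    finally show ?thesis
      using Bochner_Integration.integral_diff[OF i' i] by (simp add: q_def add.commute)
  qed
  ultimately show ?thesis by (simp add: LIMSEQ_const_iff)
qed

section \<open>The Gagliardo-Nirenberg-Sobolev inequality\<close>

definition vec3 :: "real \<times> real \<times> real \<Rightarrow> real^3" where
  "vec3 p = fst p *\<^sub>R axis 1 1 + fst (snd p) *\<^sub>R axis 2 1 + snd (snd p) *\<^sub>R axis 3 1"

lemma vec3_nth [simp]: "vec3 p $ 1 = fst p" "vec3 p $ 2 = fst (snd p)" "vec3 p $ 3 = snd (snd p)"
  by (simp_all add: vec3_def axis_def)

lemma continuous_vec3: "continuous_on A vec3"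
  unfolding vec3_def by (intro continuous_intros)

lemma measurable_vec3 [measurable]: "vec3 \<in> borel_measurable borel"
  by (intro borel_measurable_continuous_onI continuous_vec3)

lemma prod_Basis_pair:
  fixes x :: "'a::euclidean_space" and y :: "'b::euclidean_space"
  shows "(\<Prod>b\<in>Basis. (x, y) \<bullet> b) = (\<Prod>b\<in>Basis. x \<bullet> b) * (\<Prod>b\<in>Basis. y \<bullet> b)"
proof -
  have "(\<Prod>b\<in>Basis. (x, y) \<bullet> b) = (\<Prod>b\<in>(\<lambda>u. (u, 0)) ` Basis. (x, y) \<bullet> b) * (\<Prod>b\<in>(\<lambda>v. (0, v)) ` Basis. (x, y) \<bullet> b)"
    unfolding Basis_prod_def by (rule prod.union_disjoint) auto
  then show ?thesis by (simp add: prod.reindex inj_on_def)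
qed

lemma prod_Basis_vec:
  fixes x :: "real ^ 'n"
  shows "(\<Prod>b\<in>Basis. x \<bullet> b) = (\<Prod>i\<in>UNIV. x $ i)"
proof -
  have B: "(Basis :: (real ^ 'n) set) = range (\<lambda>i. axis i 1)"
    by (auto simp: Basis_vec_def)
  show ?thesis
    unfolding B by (subst prod.reindex) (auto simp: inj_on_def axis_eq_axis inner_axis)
qed

text \<open>Lebesgue measure is determined by its values on boxes, and the preimage of a box under
  \<open>vec3\<close> is a box of the same volume. This makes Fubini's theorem for nested products
  available on \<open>real^3\<close>.\<close>

lemma lborel_vec3: "lborel = distr lborel borel vec3"
proof (rule lborel_eqI)
  fix l u :: "real^3" assume lu: "\<And>b. b \<in> Basis \<Longrightarrow> l \<bullet> b \<le> u \<bullet> b"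
  have le: "l $ i \<le> u $ i" for i
    using lu[of "axis i 1"] by (simp add: inner_axis axis_in_Basis_iff)
  let ?l = "(l $ 1, l $ 2, l $ 3)" and ?u = "(u $ 1, u $ 2, u $ 3)"
  have "vec3 -` box l u = box ?l ?u"
    by (auto simp: mem_box_cart mem_box Basis_prod_def forall_3)
  then have "emeasure (distr lborel borel vec3) (box l u) = emeasure lborel (box ?l ?u)"
    by (subst emeasure_distr) auto
  also have "\<dots> = (\<Prod>b\<in>Basis. (?u - ?l) \<bullet> b)"
    by (rule emeasure_lborel_box) (use le in \<open>auto simp: Basis_prod_def\<close>)
  also have "(\<Prod>b\<in>Basis. (?u - ?l) \<bullet> b) = (u $ 1 - l $ 1) * (u $ 2 - l $ 2) * (u $ 3 - l $ 3)"
    by (simp add: prod_Basis_pair)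
  also have "\<dots> = (\<Prod>b\<in>Basis. (u - l) \<bullet> b)"
    unfolding prod_Basis_vec UNIV_3 by simp
  finally show "emeasure (distr lborel borel vec3) (box l u) = (\<Prod>b\<in>Basis. (u - l) \<bullet> b)" .
qed simp

lemma borel_measurable_pair_lborel_iff:
  "f \<in> borel_measurable (borel \<Otimes>\<^sub>M lborel) \<longleftrightarrow> f \<in> borel_measurable borel"
  "f \<in> borel_measurable (lborel \<Otimes>\<^sub>M lborel) \<longleftrightarrow> f \<in> borel_measurable borel"
  for f :: "'a::euclidean_space \<times> 'b::euclidean_space \<Rightarrow> 'c::topological_space"
proof -
  have "sets (borel \<Otimes>\<^sub>M (lborel :: 'b measure)) = sets (borel :: ('a \<times> 'b) measure)"
    unfolding borel_prod[symmetric] by (intro sets_pair_measure_cong) auto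
  then show "f \<in> borel_measurable (borel \<Otimes>\<^sub>M lborel) \<longleftrightarrow> f \<in> borel_measurable borel"
    by (simp cong: measurable_cong_sets)
qed (simp add: lborel_prod)

lemma nn_integral_lborel_pair:
  fixes g :: "'a::euclidean_space \<times> 'b::euclidean_space \<Rightarrow> ennreal"
  assumes "g \<in> borel_measurable borel"
  shows "(\<integral>\<^sup>+q. g q \<partial>lborel) = (\<integral>\<^sup>+x. \<integral>\<^sup>+y. g (x, y) \<partial>lborel \<partial>lborel)"
    and "(\<integral>\<^sup>+q. g q \<partial>lborel) = (\<integral>\<^sup>+y. \<integral>\<^sup>+x. g (x, y) \<partial>lborel \<partial>lborel)"
proof -
  have g: "g \<in> borel_measurable (lborel \<Otimes>\<^sub>M lborel)"
    using assms by (simp add: borel_measurable_pair_lborel_iff)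
  show "(\<integral>\<^sup>+q. g q \<partial>lborel) = (\<integral>\<^sup>+x. \<integral>\<^sup>+y. g (x, y) \<partial>lborel \<partial>lborel)"
    using lborel.nn_integral_fst[OF g] by (simp add: lborel_prod)
  show "(\<integral>\<^sup>+q. g q \<partial>lborel) = (\<integral>\<^sup>+y. \<integral>\<^sup>+x. g (x, y) \<partial>lborel \<partial>lborel)"
    using lborel_pair.nn_integral_snd[OF g] by (simp add: lborel_prod)
qed

text \<open>The last three forms put one coordinate each innermost, with q collecting the other two.
  They let an integral over space be read as one over the lines parallel to any chosen axis.\<close>

lemma nn_integral_vec3:
  assumes [measurable]: "f \<in> borel_measurable borel"
  shows "(\<integral>\<^sup>+x. f x \<partial>lborel) = (\<integral>\<^sup>+x. \<integral>\<^sup>+q. f (vec3 (x, q)) \<partial>lborel \<partial>lborel)"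
    and "(\<integral>\<^sup>+x. f x \<partial>lborel) = (\<integral>\<^sup>+q. \<integral>\<^sup>+x. f (vec3 (x, q)) \<partial>lborel \<partial>lborel)"
    and "(\<integral>\<^sup>+x. f x \<partial>lborel) = (\<integral>\<^sup>+q. \<integral>\<^sup>+y. f (vec3 (fst q, y, snd q)) \<partial>lborel \<partial>lborel)"
    and "(\<integral>\<^sup>+x. f x \<partial>lborel) = (\<integral>\<^sup>+q. \<integral>\<^sup>+z. f (vec3 (fst q, snd q, z)) \<partial>lborel \<partial>lborel)"
proof -
  have m: "(\<lambda>p. f (vec3 (g p))) \<in> borel_measurable borel" if "continuous_on UNIV g"
    for g :: "'z::topological_space \<Rightarrow> real \<times> real \<times> real"
    using measurable_compose[OF borel_measurable_continuous_onI assms,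
        OF continuous_on_compose2[OF continuous_vec3[of UNIV] that subset_UNIV]] .
  have mp: "(\<lambda>p. f (vec3 p)) \<in> borel_measurable (lborel \<Otimes>\<^sub>M lborel)"
    unfolding borel_measurable_pair_lborel_iff by (intro m continuous_intros)
  have "(\<integral>\<^sup>+x. f x \<partial>lborel) = (\<integral>\<^sup>+p. f (vec3 p) \<partial>lborel)"
    by (subst lborel_vec3, subst nn_integral_distr) auto
  also have "\<dots> = (\<integral>\<^sup>+p. f (vec3 p) \<partial>(lborel \<Otimes>\<^sub>M lborel))" by (simp add: lborel_prod)
  also have "\<dots> = (\<integral>\<^sup>+x. \<integral>\<^sup>+q. f (vec3 (x, q)) \<partial>lborel \<partial>lborel)"
    by (subst lborel.nn_integral_fst[OF mp, symmetric]) simp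
  finally show 1: "(\<integral>\<^sup>+x. f x \<partial>lborel) = (\<integral>\<^sup>+x. \<integral>\<^sup>+q. f (vec3 (x, q)) \<partial>lborel \<partial>lborel)" .
  then show "(\<integral>\<^sup>+x. f x \<partial>lborel) = (\<integral>\<^sup>+q. \<integral>\<^sup>+x. f (vec3 (x, q)) \<partial>lborel \<partial>lborel)"
    by (subst lborel_pair.Fubini'[symmetric]) (auto simp: case_prod_beta' mp)
  note 3 = nn_integral_lborel_pair(1)
  have 2: "(\<integral>\<^sup>+x. f x \<partial>lborel) = (\<integral>\<^sup>+x. \<integral>\<^sup>+y. \<integral>\<^sup>+z. f (vec3 (x, y, z)) \<partial>lborel \<partial>lborel \<partial>lborel)"
    unfolding 1 by (intro nn_integral_cong 3 m continuous_intros)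
  have mz: "(\<lambda>q. \<integral>\<^sup>+z. f (vec3 (fst q, snd q, z)) \<partial>lborel) \<in> borel_measurable borel"
    by (rule lborel.borel_measurable_nn_integral)
       (simp add: case_prod_beta' borel_measurable_pair_lborel_iff m continuous_intros)
  have my: "(\<lambda>q. \<integral>\<^sup>+y. f (vec3 (fst q, y, snd q)) \<partial>lborel) \<in> borel_measurable borel"
    by (rule lborel.borel_measurable_nn_integral)
       (simp add: case_prod_beta' borel_measurable_pair_lborel_iff m continuous_intros)
  show "(\<integral>\<^sup>+x. f x \<partial>lborel) = (\<integral>\<^sup>+q. \<integral>\<^sup>+z. f (vec3 (fst q, snd q, z)) \<partial>lborel \<partial>lborel)"
    unfolding 2 by (subst 3[OF mz]) simp
  have "(\<integral>\<^sup>+y. \<integral>\<^sup>+z. f (vec3 (x, y, z)) \<partial>lborel \<partial>lborel) = (\<integral>\<^sup>+z. \<integral>\<^sup>+y. f (vec3 (x, y, z)) \<partial>lborel \<partial>lborel)" for x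
    by (rule lborel_pair.Fubini'[symmetric])
       (simp add: case_prod_beta' borel_measurable_pair_lborel_iff m continuous_intros)
  then show "(\<integral>\<^sup>+x. f x \<partial>lborel) = (\<integral>\<^sup>+q. \<integral>\<^sup>+y. f (vec3 (fst q, y, snd q)) \<partial>lborel \<partial>lborel)"
    unfolding 2 by (subst 3[OF my]) simp
qed

text \<open>With q = (y, z) the three factors depend on (y, z), (x, z) and (x, y). Cauchy-Schwarz in
  q splits off f, Cauchy-Schwarz in x splits g from h, and what is left is a product of a function
  of z and a function of y.\<close>

lemma Loomis_Whitney:
  fixes f g h :: "real \<times> real \<Rightarrow> ennreal"
  assumes "f \<in> borel_measurable borel" "g \<in> borel_measurable borel" "h \<in> borel_measurable borel"
  shows "(\<integral>\<^sup>+q. \<integral>\<^sup>+x. f q * g (x, snd q) * h (x, fst q) \<partial>lborel \<partial>lborel)\<^sup>2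
    \<le> (\<integral>\<^sup>+q. (f q)\<^sup>2 \<partial>lborel) * (\<integral>\<^sup>+q. (g q)\<^sup>2 \<partial>lborel) * (\<integral>\<^sup>+q. (h q)\<^sup>2 \<partial>lborel)"
proof -
  have comp: "(\<lambda>p. f (c p)) \<in> borel_measurable borel"
    if "f \<in> borel_measurable borel" "continuous_on UNIV c"
    for f :: "real \<times> real \<Rightarrow> ennreal" and c :: "'z::topological_space \<Rightarrow> real \<times> real"
    using measurable_compose[OF borel_measurable_continuous_onI[OF that(2)] that(1)] .
  note pm = borel_measurable_pair_lborel_iff[THEN iffD2]
  have swap: "(\<integral>\<^sup>+q. (g q)\<^sup>2 \<partial>lborel) = (\<integral>\<^sup>+y. \<integral>\<^sup>+x. (g (x, y))\<^sup>2 \<partial>lborel \<partial>lborel)"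
    if g: "g \<in> borel_measurable borel" for g :: "real \<times> real \<Rightarrow> ennreal"
    using nn_integral_lborel_pair(2)[of "\<lambda>q. (g q)\<^sup>2"] borel_measurable_power_ennreal[OF g] by blast
  define P where "P q = (\<integral>\<^sup>+x. g (x, snd q) * h (x, fst q) \<partial>lborel)" for q
  have P: "P \<in> borel_measurable borel"
    unfolding P_def
    by (rule lborel.borel_measurable_nn_integral, unfold case_prod_beta',
        intro pm(1) borel_measurable_times_ennreal comp[OF assms(2)] comp[OF assms(3)] continuous_intros)
  define A where "A y = (\<integral>\<^sup>+x. (g (x, y))\<^sup>2 \<partial>lborel)" for y
  define B where "B y = (\<integral>\<^sup>+x. (h (x, y))\<^sup>2 \<partial>lborel)" for y
  have A: "A \<in> borel_measurable borel"
    unfolding A_def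
    by (rule lborel.borel_measurable_nn_integral, unfold case_prod_beta',
        intro pm(1) borel_measurable_power_ennreal comp[OF assms(2)] comp[OF assms(3)] continuous_intros)
  have B: "B \<in> borel_measurable borel"
    unfolding B_def
    by (rule lborel.borel_measurable_nn_integral, unfold case_prod_beta',
        intro pm(1) borel_measurable_power_ennreal comp[OF assms(2)] comp[OF assms(3)] continuous_intros)
  have gh: "(\<lambda>x. g (x, y)) \<in> borel_measurable borel" "(\<lambda>x. h (x, y)) \<in> borel_measurable borel" for y
    by (intro comp[OF assms(2)] comp[OF assms(3)] continuous_intros)+
  have ghl: "(\<lambda>x. g (x, y)) \<in> borel_measurable lborel" "(\<lambda>x. h (x, y)) \<in> borel_measurable lborel" for y
    using gh by simp_all
  have "(\<integral>\<^sup>+x. f q * g (x, snd q) * h (x, fst q) \<partial>lborel) = f q * P q" for q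
    unfolding P_def mult.assoc by (intro nn_integral_cmult borel_measurable_times_ennreal ghl)
  then have "(\<integral>\<^sup>+q. \<integral>\<^sup>+x. f q * g (x, snd q) * h (x, fst q) \<partial>lborel \<partial>lborel)\<^sup>2
      \<le> (\<integral>\<^sup>+q. (f q)\<^sup>2 \<partial>lborel) * (\<integral>\<^sup>+q. (P q)\<^sup>2 \<partial>lborel)"
    using Cauchy_Schwarz_nn_integral[of f lborel P] assms(1) P by simp
  also have "(\<integral>\<^sup>+q. (P q)\<^sup>2 \<partial>lborel) \<le> (\<integral>\<^sup>+q. A (snd q) * B (fst q) \<partial>lborel)"
    unfolding P_def A_def B_def
    by (intro nn_integral_mono Cauchy_Schwarz_nn_integral ghl)
  also have "\<dots> = (\<integral>\<^sup>+x. \<integral>\<^sup>+y. A y * B x \<partial>lborel \<partial>lborel)"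
    by (subst nn_integral_lborel_pair(1), rule borel_measurable_times_ennreal[OF measurable_compose[OF _ A]
          measurable_compose[OF _ B]]; (intro borel_measurable_continuous_onI continuous_intros)?; simp)
  also have "\<dots> = (\<integral>\<^sup>+q. (g q)\<^sup>2 \<partial>lborel) * (\<integral>\<^sup>+q. (h q)\<^sup>2 \<partial>lborel)"
    unfolding swap[OF assms(2)] swap[OF assms(3)] A_def[symmetric] B_def[symmetric]
    using A B by (simp add: nn_integral_cmult nn_integral_multc)
  finally show ?thesis by (simp add: mult.assoc mult_left_mono)
qed

lemma compactly_supported_line_bound:
  fixes v v' :: "real \<Rightarrow> real"
  assumes der: "\<And>t. (v has_real_derivative v' t) (at t)" and v': "continuous_on UNIV v'"
    and R: "\<And>t. R < \<bar>t\<bar> \<Longrightarrow> v t = 0"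
  shows "ennreal \<bar>v x\<bar> \<le> (\<integral>\<^sup>+t. ennreal \<bar>v' t\<bar> \<partial>lborel)"
proof -
  define a where "a = - \<bar>x\<bar> - \<bar>R\<bar> - 1"
  have a: "a \<le> x" "v a = 0" by (auto simp: a_def intro!: R)
  have "(v' has_integral v x - v a) {a..x}"
    using a(1) der by (intro fundamental_theorem_of_calculus)
      (auto simp: has_real_derivative_iff_has_vector_derivative[symmetric] intro: has_field_derivative_at_within)
  then have v: "integral {a..x} v' = v x" using a(2) by auto
  have c: "continuous_on {a..x} (\<lambda>t. \<bar>v' t\<bar>)"
    by (intro continuous_intros continuous_on_subset[OF v']) auto
  then have i: "(\<lambda>t. \<bar>v' t\<bar>) integrable_on {a..x}" by (rule integrable_continuous_real)
  have "norm (integral {a..x} v') \<le> integral {a..x} (\<lambda>t. \<bar>v' t\<bar>)"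
    by (intro integral_norm_bound_integral i integrable_continuous_real continuous_on_subset[OF v']) auto
  then have "\<bar>v x\<bar> \<le> integral {a..x} (\<lambda>t. \<bar>v' t\<bar>)" by (simp add: v)
  then have "ennreal \<bar>v x\<bar> \<le> ennreal (integral {a..x} (\<lambda>t. \<bar>v' t\<bar>))" by (rule ennreal_leI)
  also have "\<dots> = (\<integral>\<^sup>+t. ennreal (indicator {a..x} t * \<bar>v' t\<bar>) \<partial>lborel)"
    using nn_integral_has_integral_lebesgue[OF _ integrable_integral[OF i]] by simp
  also have "\<dots> \<le> (\<integral>\<^sup>+t. ennreal \<bar>v' t\<bar> \<partial>lborel)"
    by (intro nn_integral_mono ennreal_leI) (auto simp: indicator_def)
  finally show ?thesis .
qed

text \<open>\<open>u\<^sup>4\<close> is bounded by the integral \<open>a\<^sub>i\<close> of \<open>\<bar>\<partial>\<^sub>i (u\<^sup>4)\<bar>\<close> along each of the three coordinate lines, and the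
  Loomis-Whitney inequality is applied to \<open>u\<^sup>6 \<le> \<surd>(a\<^sub>1 a\<^sub>2 a\<^sub>3)\<close>.\<close>

lemma Gagliardo_Nirenberg_Sobolev:
  fixes u :: "real^3 \<Rightarrow> real" and g :: "3 \<Rightarrow> real^3 \<Rightarrow> real"
  assumes der: "\<And>x i. ((\<lambda>t. u (x + t *\<^sub>R axis i 1)) has_real_derivative g i x) (at 0)"
    and u: "continuous_on UNIV u" and g: "\<And>i. continuous_on UNIV (g i)"
    and R: "\<And>x. R < norm x \<Longrightarrow> u x = 0"
  shows "(\<integral>\<^sup>+x. ennreal (u x ^ 6) \<partial>lborel) \<le> 4096 * (\<integral>\<^sup>+x. ennreal (\<Sum>i\<in>UNIV. (g i x)\<^sup>2) \<partial>lborel) ^ 3"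
proof -
  define w where "w i x = 4 * u x ^ 3 * g i x" for i x
  have w: "continuous_on UNIV (w i)" for i
    unfolding w_def by (intro continuous_intros u g)
  have wm: "(\<lambda>x. ennreal \<bar>w i x\<bar>) \<in> borel_measurable borel" for i
    by (intro measurable_compose[OF _ measurable_ennreal] borel_measurable_continuous_onI continuous_intros w)
  have "\<exists>B. \<forall>x. \<bar>w i x\<bar> \<le> B * indicator (cball 0 R) x" for i
  proof -
    have "bounded (w i ` cball 0 R)"
      by (intro compact_imp_bounded compact_continuous_image continuous_on_subset[OF w]) auto
    then obtain B where "\<forall>x\<in>cball 0 R. \<bar>w i x\<bar> \<le> B" by (auto simp: bounded_iff)
    then have "\<bar>w i x\<bar> \<le> B * indicator (cball 0 R) x" for x
      using R[of x] by (cases "x \<in> cball 0 R") (auto simp: w_def)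
    then show ?thesis by blast
  qed
  then obtain B where B: "\<And>i x. \<bar>w i x\<bar> \<le> B i * indicator (cball 0 R) x" by metis
  \<comment> \<open>\<open>c\<close> runs along a line parallel to axis i and is parametrised by its
    own i-th coordinate. Hence |s| is at most the norm of \<open>c s\<close>, and the integrand
    vanishes for |s| > R.\<close>
  have line: "ennreal (u (c t) ^ 4) \<le> (\<integral>\<^sup>+s. ennreal \<bar>w i (c s)\<bar> \<partial>lborel)"
    and fin: "(\<integral>\<^sup>+s. ennreal \<bar>w i (c s)\<bar> \<partial>lborel) < top"
    if c: "\<And>t s. c (t + s) = c t + s *\<^sub>R axis i 1" and ci: "\<And>t. c t $ i = t" for c :: "real \<Rightarrow> real^3" and i t
  proof -
    have cc: "continuous_on UNIV c"
    proof -
      have "continuous_on UNIV (\<lambda>s. c 0 + s *\<^sub>R axis i 1)" by (intro continuous_intros)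
      also have "(\<lambda>s. c 0 + s *\<^sub>R axis i 1) = c"
      proof
        show "c 0 + s *\<^sub>R axis i 1 = c s" for s using c[of 0 s] by (simp only: add_0)
      qed
      finally show ?thesis .
    qed
    have big: "\<bar>s\<bar> \<le> norm (c s)" for s using component_le_norm_cart[of "c s" i] ci by simp
    have "((\<lambda>s. u (c s)) has_real_derivative g i (c t)) (at t)" for t
    proof -
      have "((\<lambda>s. u (c (s + t))) has_real_derivative g i (c t)) (at 0)"
        using der[of "c t" i] by (simp only: c[symmetric] add.commute)
      then show ?thesis using DERIV_shift[of "\<lambda>s. u (c s)" "g i (c t)" 0 t] by simp
    qed
    from DERIV_power[OF this, of 4]
    have "((\<lambda>s. u (c s) ^ 4) has_real_derivative w i (c t)) (at t)" for t
      by (simp add: w_def mult_ac)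
    then have "ennreal \<bar>u (c t) ^ 4\<bar> \<le> (\<integral>\<^sup>+s. ennreal \<bar>w i (c s)\<bar> \<partial>lborel)"
    proof (rule compactly_supported_line_bound)
      show "continuous_on UNIV (\<lambda>s. w i (c s))" by (rule continuous_on_compose2[OF w cc]) auto
      show "u (c t) ^ 4 = 0" if "R < \<bar>t\<bar>" for t using R[of "c t"] big[of t] that by simp
    qed
    then show "ennreal (u (c t) ^ 4) \<le> (\<integral>\<^sup>+s. ennreal \<bar>w i (c s)\<bar> \<partial>lborel)" by simp
    have "(\<integral>\<^sup>+s. ennreal \<bar>w i (c s)\<bar> \<partial>lborel) \<le> (\<integral>\<^sup>+s. ennreal \<bar>B i\<bar> * indicator {-R..R} s \<partial>lborel)"
    proof (intro nn_integral_mono)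
      fix s
      have "\<bar>w i (c s)\<bar> \<le> \<bar>B i\<bar> * indicator {-R..R} s"
        using B[of i "c s"] big[of s] by (cases "norm (c s) \<le> R") (auto split: split_indicator)
      then have "ennreal \<bar>w i (c s)\<bar> \<le> ennreal (\<bar>B i\<bar> * indicator {-R..R} s)" by (rule ennreal_leI)
      then show "ennreal \<bar>w i (c s)\<bar> \<le> ennreal \<bar>B i\<bar> * indicator {-R..R} s"
        by (auto simp: indicator_def split: if_splits)
    qed
    also have "\<dots> < top"
      using emeasure_bounded_finite[of "{-R..R}"]
      by (subst nn_integral_cmult_indicator) (auto simp: ennreal_mult_less_top infinity_ennreal_def)
    finally show "(\<integral>\<^sup>+s. ennreal \<bar>w i (c s)\<bar> \<partial>lborel) < top" .
  qed
  \<comment> \<open>A square root on \<open>ennreal\<close> that is correct for finite arguments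
    only; this is what the finiteness of \<open>a1\<close>, \<open>a2\<close> and \<open>a3\<close>
    is for.\<close>
  define r where "r a = ennreal (sqrt (enn2real a))" for a
  have r2: "(r a)\<^sup>2 = a" if "a < top" for a
    unfolding r_def using that by (subst ennreal_power) (auto simp: enn2real_nonneg)
  have r_le: "ennreal (x\<^sup>2) \<le> r a" if "ennreal (x ^ 4) \<le> a" "a < top" for x a
  proof -
    have "x ^ 4 \<le> enn2real a" using that by (metis enn2real_nonneg ennreal_enn2real ennreal_le_iff)
    then have "(x\<^sup>2)\<^sup>2 \<le> enn2real a" by simp
    then show ?thesis unfolding r_def by (intro ennreal_leI real_le_rsqrt)
  qed
  have rm: "(\<lambda>q. r (a q)) \<in> borel_measurable M" if "a \<in> borel_measurable M" for a and M :: "'z measure"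
    unfolding r_def using that by measurable
  have wcm: "(\<lambda>p. ennreal \<bar>w i (vec3 (c p))\<bar>) \<in> borel_measurable (borel \<Otimes>\<^sub>M lborel)" if "continuous_on UNIV c"
    for i and c :: "(real \<times> real) \<times> real \<Rightarrow> real \<times> real \<times> real"
    unfolding borel_measurable_pair_lborel_iff
    by (rule measurable_compose[OF borel_measurable_continuous_onI wm])
       (rule continuous_on_compose2[OF continuous_vec3[of UNIV] that subset_UNIV])
  define a1 where "a1 q = (\<integral>\<^sup>+x. ennreal \<bar>w 1 (vec3 (x, q))\<bar> \<partial>lborel)" for q
  define a2 where "a2 q = (\<integral>\<^sup>+y. ennreal \<bar>w 2 (vec3 (fst q, y, snd q))\<bar> \<partial>lborel)" for q
  define a3 where "a3 q = (\<integral>\<^sup>+z. ennreal \<bar>w 3 (vec3 (fst q, snd q, z))\<bar> \<partial>lborel)" for q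
  have c: "vec3 (t + s, q) = vec3 (t, q) + s *\<^sub>R axis 1 1" "vec3 (x, t + s, z) = vec3 (x, t, z) + s *\<^sub>R axis 2 1"
    "vec3 (x, y, t + s) = vec3 (x, y, t) + s *\<^sub>R axis 3 1" for t s q x y z
    by (simp_all add: vec3_def algebra_simps)
  have a1: "ennreal (u (vec3 (t, q)) ^ 4) \<le> a1 q" "a1 q < top" for t q
    using line[of "\<lambda>t. vec3 (t, q)" 1 t] fin[of "\<lambda>t. vec3 (t, q)" 1] by (simp_all add: c a1_def)
  have a2: "ennreal (u (vec3 (x, t, z)) ^ 4) \<le> a2 (x, z)" "a2 (x, z) < top" for t x z
    using line[of "\<lambda>t. vec3 (x, t, z)" 2 t] fin[of "\<lambda>t. vec3 (x, t, z)" 2] by (simp_all add: c a2_def)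
  have a3: "ennreal (u (vec3 (x, y, t)) ^ 4) \<le> a3 (x, y)" "a3 (x, y) < top" for t x y
    using line[of "\<lambda>t. vec3 (x, y, t)" 3 t] fin[of "\<lambda>t. vec3 (x, y, t)" 3] by (simp_all add: c a3_def)
  have m1: "a1 \<in> borel_measurable borel" unfolding a1_def
    by (rule lborel.borel_measurable_nn_integral, unfold case_prod_beta', rule wcm, intro continuous_intros)
  have m2: "a2 \<in> borel_measurable borel" unfolding a2_def
    by (rule lborel.borel_measurable_nn_integral, unfold case_prod_beta', rule wcm, intro continuous_intros)
  have m3: "a3 \<in> borel_measurable borel" unfolding a3_def
    by (rule lborel.borel_measurable_nn_integral, unfold case_prod_beta', rule wcm, intro continuous_intros)
  define I where "I = (\<integral>\<^sup>+x. ennreal (u x ^ 6) \<partial>lborel)"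
  define D where "D = (\<integral>\<^sup>+x. ennreal (\<Sum>i\<in>UNIV. (g i x)\<^sup>2) \<partial>lborel)"
  define W where "W i = (\<integral>\<^sup>+x. ennreal \<bar>w i x\<bar> \<partial>lborel)" for i
  have I: "I = (\<integral>\<^sup>+q. \<integral>\<^sup>+x. ennreal (u (vec3 (x, q)) ^ 6) \<partial>lborel \<partial>lborel)"
    unfolding I_def
    by (rule nn_integral_vec3(2)) (intro measurable_compose[OF _ measurable_ennreal]
        borel_measurable_continuous_onI continuous_intros u)
  also have "\<dots> \<le> (\<integral>\<^sup>+q. \<integral>\<^sup>+x. r (a1 q) * r (a2 (x, snd q)) * r (a3 (x, fst q)) \<partial>lborel \<partial>lborel)"
  proof (intro nn_integral_mono)
    fix q x
    let ?u = "u (vec3 (x, q))"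
    have "ennreal (?u\<^sup>2) \<le> r (a1 q)" "ennreal (?u\<^sup>2) \<le> r (a2 (x, snd q))" "ennreal (?u\<^sup>2) \<le> r (a3 (x, fst q))"
      using r_le[OF a1, of x q] r_le[OF a2, of x "fst q" "snd q"] r_le[OF a3, of x "fst q" "snd q"] by simp_all
    then have "ennreal (?u\<^sup>2) * ennreal (?u\<^sup>2) * ennreal (?u\<^sup>2) \<le> r (a1 q) * r (a2 (x, snd q)) * r (a3 (x, fst q))"
      by (intro mult_mono) auto
    moreover have "ennreal (?u ^ 6) = ennreal (?u\<^sup>2) * ennreal (?u\<^sup>2) * ennreal (?u\<^sup>2)"
      by (simp add: ennreal_mult[symmetric] power_add[symmetric])
    ultimately show "ennreal (?u ^ 6) \<le> r (a1 q) * r (a2 (x, snd q)) * r (a3 (x, fst q))" by simp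
  qed
  finally have "I\<^sup>2 \<le> (\<integral>\<^sup>+q. \<integral>\<^sup>+x. r (a1 q) * r (a2 (x, snd q)) * r (a3 (x, fst q)) \<partial>lborel \<partial>lborel)\<^sup>2"
    by (intro power_mono) auto
  also have "\<dots> \<le> (\<integral>\<^sup>+q. (r (a1 q))\<^sup>2 \<partial>lborel) * (\<integral>\<^sup>+q. (r (a2 q))\<^sup>2 \<partial>lborel) * (\<integral>\<^sup>+q. (r (a3 q))\<^sup>2 \<partial>lborel)"
    by (rule Loomis_Whitney[OF rm[OF m1] rm[OF m2] rm[OF m3]])
  also have "(\<integral>\<^sup>+q. (r (a1 q))\<^sup>2 \<partial>lborel) = (\<integral>\<^sup>+q. a1 q \<partial>lborel)"
    by (simp only: r2[OF a1(2)])
  also have "\<dots> = W 1" unfolding a1_def W_def by (rule nn_integral_vec3(2)[OF wm, symmetric])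
  also have "(\<integral>\<^sup>+q. (r (a2 q))\<^sup>2 \<partial>lborel) = (\<integral>\<^sup>+q. a2 q \<partial>lborel)"
    using r2[OF a2(2)] by (intro nn_integral_cong) (metis surj_pair)
  also have "\<dots> = W 2" unfolding a2_def W_def by (rule nn_integral_vec3(3)[OF wm, symmetric])
  also have "(\<integral>\<^sup>+q. (r (a3 q))\<^sup>2 \<partial>lborel) = (\<integral>\<^sup>+q. a3 q \<partial>lborel)"
    using r2[OF a3(2)] by (intro nn_integral_cong) (metis surj_pair)
  also have "\<dots> = W 3" unfolding a3_def W_def by (rule nn_integral_vec3(4)[OF wm, symmetric])
  finally have IW: "I\<^sup>2 \<le> W 1 * W 2 * W 3" .
  \<comment> \<open>Cauchy-Schwarz for the product of 4 |u|^3 and |g i|: the square of the first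
    factor is 16 u^6, which brings I back.\<close>
  have W: "(W i)\<^sup>2 \<le> 16 * I * D" for i
  proof -
    have mu: "(\<lambda>x. ennreal (4 * \<bar>u x\<bar> ^ 3)) \<in> borel_measurable lborel" "(\<lambda>x. ennreal \<bar>g i x\<bar>) \<in> borel_measurable lborel"
      "(\<lambda>x. ennreal (u x ^ 6)) \<in> borel_measurable lborel"
      unfolding measurable_lborel2
      by (intro measurable_compose[OF _ measurable_ennreal] borel_measurable_continuous_onI continuous_intros u g)+
    have "W i = (\<integral>\<^sup>+x. ennreal (4 * \<bar>u x\<bar> ^ 3) * ennreal \<bar>g i x\<bar> \<partial>lborel)"
      unfolding W_def w_def by (simp add: ennreal_mult'[symmetric] abs_mult power_abs)
    then have "(W i)\<^sup>2 \<le> (\<integral>\<^sup>+x. (ennreal (4 * \<bar>u x\<bar> ^ 3))\<^sup>2 \<partial>lborel) * (\<integral>\<^sup>+x. (ennreal \<bar>g i x\<bar>)\<^sup>2 \<partial>lborel)"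
      using Cauchy_Schwarz_nn_integral[OF mu(1,2)] by simp
    also have "(\<lambda>x. (ennreal (4 * \<bar>u x\<bar> ^ 3))\<^sup>2) = (\<lambda>x. 16 * ennreal (u x ^ 6))"
    proof
      fix x
      have "(4 * \<bar>u x\<bar> ^ 3)\<^sup>2 = 16 * u x ^ 6"
        by (simp add: power_mult_distrib flip: power_mult)
      then show "(ennreal (4 * \<bar>u x\<bar> ^ 3))\<^sup>2 = 16 * ennreal (u x ^ 6)"
        by (simp add: ennreal_power ennreal_mult)
    qed
    also have "(\<integral>\<^sup>+x. 16 * ennreal (u x ^ 6) \<partial>lborel) = 16 * I"
      unfolding I_def by (rule nn_integral_cmult[OF mu(3)])
    also have "(\<integral>\<^sup>+x. (ennreal \<bar>g i x\<bar>)\<^sup>2 \<partial>lborel) \<le> D"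
      unfolding D_def
    proof (intro nn_integral_mono)
      fix x
      have "(g i x)\<^sup>2 \<le> (\<Sum>i\<in>UNIV. (g i x)\<^sup>2)" by (rule member_le_sum) auto
      then show "(ennreal \<bar>g i x\<bar>)\<^sup>2 \<le> ennreal (\<Sum>i\<in>UNIV. (g i x)\<^sup>2)"
        by (simp add: ennreal_power ennreal_leI)
    qed
    finally show ?thesis by (simp add: mult_left_mono)
  qed
  \<comment> \<open>The bounds combine to I^4 \<le> (16 I D)^3, whence the constant 4096 = 16^3.
    Cancelling I^3 needs I finite, which holds since u is bounded with bounded support.\<close>
  have "I ^ 4 = (I\<^sup>2)\<^sup>2" by simp
  also have "\<dots> \<le> (W 1 * W 2 * W 3)\<^sup>2" by (intro power_mono IW) auto
  also have "\<dots> = (W 1)\<^sup>2 * (W 2)\<^sup>2 * (W 3)\<^sup>2" by (simp add: power_mult_distrib)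
  also have "\<dots> \<le> (16 * I * D) * (16 * I * D) * (16 * I * D)" by (intro mult_mono W) auto
  also have "\<dots> = I ^ 3 * (4096 * D ^ 3)" by (simp add: power3_eq_cube mult_ac)
  finally have "I ^ 3 * I \<le> I ^ 3 * (4096 * D ^ 3)" by (simp add: power_Suc2[symmetric])
  moreover have "I < top"
  proof -
    have "bounded (u ` cball 0 R)"
      by (intro compact_imp_bounded compact_continuous_image continuous_on_subset[OF u]) auto
    then obtain K where K: "\<forall>x\<in>cball 0 R. \<bar>u x\<bar> \<le> K" by (auto simp: bounded_iff)
    have "I \<le> (\<integral>\<^sup>+x. ennreal (K ^ 6) * indicator (cball (0 :: real^3) R) x \<partial>lborel)"
      unfolding I_def
    proof (rule nn_integral_mono)
      fix x
      show "ennreal (u x ^ 6) \<le> ennreal (K ^ 6) * indicator (cball 0 R) x"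
      proof (cases "x \<in> cball 0 R")
        case True
        then have "\<bar>u x\<bar> ^ 6 \<le> K ^ 6" using K by (intro power_mono) auto
        then show ?thesis using True by (auto simp: ennreal_leI)
      next
        case False
        then show ?thesis using R[of x] by simp
      qed
    qed
    also have "\<dots> < top"
      using emeasure_bounded_finite[of "cball (0 :: real^3) R"]
      by (subst nn_integral_cmult_indicator) (auto simp: ennreal_mult_less_top infinity_ennreal_def)
    finally show ?thesis .
  qed
  ultimately show ?thesis
    unfolding I_def[symmetric] D_def[symmetric]
    by (cases "I = 0") (auto simp: ennreal_mult_le_mult_iff power_eq_top_ennreal)
qed

section \<open>Sobolev spaces on a bounded open set\<close>

lemma L2_spaceD:
  assumes "u \<in> L2_space \<Omega>"
  shows "u \<in> borel_measurable (lebesgue_on \<Omega>)" "integrable (lebesgue_on \<Omega>) (\<lambda>x. (norm (u x))\<^sup>2)"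
  using assms by (auto simp: L2_space_def)

lemma L2_inner_integrable:
  assumes "u \<in> L2_space \<Omega>" "v \<in> L2_space \<Omega>"
  shows "integrable (lebesgue_on \<Omega>) (\<lambda>x. u x \<bullet> v x)"
proof (rule Bochner_Integration.integrable_bound)
  show "integrable (lebesgue_on \<Omega>) (\<lambda>x. (norm (u x))\<^sup>2 + (norm (v x))\<^sup>2)"
    by (intro Bochner_Integration.integrable_add L2_spaceD(2) assms)
  show "(\<lambda>x. u x \<bullet> v x) \<in> borel_measurable (lebesgue_on \<Omega>)"
    using L2_spaceD(1)[OF assms(1)] L2_spaceD(1)[OF assms(2)] by (rule borel_measurable_inner)
  show "AE x in lebesgue_on \<Omega>. norm (u x \<bullet> v x) \<le> norm ((norm (u x))\<^sup>2 + (norm (v x))\<^sup>2)"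
  proof (intro AE_I2)
    fix x
    have "\<bar>u x \<bullet> v x\<bar> \<le> norm (u x) * norm (v x)" by (rule Cauchy_Schwarz_ineq2)
    also have "\<dots> \<le> (norm (u x))\<^sup>2 + (norm (v x))\<^sup>2"
    proof -
      have "0 \<le> norm (u x) * norm (v x)" by simp
      then show ?thesis using sum_squares_bound[of "norm (u x)" "norm (v x)"] by linarith
    qed
    finally show "norm (u x \<bullet> v x) \<le> norm ((norm (u x))\<^sup>2 + (norm (v x))\<^sup>2)" by simp
  qed
qed

lemma L2_space_add:
  assumes "u \<in> L2_space \<Omega>" "v \<in> L2_space \<Omega>"
  shows "(\<lambda>x. u x + v x) \<in> L2_space \<Omega>"
proof -
  have "integrable (lebesgue_on \<Omega>) (\<lambda>x. (norm (u x))\<^sup>2 + 2 * (u x \<bullet> v x) + (norm (v x))\<^sup>2)"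
    using assms by (intro Bochner_Integration.integrable_add integrable_mult_right L2_inner_integrable L2_spaceD(2))
  moreover have "(\<lambda>x. (norm (u x))\<^sup>2 + 2 * (u x \<bullet> v x) + (norm (v x))\<^sup>2) = (\<lambda>x. (norm (u x + v x))\<^sup>2)"
    by (simp add: fun_eq_iff power2_norm_eq_inner inner_add_left inner_add_right inner_commute)
  ultimately show ?thesis
    using L2_spaceD(1)[OF assms(1)] L2_spaceD(1)[OF assms(2)] by (simp add: L2_space_def borel_measurable_add)
qed

lemma L2_space_scaleR: "u \<in> L2_space \<Omega> \<Longrightarrow> (\<lambda>x. c *\<^sub>R u x) \<in> L2_space \<Omega>"
  by (auto simp: L2_space_def power_mult_distrib intro: borel_measurable_scaleR)

lemma L2_space_diff:
  assumes "u \<in> L2_space \<Omega>" "v \<in> L2_space \<Omega>"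
  shows "u - v \<in> L2_space \<Omega>"
  using L2_space_add[OF assms(1) L2_space_scaleR[OF assms(2), of "-1"]]
  by (simp add: fun_diff_def[of u v])

lemma L2_inner_commute: "L2_inner \<Omega> u v = L2_inner \<Omega> v u"
  by (simp add: L2_inner_def inner_commute)

lemma L2_inner_add_left:
  assumes "u \<in> L2_space \<Omega>" "v \<in> L2_space \<Omega>" "w \<in> L2_space \<Omega>"
  shows "L2_inner \<Omega> (\<lambda>x. u x + v x) w = L2_inner \<Omega> u w + L2_inner \<Omega> v w"
  unfolding L2_inner_def inner_add_left
  by (intro Bochner_Integration.integral_add L2_inner_integrable assms)

lemma L2_inner_scaleR_left: "L2_inner \<Omega> (\<lambda>x. c *\<^sub>R u x) v = c * L2_inner \<Omega> u v"
  by (simp add: L2_inner_def)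

lemma L2_inner_diff_left:
  assumes "u \<in> L2_space \<Omega>" "v \<in> L2_space \<Omega>" "w \<in> L2_space \<Omega>"
  shows "L2_inner \<Omega> (u - v) w = L2_inner \<Omega> u w - L2_inner \<Omega> v w"
  unfolding L2_inner_def fun_diff_def inner_diff_left
  by (intro Bochner_Integration.integral_diff L2_inner_integrable assms)

lemma L2_inner_diff_right:
  assumes "u \<in> L2_space \<Omega>" "v \<in> L2_space \<Omega>" "w \<in> L2_space \<Omega>"
  shows "L2_inner \<Omega> w (u - v) = L2_inner \<Omega> w u - L2_inner \<Omega> w v"
  using L2_inner_diff_left[OF assms] by (simp add: L2_inner_commute)

lemma L2_inner_cong_AE:
  assumes "AE x in lebesgue_on \<Omega>. u x = u' x" "AE x in lebesgue_on \<Omega>. v x = v' x"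
    "u \<in> L2_space \<Omega>" "u' \<in> L2_space \<Omega>" "v \<in> L2_space \<Omega>" "v' \<in> L2_space \<Omega>"
  shows "L2_inner \<Omega> u v = L2_inner \<Omega> u' v'"
  unfolding L2_inner_def
proof (rule integral_cong_AE)
  show "AE x in lebesgue_on \<Omega>. u x \<bullet> v x = u' x \<bullet> v' x"
    using assms(1,2) by eventually_elim simp
qed (intro borel_measurable_inner L2_spaceD(1) assms)+

lemma L2_inner_self_nonneg: "0 \<le> L2_inner \<Omega> u u"
  by (auto simp: L2_inner_def intro!: integral_nonneg_AE)

lemma L2_norm_nonneg: "0 \<le> L2_norm \<Omega> u"
  by (simp add: L2_norm_def L2_inner_self_nonneg)

lemma L2_norm_power2: "(L2_norm \<Omega> u)\<^sup>2 = L2_inner \<Omega> u u"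
  by (simp add: L2_norm_def L2_inner_self_nonneg)

lemma L2_norm_cong_AE:
  assumes "AE x in lebesgue_on \<Omega>. u x = v x" "u \<in> L2_space \<Omega>" "v \<in> L2_space \<Omega>"
  shows "L2_norm \<Omega> u = L2_norm \<Omega> v"
  unfolding L2_norm_def using L2_inner_cong_AE[OF assms(1,1)] assms by simp

lemma L2_norm_scaleR: "L2_norm \<Omega> (\<lambda>x. c *\<^sub>R u x) = \<bar>c\<bar> * L2_norm \<Omega> u"
proof -
  have "L2_inner \<Omega> (\<lambda>x. c *\<^sub>R u x) (\<lambda>x. c *\<^sub>R u x) = c\<^sup>2 * L2_inner \<Omega> u u"
    by (simp add: L2_inner_def power2_eq_square mult.assoc)
  then show ?thesis by (simp add: L2_norm_def real_sqrt_mult)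
qed

lemma L2_norm_diff_power2:
  assumes "u \<in> L2_space \<Omega>" "v \<in> L2_space \<Omega>"
  shows "(L2_norm \<Omega> (u - v))\<^sup>2 = L2_inner \<Omega> u u - 2 * L2_inner \<Omega> u v + L2_inner \<Omega> v v"
  using assms L2_inner_commute[of \<Omega> v u]
  by (simp add: L2_norm_power2 L2_inner_diff_left L2_inner_diff_right L2_space_diff)

lemma L2_Cauchy_Schwarz:
  assumes "u \<in> L2_space \<Omega>" "v \<in> L2_space \<Omega>"
  shows "\<bar>L2_inner \<Omega> u v\<bar> \<le> L2_norm \<Omega> u * L2_norm \<Omega> v"
proof -
  have q: "0 \<le> L2_inner \<Omega> u u - 2 * t * L2_inner \<Omega> u v + t\<^sup>2 * L2_inner \<Omega> v v" for t
  proof -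
    have "L2_inner \<Omega> u (\<lambda>x. t *\<^sub>R v x) = t * L2_inner \<Omega> u v"
      "L2_inner \<Omega> (\<lambda>x. t *\<^sub>R v x) (\<lambda>x. t *\<^sub>R v x) = t\<^sup>2 * L2_inner \<Omega> v v"
      by (simp_all add: L2_inner_def power2_eq_square mult.assoc)
    then show ?thesis
      using L2_norm_diff_power2[OF assms(1) L2_space_scaleR[OF assms(2), of t]]
        zero_le_power2[of "L2_norm \<Omega> (u - (\<lambda>x. t *\<^sub>R v x))"] by simp
  qed
  have "(L2_inner \<Omega> u v)\<^sup>2 \<le> L2_inner \<Omega> u u * L2_inner \<Omega> v v"
  proof (cases "L2_inner \<Omega> v v = 0")
    case True
    have "L2_inner \<Omega> u v = 0"
    proof (rule ccontr)
      assume "L2_inner \<Omega> u v \<noteq> 0"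
      \<comment> \<open>At this t the quadratic expression equals -1, because its leading
        coefficient is 0.\<close>
      then show False using q[of "(L2_inner \<Omega> u u + 1) / (2 * L2_inner \<Omega> u v)"] True by simp
    qed
    then show ?thesis using True by simp
  next
    case False
    then have "0 < L2_inner \<Omega> v v" using L2_inner_self_nonneg[of \<Omega> v] by simp
    then show ?thesis using q[of "L2_inner \<Omega> u v / L2_inner \<Omega> v v"]
      by (simp add: field_simps power2_eq_square)
  qed
  then have "\<bar>L2_inner \<Omega> u v\<bar> \<le> sqrt (L2_inner \<Omega> u u * L2_inner \<Omega> v v)"
    by (intro real_le_rsqrt) simp
  then show ?thesis by (simp add: L2_norm_def real_sqrt_mult)
qed

lemma L2_norm_diff_le:
  assumes "u \<in> L2_space \<Omega>" "v \<in> L2_space \<Omega>"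
  shows "L2_norm \<Omega> (u - v) \<le> L2_norm \<Omega> u + L2_norm \<Omega> v"
proof (rule power2_le_imp_le)
  have "(L2_norm \<Omega> (u - v))\<^sup>2 \<le> (L2_norm \<Omega> u)\<^sup>2 + 2 * (L2_norm \<Omega> u * L2_norm \<Omega> v) + (L2_norm \<Omega> v)\<^sup>2"
    unfolding L2_norm_diff_power2[OF assms]
    using L2_Cauchy_Schwarz[OF assms] by (simp add: L2_norm_power2)
  then show "(L2_norm \<Omega> (u - v))\<^sup>2 \<le> (L2_norm \<Omega> u + L2_norm \<Omega> v)\<^sup>2"
    by (simp add: power2_sum)
qed (simp add: L2_norm_nonneg)

section \<open>Linear combinations, supports and bounds of test functions\<close>

lemma Ck_on_UNIV_diff_scaleR:
  assumes "Ck_on k UNIV f" "Ck_on k UNIV g"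
  shows "Ck_on k UNIV (\<lambda>x. a *\<^sub>R f x - b *\<^sub>R g x)"
  using assms
proof (induction k arbitrary: f g)
  case 0
  then show ?case by (auto intro!: continuous_intros)
next
  case (Suc k)
  have d: "((\<lambda>x. a *\<^sub>R f x - b *\<^sub>R g x) has_derivative
      (\<lambda>h. a *\<^sub>R frechet_derivative f (at x) h - b *\<^sub>R frechet_derivative g (at x) h)) (at x)" for x
    using Suc.prems frechet_derivative_works[of f] frechet_derivative_works[of g]
    by (auto intro!: derivative_intros)
  then have "frechet_derivative (\<lambda>x. a *\<^sub>R f x - b *\<^sub>R g x) (at x)
      = (\<lambda>h. a *\<^sub>R frechet_derivative f (at x) h - b *\<^sub>R frechet_derivative g (at x) h)" for x
    by (metis frechet_derivative_at)
  then show ?case using Suc by (auto intro: differentiableI[OF d])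
qed

lemma test_functions_diff_scaleR:
  assumes "\<phi> \<in> test_functions \<Omega>" "\<psi> \<in> test_functions \<Omega>"
  shows "(\<lambda>x. a *\<^sub>R \<phi> x - b *\<^sub>R \<psi> x) \<in> test_functions \<Omega>"
proof -
  have sub: "closure {x. a *\<^sub>R \<phi> x - b *\<^sub>R \<psi> x \<noteq> 0} \<subseteq> closure {x. \<phi> x \<noteq> 0} \<union> closure {x. \<psi> x \<noteq> 0}"
    unfolding closure_Un[symmetric] by (intro closure_mono) auto
  moreover have "compact (closure {x. \<phi> x \<noteq> 0} \<union> closure {x. \<psi> x \<noteq> 0})"
    using assms by (intro compact_Un) (auto simp: test_functions_def)
  ultimately have "compact (closure {x. a *\<^sub>R \<phi> x - b *\<^sub>R \<psi> x \<noteq> 0})"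
    by (meson bounded_subset closed_closure compact_eq_bounded_closed)
  with sub show ?thesis
    using assms by (auto simp: test_functions_def smooth_on_def Ck_on_UNIV_diff_scaleR)
qed

lemma test_functionD:
  fixes \<phi> :: "'a::euclidean_space \<Rightarrow> 'b::real_normed_vector"
  assumes "\<phi> \<in> test_functions \<Omega>"
  shows "continuous_on UNIV \<phi>" "(\<phi> has_derivative frechet_derivative \<phi> (at x)) (at x)"
    "i \<in> Basis \<Longrightarrow> continuous_on UNIV (\<lambda>x. frechet_derivative \<phi> (at x) i)"
proof -
  have C: "Ck_on k UNIV \<phi>" for k using assms by (auto simp: test_functions_def smooth_on_def)
  show "continuous_on UNIV \<phi>" using C[of 0] by simp
  show "(\<phi> has_derivative frechet_derivative \<phi> (at x)) (at x)"
    using C[of 1] by (simp add: frechet_derivative_works)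
  show "continuous_on UNIV (\<lambda>x. frechet_derivative \<phi> (at x) i)" if "i \<in> Basis"
    using C[of 1] that by simp
qed

lemma test_function_support:
  fixes \<phi> :: "'a::euclidean_space \<Rightarrow> 'b::real_normed_vector"
  assumes "\<phi> \<in> test_functions \<Omega>"
  obtains K where "compact K" "K \<subseteq> \<Omega>" "\<And>x. x \<notin> K \<Longrightarrow> \<phi> x = 0"
    "\<And>x i. x \<notin> K \<Longrightarrow> frechet_derivative \<phi> (at x) i = 0"
proof
  let ?K = "closure {x. \<phi> x \<noteq> 0}"
  show "compact ?K" "?K \<subseteq> \<Omega>" using assms by (auto simp: test_functions_def)
  show z: "\<phi> x = 0" if "x \<notin> ?K" for x using that closure_subset[of "{x. \<phi> x \<noteq> 0}"] by auto
  show "frechet_derivative \<phi> (at x) i = 0" if "x \<notin> ?K" for x i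
  proof -
    have "(\<phi> has_derivative (\<lambda>_. 0)) (at x)"
    proof (rule has_derivative_transform_within_open[where s = "- ?K" and f = "\<lambda>_. 0"])
      show "0 = \<phi> y" if "y \<in> - ?K" for y using z[of y] that by simp
    qed (use that in \<open>simp_all add: open_Compl del: closure_complement\<close>)
    from frechet_derivative_at[OF this] show ?thesis by (simp add: fun_eq_iff)
  qed
qed

lemma test_function_bounds:
  fixes \<phi> :: "'a::euclidean_space \<Rightarrow> 'b::real_normed_vector"
  assumes "\<phi> \<in> test_functions \<Omega>"
  shows "\<exists>B. \<forall>x. norm (\<phi> x) \<le> B" "i \<in> Basis \<Longrightarrow> \<exists>B. \<forall>x. norm (frechet_derivative \<phi> (at x) i) \<le> B"
proof -
  obtain K where K: "compact K" "K \<subseteq> \<Omega>" "\<And>x. x \<notin> K \<Longrightarrow> \<phi> x = 0"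
    "\<And>x i. x \<notin> K \<Longrightarrow> frechet_derivative \<phi> (at x) i = 0"
    using test_function_support[OF assms] by blast
  have *: "\<exists>B. \<forall>x. norm (f x) \<le> B"
    if c: "continuous_on UNIV f" and z: "\<And>x. x \<notin> K \<Longrightarrow> f x = 0" for f :: "'a \<Rightarrow> 'b"
  proof -
    obtain B where B: "0 \<le> B" "\<And>x. norm (f x) \<le> B * indicator K x"
      using compact_support_bounded[OF c K(1) z] by blast
    have "norm (f x) \<le> B" for x
      using B(1) B(2)[of x] by (cases "x \<in> K") auto
    then show ?thesis by blast
  qed
  show "\<exists>B. \<forall>x. norm (\<phi> x) \<le> B" by (rule *[OF test_functionD(1)[OF assms] K(3)])
  show "\<exists>B. \<forall>x. norm (frechet_derivative \<phi> (at x) i) \<le> B" if "i \<in> Basis"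
    by (rule *[OF test_functionD(3)[OF assms that] K(4)])
qed

section \<open>Weak gradients and the H1 norm\<close>

locale bounded_open_domain =
  fixes \<Omega> :: "(real^3) set"
  assumes open_domain: "open \<Omega>" and bounded_domain: "bounded \<Omega>"
begin

lemma domain_sets: "\<Omega> \<inter> space lebesgue \<in> sets lebesgue"
  using open_domain by simp

lemma finite_measure_domain: "finite_measure (lebesgue_on \<Omega>)"
  using open_domain bounded_domain by (intro finite_measure_lebesgue_on lmeasurable_open)

lemma borel_measurable_domain: "f \<in> borel_measurable borel \<Longrightarrow> f \<in> borel_measurable (lebesgue_on \<Omega>)"
  by (intro measurable_restrict_space1 measurable_completion) simp

lemma bounded_continuous_L2:
  fixes f :: "real^3 \<Rightarrow> 'b::euclidean_space"
  assumes "continuous_on UNIV f" "\<And>x. norm (f x) \<le> B"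
  shows "f \<in> L2_space \<Omega>"
proof -
  interpret finite_measure "lebesgue_on \<Omega>" by (rule finite_measure_domain)
  have f: "f \<in> borel_measurable (lebesgue_on \<Omega>)"
    using assms(1) by (intro borel_measurable_domain borel_measurable_continuous_onI)
  moreover have "integrable (lebesgue_on \<Omega>) (\<lambda>x. (norm (f x))\<^sup>2)"
    using f by (intro integrable_const_bound[where B = "B\<^sup>2"]) (auto intro!: power_mono assms(2))
  ultimately show ?thesis by (simp add: L2_space_def)
qed

lemma L2_component_test_integrable:
  assumes u: "u \<in> L2_space \<Omega>" and b: "continuous_on UNIV b" "\<exists>B. \<forall>x. norm (b x) \<le> B"
  shows "integrable (lebesgue_on \<Omega>) (\<lambda>x. (u x \<bullet> e) * b x)"
proof -
  obtain B where "\<And>x. norm (b x) \<le> B" using b by blast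
  then have "(\<lambda>x. b x *\<^sub>R e) \<in> L2_space \<Omega>"
    using b(1) by (intro bounded_continuous_L2[where B = "B * norm e"] continuous_intros) (auto intro: mult_right_mono)
  from L2_inner_integrable[OF u this] show ?thesis by (simp add: mult.commute)
qed

lemma matrix_component: "A $ i $ j = A \<bullet> axis i (axis j 1)"
  for A :: "real^3^3"
  by (simp add: inner_axis)

lemma weak_grad_test_integrable:
  fixes \<phi> :: "real^3 \<Rightarrow> real" and u :: "real^3 \<Rightarrow> real^3" and G :: "real^3 \<Rightarrow> real^3^3"
  assumes "\<phi> \<in> test_functions \<Omega>"
  shows "u \<in> L2_space \<Omega> \<Longrightarrow> integrable (lebesgue_on \<Omega>) (\<lambda>x. u x $ i * frechet_derivative \<phi> (at x) (axis j 1))"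
    and "G \<in> L2_space \<Omega> \<Longrightarrow> integrable (lebesgue_on \<Omega>) (\<lambda>x. G x $ i $ j * \<phi> x)"
proof -
  show "integrable (lebesgue_on \<Omega>) (\<lambda>x. u x $ i * frechet_derivative \<phi> (at x) (axis j 1))" if "u \<in> L2_space \<Omega>"
    using L2_component_test_integrable[OF that, of "\<lambda>x. frechet_derivative \<phi> (at x) (axis j 1)" "axis i 1"]
      test_functionD(3)[OF assms] test_function_bounds(2)[OF assms]
    by (simp add: inner_axis axis_in_Basis_iff)
  show "integrable (lebesgue_on \<Omega>) (\<lambda>x. G x $ i $ j * \<phi> x)" if "G \<in> L2_space \<Omega>"
    unfolding matrix_component
    by (rule L2_component_test_integrable[OF that test_functionD(1)[OF assms] test_function_bounds(1)[OF assms]])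
qed

text \<open>Entrywise application of the fundamental lemma. It makes the arbitrary choice in
  \<open>weak_grad\<close> harmless: the gradient of a combination equals the combination of
  gradients almost everywhere, and norms and scalar products do not see the difference.\<close>

lemma weak_grad_unique:
  assumes "G \<in> L2_space \<Omega>" "is_weak_grad \<Omega> u G" "G' \<in> L2_space \<Omega>" "is_weak_grad \<Omega> u G'"
  shows "AE x in lebesgue_on \<Omega>. G x = G' x"
proof -
  have "AE x in lebesgue_on \<Omega>. G x $ i $ j - G' x $ i $ j = 0" for i j
  proof (rule test_function_integrals_zero_imp_AE_zero[OF open_domain])
    have one: "continuous_on UNIV (\<lambda>_::real^3. 1::real)" "\<exists>B. \<forall>x::real^3. norm (1::real) \<le> B" by auto
    show "integrable (lebesgue_on \<Omega>) (\<lambda>x. G x $ i $ j - G' x $ i $ j)"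
      using L2_component_test_integrable[OF assms(1) one] L2_component_test_integrable[OF assms(3) one]
      unfolding matrix_component by (intro Bochner_Integration.integrable_diff) simp_all
    show "(\<integral>x. (G x $ i $ j - G' x $ i $ j) * \<phi> x \<partial>lebesgue_on \<Omega>) = 0" if "\<phi> \<in> test_functions \<Omega>" for \<phi>
      using assms(2,4) that unfolding left_diff_distrib is_weak_grad_def
      by (subst Bochner_Integration.integral_diff) (auto intro: weak_grad_test_integrable assms)
  qed
  then have "AE x in lebesgue_on \<Omega>. \<forall>i j. G x $ i $ j = G' x $ i $ j"
    by (simp add: AE_all_countable)
  then show ?thesis by eventually_elim (simp add: vec_eq_iff)
qed

lemma weak_grad_spec:
  assumes "u \<in> H1_space \<Omega>"
  shows "weak_grad \<Omega> u \<in> L2_space \<Omega>" "is_weak_grad \<Omega> u (weak_grad \<Omega> u)"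
  using assms someI_ex[of "\<lambda>G. G \<in> L2_space \<Omega> \<and> is_weak_grad \<Omega> u G"]
  unfolding H1_space_def weak_grad_def by auto

lemma H1_L2: "u \<in> H1_space \<Omega> \<Longrightarrow> u \<in> L2_space \<Omega>"
  by (simp add: H1_space_def)

text \<open>Combinations of the form a u - b v cover differences (a = b = 1) and scalar multiples (b
  = 0) together, so the closure properties of each space are stated once in this form.\<close>

lemma is_weak_grad_lincomb:
  assumes u: "u \<in> L2_space \<Omega>" "G \<in> L2_space \<Omega>" "is_weak_grad \<Omega> u G"
    and v: "v \<in> L2_space \<Omega>" "H \<in> L2_space \<Omega>" "is_weak_grad \<Omega> v H"
  shows "is_weak_grad \<Omega> (\<lambda>x. a *\<^sub>R u x - b *\<^sub>R v x) (\<lambda>x. a *\<^sub>R G x - b *\<^sub>R H x)"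
  unfolding is_weak_grad_def
proof (intro ballI allI)
  fix \<phi> :: "real^3 \<Rightarrow> real" and i j :: 3
  assume p: "\<phi> \<in> test_functions \<Omega>"
  let ?d = "\<lambda>x. frechet_derivative \<phi> (at x) (axis j 1)"
  have "(\<integral>x. (a *\<^sub>R u x - b *\<^sub>R v x) $ i * ?d x \<partial>lebesgue_on \<Omega>)
      = (\<integral>x. a * (u x $ i * ?d x) - b * (v x $ i * ?d x) \<partial>lebesgue_on \<Omega>)"
    by (simp add: algebra_simps)
  also have "\<dots> = a * (\<integral>x. u x $ i * ?d x \<partial>lebesgue_on \<Omega>) - b * (\<integral>x. v x $ i * ?d x \<partial>lebesgue_on \<Omega>)"
    using weak_grad_test_integrable(1)[OF p u(1)] weak_grad_test_integrable(1)[OF p v(1)]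
    by (simp add: Bochner_Integration.integral_diff)
  also have "\<dots> = - (a * (\<integral>x. G x $ i $ j * \<phi> x \<partial>lebesgue_on \<Omega>) - b * (\<integral>x. H x $ i $ j * \<phi> x \<partial>lebesgue_on \<Omega>))"
    using u(3) v(3) p unfolding is_weak_grad_def by simp
  also have "a * (\<integral>x. G x $ i $ j * \<phi> x \<partial>lebesgue_on \<Omega>) - b * (\<integral>x. H x $ i $ j * \<phi> x \<partial>lebesgue_on \<Omega>)
     = (\<integral>x. a * (G x $ i $ j * \<phi> x) - b * (H x $ i $ j * \<phi> x) \<partial>lebesgue_on \<Omega>)"
    using weak_grad_test_integrable(2)[OF p u(2)] weak_grad_test_integrable(2)[OF p v(2)]
    by (simp add: Bochner_Integration.integral_diff)
  also have "\<dots> = (\<integral>x. (a *\<^sub>R G x - b *\<^sub>R H x) $ i $ j * \<phi> x \<partial>lebesgue_on \<Omega>)"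
    by (simp add: algebra_simps)
  finally show "(\<integral>x. (a *\<^sub>R u x - b *\<^sub>R v x) $ i * ?d x \<partial>lebesgue_on \<Omega>)
      = - (\<integral>x. (a *\<^sub>R G x - b *\<^sub>R H x) $ i $ j * \<phi> x \<partial>lebesgue_on \<Omega>)" .
qed

lemma L2_space_lincomb:
  "u \<in> L2_space \<Omega> \<Longrightarrow> v \<in> L2_space \<Omega> \<Longrightarrow> (\<lambda>x. a *\<^sub>R u x - b *\<^sub>R v x) \<in> L2_space \<Omega>"
  using L2_space_diff[OF L2_space_scaleR L2_space_scaleR, of u \<Omega> v a b] by (simp add: fun_diff_def)

lemma H1_lincomb:
  assumes "u \<in> H1_space \<Omega>" "v \<in> H1_space \<Omega>"
  shows "(\<lambda>x. a *\<^sub>R u x - b *\<^sub>R v x) \<in> H1_space \<Omega>"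
    and "AE x in lebesgue_on \<Omega>. weak_grad \<Omega> (\<lambda>x. a *\<^sub>R u x - b *\<^sub>R v x) x
      = a *\<^sub>R weak_grad \<Omega> u x - b *\<^sub>R weak_grad \<Omega> v x"
proof -
  note w = weak_grad_spec[OF assms(1)] weak_grad_spec[OF assms(2)]
  note l = H1_L2[OF assms(1)] H1_L2[OF assms(2)]
  note wg = L2_space_lincomb[OF w(1,3), of a b] is_weak_grad_lincomb[OF l(1) w(1,2) l(2) w(3,4), of a b]
  show H: "(\<lambda>x. a *\<^sub>R u x - b *\<^sub>R v x) \<in> H1_space \<Omega>"
    using wg L2_space_lincomb[OF l] unfolding H1_space_def by blast
  show "AE x in lebesgue_on \<Omega>. weak_grad \<Omega> (\<lambda>x. a *\<^sub>R u x - b *\<^sub>R v x) x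
      = a *\<^sub>R weak_grad \<Omega> u x - b *\<^sub>R weak_grad \<Omega> v x"
    by (rule weak_grad_unique[OF weak_grad_spec[OF H] wg])
qed

lemma H1_diff:
  assumes "u \<in> H1_space \<Omega>" "v \<in> H1_space \<Omega>"
  shows "u - v \<in> H1_space \<Omega>"
    and "AE x in lebesgue_on \<Omega>. weak_grad \<Omega> (u - v) x = (weak_grad \<Omega> u - weak_grad \<Omega> v) x"
  using H1_lincomb[OF assms, of 1 1] by (simp_all add: fun_diff_def)

lemma H1_scaleR:
  assumes "u \<in> H1_space \<Omega>"
  shows "(\<lambda>x. c *\<^sub>R u x) \<in> H1_space \<Omega>"
    and "AE x in lebesgue_on \<Omega>. weak_grad \<Omega> (\<lambda>x. c *\<^sub>R u x) x = c *\<^sub>R weak_grad \<Omega> u x"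
  using H1_lincomb[OF assms assms, of c 0] by simp_all

lemma H1_norm_nonneg: "0 \<le> H1_norm \<Omega> u"
  by (simp add: H1_norm_def)

lemma L2_norm_le_H1_norm: "L2_norm \<Omega> u \<le> H1_norm \<Omega> u" "L2_norm \<Omega> (weak_grad \<Omega> u) \<le> H1_norm \<Omega> u"
  by (auto simp: H1_norm_def intro!: real_le_rsqrt)

lemma H1_norm_diff_le:
  assumes "u \<in> H1_space \<Omega>" "v \<in> H1_space \<Omega>"
  shows "H1_norm \<Omega> (u - v) \<le> H1_norm \<Omega> u + H1_norm \<Omega> v"
proof -
  note w = weak_grad_spec(1)[OF assms(1)] weak_grad_spec(1)[OF assms(2)]
  have "L2_norm \<Omega> (weak_grad \<Omega> (u - v)) = L2_norm \<Omega> (weak_grad \<Omega> u - weak_grad \<Omega> v)"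
    by (rule L2_norm_cong_AE[OF H1_diff(2)[OF assms] weak_grad_spec(1)[OF H1_diff(1)[OF assms]] L2_space_diff[OF w]])
  also have "\<dots> \<le> L2_norm \<Omega> (weak_grad \<Omega> u) + L2_norm \<Omega> (weak_grad \<Omega> v)"
    by (rule L2_norm_diff_le[OF w])
  finally have g: "L2_norm \<Omega> (weak_grad \<Omega> (u - v)) \<le> L2_norm \<Omega> (weak_grad \<Omega> u) + L2_norm \<Omega> (weak_grad \<Omega> v)" .
  have "H1_norm \<Omega> (u - v) \<le> sqrt ((L2_norm \<Omega> u + L2_norm \<Omega> v)\<^sup>2
      + (L2_norm \<Omega> (weak_grad \<Omega> u) + L2_norm \<Omega> (weak_grad \<Omega> v))\<^sup>2)"
    unfolding H1_norm_def
    by (intro real_sqrt_le_mono add_mono power_mono g L2_norm_diff_le H1_L2 assms L2_norm_nonneg)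
  also have "\<dots> \<le> H1_norm \<Omega> u + H1_norm \<Omega> v"
    unfolding H1_norm_def by (rule real_sqrt_sum_squares_triangle_ineq)
  finally show ?thesis .
qed

lemma H1_norm_scaleR:
  assumes "u \<in> H1_space \<Omega>"
  shows "H1_norm \<Omega> (\<lambda>x. c *\<^sub>R u x) = \<bar>c\<bar> * H1_norm \<Omega> u"
proof -
  have "L2_norm \<Omega> (weak_grad \<Omega> (\<lambda>x. c *\<^sub>R u x)) = \<bar>c\<bar> * L2_norm \<Omega> (weak_grad \<Omega> u)"
    using L2_norm_cong_AE[OF H1_scaleR(2)[OF assms] weak_grad_spec(1)[OF H1_scaleR(1)[OF assms]]
        L2_space_scaleR[OF weak_grad_spec(1)[OF assms]]] by (simp add: L2_norm_scaleR)
  then show ?thesis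
    by (simp add: H1_norm_def L2_norm_scaleR power_mult_distrib flip: distrib_left)
       (simp add: real_sqrt_mult)
qed

end

section \<open>Classical gradients and the Sobolev embedding\<close>

definition classical_grad :: "(real^3 \<Rightarrow> real^3) \<Rightarrow> real^3 \<Rightarrow> real^3^3" where
  "classical_grad \<phi> x = (\<chi> i j. frechet_derivative \<phi> (at x) (axis j 1) $ i)"

lemma norm_power2_vec: "(norm x)\<^sup>2 = (\<Sum>i\<in>UNIV. (norm (x $ i))\<^sup>2)" for x :: "('a::real_inner) ^ 'n"
  by (simp add: power2_norm_eq_inner inner_vec_def)

lemma norm_matrix_vector_mult_le: "norm (A *v x) \<le> norm A * norm x" for A :: "real ^ 'n ^ 'm"
proof (rule power2_le_imp_le)
  have "(norm (A *v x))\<^sup>2 = (\<Sum>i\<in>UNIV. (A $ i \<bullet> x)\<^sup>2)"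
    by (simp add: norm_power2_vec matrix_vector_mul_component)
  also have "\<dots> \<le> (\<Sum>i\<in>UNIV. (norm (A $ i))\<^sup>2 * (norm x)\<^sup>2)"
    by (intro sum_mono) (simp add: power2_norm_eq_inner Cauchy_Schwarz_ineq)
  also have "\<dots> = (norm A * norm x)\<^sup>2"
    by (simp add: norm_power2_vec[of A] power_mult_distrib sum_distrib_right)
  finally show "(norm (A *v x))\<^sup>2 \<le> (norm A * norm x)\<^sup>2" .
qed simp

lemma norm_power6_le: "norm x ^ 6 \<le> 9 * (\<Sum>i\<in>UNIV. x $ i ^ 6)" for x :: "real^3"
proof -
  define a b c where "a = (x $ 1)\<^sup>2" "b = (x $ 2)\<^sup>2" "c = (x $ 3)\<^sup>2"
  then have n: "0 \<le> a" "0 \<le> b" "0 \<le> c" by simp_all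
  have "norm x ^ 6 = ((norm x)\<^sup>2) ^ 3" by simp
  also have "\<dots> = (a + b + c) ^ 3"
    unfolding a_b_c_def norm_power2_vec UNIV_3 by (simp add: add.assoc)
  also have "\<dots> \<le> 9 * (a ^ 3 + b ^ 3 + c ^ 3)"
  proof -
    \<comment> \<open>The difference of the two sides is three times the sum of the first three
      expressions plus the fourth.\<close>
    have "0 \<le> (a - b)\<^sup>2 * (a + b)" "0 \<le> (b - c)\<^sup>2 * (b + c)" "0 \<le> (a - c)\<^sup>2 * (a + c)" "0 \<le> (a + b + c) * ((a - b)\<^sup>2 + (b - c)\<^sup>2 + (a - c)\<^sup>2)"
      using n by auto
    then show ?thesis by (simp add: power2_eq_square power3_eq_cube algebra_simps)
  qed
  also have "\<dots> = 9 * (\<Sum>i\<in>UNIV. x $ i ^ 6)"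
    unfolding a_b_c_def UNIV_3 by simp
  finally show ?thesis .
qed

context bounded_open_domain
begin

lemma test_component_has_derivative:
  fixes \<phi> :: "real^3 \<Rightarrow> real^3"
  assumes "\<phi> \<in> test_functions \<Omega>"
  shows "((\<lambda>x. \<phi> x $ i) has_derivative (\<lambda>h. frechet_derivative \<phi> (at x) h $ i)) (at x)"
  by (rule bounded_linear.has_derivative[OF bounded_linear_vec_nth test_functionD(2)[OF assms]])

lemma directional_derivative:
  fixes f :: "'z::real_normed_vector \<Rightarrow> real"
  assumes "(f has_derivative D) (at x)"
  shows "((\<lambda>t. f (x + t *\<^sub>R e)) has_real_derivative D e) (at 0)"
proof -
  have "((\<lambda>t. f (x + t *\<^sub>R e)) has_derivative (\<lambda>t. D (t *\<^sub>R e))) (at 0)"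
    by (rule has_derivative_compose[where g = f]) (use assms in \<open>auto intro!: derivative_eq_intros\<close>)
  moreover have "D (t *\<^sub>R e) = D e * t" for t
    using linear_scale[OF has_derivative_linear[OF assms]] by (simp add: mult.commute)
  ultimately show ?thesis by (simp add: has_field_derivative_def)
qed

lemma integral_domain_eq:
  fixes f :: "real^3 \<Rightarrow> real"
  assumes "continuous_on UNIV f" "\<And>x. x \<notin> \<Omega> \<Longrightarrow> f x = 0"
  shows "(\<integral>x. f x \<partial>lebesgue_on \<Omega>) = (\<integral>x. f x \<partial>lborel)"
proof -
  have "(\<integral>x. f x \<partial>lebesgue_on \<Omega>) = (\<integral>x. indicator \<Omega> x *\<^sub>R f x \<partial>lebesgue)"
    by (rule integral_restrict_space[OF domain_sets])
  also have "(\<lambda>x. indicator \<Omega> x *\<^sub>R f x) = f" using assms(2) by (auto simp: fun_eq_iff indicator_def)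
  also have "(\<integral>x. f x \<partial>lebesgue) = (\<integral>x. f x \<partial>lborel)"
    using assms(1) by (intro integral_completion) (simp add: borel_measurable_continuous_onI)
  finally show ?thesis .
qed

lemma classical_grad_continuous:
  assumes "\<phi> \<in> test_functions \<Omega>"
  shows "continuous_on UNIV (classical_grad \<phi>)"
  unfolding classical_grad_def
  by (intro continuous_intros test_functionD(3)[OF assms]) (simp add: axis_in_Basis_iff)

lemma test_L2:
  fixes \<phi> :: "real^3 \<Rightarrow> real^3"
  assumes "\<phi> \<in> test_functions \<Omega>"
  shows "\<phi> \<in> L2_space \<Omega>" "classical_grad \<phi> \<in> L2_space \<Omega>"
proof -
  obtain K where K: "compact K" "K \<subseteq> \<Omega>" "\<And>x. x \<notin> K \<Longrightarrow> \<phi> x = 0"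
    "\<And>x i. x \<notin> K \<Longrightarrow> frechet_derivative \<phi> (at x) i = 0"
    using test_function_support[OF assms] by blast
  obtain B where "\<And>x. norm (\<phi> x) \<le> B" using test_function_bounds(1)[OF assms] by blast
  then show "\<phi> \<in> L2_space \<Omega>" by (rule bounded_continuous_L2[OF test_functionD(1)[OF assms]])
  have z: "classical_grad \<phi> x = 0" if "x \<notin> K" for x
    using K(4)[OF that] by (simp add: classical_grad_def vec_eq_iff)
  obtain C where C: "0 \<le> C" "\<And>x. norm (classical_grad \<phi> x) \<le> C * indicator K x"
    using compact_support_bounded[OF classical_grad_continuous[OF assms] K(1) z] by blast
  have "norm (classical_grad \<phi> x) \<le> C" for x using C(1) C(2)[of x] by (cases "x \<in> K") auto
  then show "classical_grad \<phi> \<in> L2_space \<Omega>"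
    by (rule bounded_continuous_L2[OF classical_grad_continuous[OF assms]])
qed

text \<open>The product of a component of \<phi> with \<psi> has compact support, so the integral of
  its partial derivative is 0; the product rule turns this into integration by parts.\<close>

lemma classical_grad_is_weak_grad:
  assumes p: "\<phi> \<in> test_functions \<Omega>"
  shows "is_weak_grad \<Omega> \<phi> (classical_grad \<phi>)"
  unfolding is_weak_grad_def
proof (intro ballI allI)
  fix \<psi> :: "real^3 \<Rightarrow> real" and i j :: 3
  assume q: "\<psi> \<in> test_functions \<Omega>"
  obtain K where K: "compact K" "K \<subseteq> \<Omega>" "\<And>x. x \<notin> K \<Longrightarrow> \<psi> x = 0"
    "\<And>x i. x \<notin> K \<Longrightarrow> frechet_derivative \<psi> (at x) i = 0"
    using test_function_support[OF q] by blast
  let ?e = "axis j 1 :: real^3"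
  have e: "?e \<in> Basis" by (simp add: axis_in_Basis_iff)
  define h where "h x = \<phi> x $ i * \<psi> x" for x
  define h' where "h' x = \<phi> x $ i * frechet_derivative \<psi> (at x) ?e + classical_grad \<phi> x $ i $ j * \<psi> x" for x
  have "((\<lambda>t. h (x + t *\<^sub>R ?e)) has_real_derivative h' x) (at 0)" for x
  proof -
    have "(h has_derivative (\<lambda>k. \<phi> x $ i * frechet_derivative \<psi> (at x) k + frechet_derivative \<phi> (at x) k $ i * \<psi> x)) (at x)"
      unfolding h_def
      by (rule has_derivative_mult[OF test_component_has_derivative[OF p] test_functionD(2)[OF q]])
    from directional_derivative[OF this, of ?e] show ?thesis by (simp add: h'_def classical_grad_def)
  qed
  moreover have "continuous_on UNIV h" "continuous_on UNIV h'"
    unfolding h_def h'_def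
    by (intro continuous_intros test_functionD(1)[OF p] test_functionD(1)[OF q] test_functionD(3)[OF q e]
        classical_grad_continuous[OF p])+
  moreover have "h x = 0" "h' x = 0" if "x \<notin> K" for x using K that by (simp_all add: h_def h'_def)
  ultimately have "(\<integral>x. h' x \<partial>lborel) = 0" "(\<integral>x. h' x \<partial>lebesgue_on \<Omega>) = (\<integral>x. h' x \<partial>lborel)"
    using integral_directional_derivative_zero[of h ?e h' K] integral_domain_eq[of h'] K(1,2) by auto
  moreover have "(\<integral>x. h' x \<partial>lebesgue_on \<Omega>) = (\<integral>x. \<phi> x $ i * frechet_derivative \<psi> (at x) ?e \<partial>lebesgue_on \<Omega>)
      + (\<integral>x. classical_grad \<phi> x $ i $ j * \<psi> x \<partial>lebesgue_on \<Omega>)"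
    unfolding h'_def
    by (intro Bochner_Integration.integral_add weak_grad_test_integrable[OF q] test_L2[OF p])
  ultimately show "(\<integral>x. \<phi> x $ i * frechet_derivative \<psi> (at x) ?e \<partial>lebesgue_on \<Omega>)
      = - (\<integral>x. classical_grad \<phi> x $ i $ j * \<psi> x \<partial>lebesgue_on \<Omega>)" by linarith
qed

lemma test_H1:
  assumes "\<phi> \<in> test_functions \<Omega>"
  shows "\<phi> \<in> H1_space \<Omega>" "L2_norm \<Omega> (weak_grad \<Omega> \<phi>) = L2_norm \<Omega> (classical_grad \<phi>)"
proof -
  show H: "\<phi> \<in> H1_space \<Omega>"
    using test_L2[OF assms] classical_grad_is_weak_grad[OF assms] by (auto simp: H1_space_def)
  show "L2_norm \<Omega> (weak_grad \<Omega> \<phi>) = L2_norm \<Omega> (classical_grad \<phi>)"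
    using weak_grad_unique[OF weak_grad_spec[OF H] test_L2(2)[OF assms] classical_grad_is_weak_grad[OF assms]]
      weak_grad_spec(1)[OF H] test_L2(2)[OF assms] by (rule L2_norm_cong_AE)
qed

lemma L2_norm_nn_integral:
  assumes "u \<in> L2_space \<Omega>"
  shows "(\<integral>\<^sup>+x. ennreal ((norm (u x))\<^sup>2) \<partial>lebesgue_on \<Omega>) = ennreal ((L2_norm \<Omega> u)\<^sup>2)"
proof -
  have "(\<integral>\<^sup>+x. ennreal ((norm (u x))\<^sup>2) \<partial>lebesgue_on \<Omega>) = ennreal (\<integral>x. (norm (u x))\<^sup>2 \<partial>lebesgue_on \<Omega>)"
    by (rule nn_integral_eq_integral[OF L2_spaceD(2)[OF assms]]) simp
  then show ?thesis by (simp add: L2_norm_power2 L2_inner_def power2_norm_eq_inner)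
qed

lemma test_Sobolev:
  fixes \<phi> :: "real^3 \<Rightarrow> real^3"
  assumes p: "\<phi> \<in> test_functions \<Omega>"
  shows "(\<integral>\<^sup>+x. ennreal (norm (\<phi> x) ^ 6) \<partial>lebesgue_on \<Omega>) \<le> ennreal ((7 * L2_norm \<Omega> (weak_grad \<Omega> \<phi>)) ^ 6)"
proof -
  obtain K where K: "compact K" "K \<subseteq> \<Omega>" "\<And>x. x \<notin> K \<Longrightarrow> \<phi> x = 0"
    "\<And>x i. x \<notin> K \<Longrightarrow> frechet_derivative \<phi> (at x) i = 0"
    using test_function_support[OF p] by blast
  obtain R where R: "\<And>x. x \<in> K \<Longrightarrow> norm x \<le> R"
    using compact_imp_bounded[OF K(1)] by (auto simp: bounded_iff)
  define D where "D = (\<integral>\<^sup>+x. ennreal ((norm (classical_grad \<phi> x))\<^sup>2) \<partial>lborel)"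
  have dom: "(\<integral>\<^sup>+x. f x \<partial>lebesgue_on \<Omega>) = (\<integral>\<^sup>+x. f x \<partial>lborel)" if "\<And>x. x \<notin> K \<Longrightarrow> f x = 0" for f :: "real^3 \<Rightarrow> ennreal"
  proof -
    have "(\<integral>\<^sup>+x. f x \<partial>lebesgue_on \<Omega>) = (\<integral>\<^sup>+x. f x * indicator \<Omega> x \<partial>lebesgue)"
      by (rule nn_integral_restrict_space[OF domain_sets])
    also have "(\<lambda>x. f x * indicator \<Omega> x) = f" using that K(2) by (auto simp: fun_eq_iff indicator_def)
    finally show ?thesis by (simp add: nn_integral_completion)
  qed
  have comp: "(\<integral>\<^sup>+x. ennreal (\<phi> x $ k ^ 6) \<partial>lborel) \<le> 4096 * D ^ 3" for k
  proof -
    have "(\<integral>\<^sup>+x. ennreal (\<phi> x $ k ^ 6) \<partial>lborel)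
        \<le> 4096 * (\<integral>\<^sup>+x. ennreal (\<Sum>j\<in>UNIV. (classical_grad \<phi> x $ k $ j)\<^sup>2) \<partial>lborel) ^ 3"
    proof (rule Gagliardo_Nirenberg_Sobolev)
      show "((\<lambda>t. \<phi> (x + t *\<^sub>R axis j 1) $ k) has_real_derivative classical_grad \<phi> x $ k $ j) (at 0)" for x j
        using directional_derivative[OF test_component_has_derivative[OF p, of k x], of "axis j 1"]
        by (simp add: classical_grad_def)
      show "\<phi> x $ k = 0" if "R < norm x" for x using K(3)[of x] R[of x] that by (cases "x \<in> K") auto
    qed (intro continuous_intros test_functionD(1)[OF p] classical_grad_continuous[OF p])+
    also have "\<dots> \<le> 4096 * D ^ 3"
      unfolding D_def
    proof (intro mult_left_mono power_mono nn_integral_mono ennreal_leI)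
      show "(\<Sum>j\<in>UNIV. (classical_grad \<phi> x $ k $ j)\<^sup>2) \<le> (norm (classical_grad \<phi> x))\<^sup>2" for x
      proof -
        have "(\<Sum>j\<in>UNIV. (classical_grad \<phi> x $ k $ j)\<^sup>2) = (norm (classical_grad \<phi> x $ k))\<^sup>2"
          by (simp add: norm_power2_vec[of "classical_grad \<phi> x $ k"])
        also have "\<dots> \<le> (norm (classical_grad \<phi> x))\<^sup>2"
          by (intro power_mono Finite_Cartesian_Product.norm_nth_le) simp
        finally show ?thesis .
      qed
    qed auto
    finally show ?thesis .
  qed
  have m: "(\<lambda>x. ennreal (\<phi> x $ k ^ 6)) \<in> borel_measurable lborel" for k
    unfolding measurable_lborel2
    by (intro measurable_compose[OF _ measurable_ennreal] borel_measurable_continuous_onI continuous_intros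
        test_functionD(1)[OF p])
  have "(\<integral>\<^sup>+x. ennreal (norm (\<phi> x) ^ 6) \<partial>lebesgue_on \<Omega>) = (\<integral>\<^sup>+x. ennreal (norm (\<phi> x) ^ 6) \<partial>lborel)"
    using K(3) by (intro dom) simp
  also have "\<dots> \<le> (\<integral>\<^sup>+x. 9 * (\<Sum>k\<in>UNIV. ennreal (\<phi> x $ k ^ 6)) \<partial>lborel)"
  proof (intro nn_integral_mono)
    fix x
    have "ennreal (norm (\<phi> x) ^ 6) \<le> ennreal (9 * (\<Sum>k\<in>UNIV. \<phi> x $ k ^ 6))"
      by (intro ennreal_leI norm_power6_le)
    then show "ennreal (norm (\<phi> x) ^ 6) \<le> 9 * (\<Sum>k\<in>UNIV. ennreal (\<phi> x $ k ^ 6))"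
      by (simp add: ennreal_mult sum_nonneg)
  qed
  also have "\<dots> = 9 * (\<Sum>k\<in>UNIV. (\<integral>\<^sup>+x. ennreal (\<phi> x $ k ^ 6) \<partial>lborel))"
    by (subst nn_integral_cmult[OF borel_measurable_sum[OF m]], subst nn_integral_sum[OF m]) simp
  also have "\<dots> \<le> 9 * (\<Sum>k\<in>(UNIV :: 3 set). 4096 * D ^ 3)"
    by (intro mult_left_mono sum_mono comp) auto
  \<comment> \<open>The number is 9 * 3 * 4096: the factor of \<open>norm_power6_le\<close>, the
    number of components and the scalar constant. The factor 7 of all later estimates comes from
    here, as 7^6 = 117649 exceeds it.\<close>
  also have "\<dots> = ennreal 110592 * D ^ 3" by (simp add: mult.assoc[symmetric])
  also have "D = ennreal ((L2_norm \<Omega> (weak_grad \<Omega> \<phi>))\<^sup>2)"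
    unfolding D_def test_H1(2)[OF p] L2_norm_nn_integral[OF test_L2(2)[OF p], symmetric]
    by (rule dom[symmetric]) (use K(4) in \<open>simp add: classical_grad_def vec_eq_iff zero_vec_def[symmetric]\<close>)
  also have "ennreal 110592 * ennreal ((L2_norm \<Omega> (weak_grad \<Omega> \<phi>))\<^sup>2) ^ 3
      = ennreal (110592 * L2_norm \<Omega> (weak_grad \<Omega> \<phi>) ^ 6)"
    by (simp add: ennreal_power ennreal_mult flip: power_mult)
  also have "\<dots> \<le> ennreal ((7 * L2_norm \<Omega> (weak_grad \<Omega> \<phi>)) ^ 6)"
    by (intro ennreal_leI) (simp add: power_mult_distrib)
  finally show ?thesis .
qed

lemma H10_H1: "u \<in> H10_space \<Omega> \<Longrightarrow> u \<in> H1_space \<Omega>"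
  by (simp add: H10_space_def closure_wrt_def)

text \<open>Test functions converging in H1 have a subsequence converging almost everywhere, and
  Fatou's lemma carries the bound for test functions over to the limit.\<close>

lemma Sobolev_embedding:
  assumes u: "u \<in> H10_space \<Omega>"
  shows "(\<integral>\<^sup>+x. ennreal (norm (u x) ^ 6) \<partial>lebesgue_on \<Omega>) \<le> ennreal ((7 * H1_norm \<Omega> u) ^ 6)"
proof -
  note uH = H10_H1[OF u]
  have app: "\<forall>\<epsilon>>0. \<exists>\<phi>\<in>test_functions \<Omega>. H1_norm \<Omega> (u - \<phi>) < \<epsilon>"
    using u by (simp add: H10_space_def closure_wrt_def)
  have "\<exists>\<phi>. \<phi> \<in> test_functions \<Omega> \<and> H1_norm \<Omega> (u - \<phi>) < inverse (real (Suc n))" for n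
    using app[rule_format, of "inverse (real (Suc n))"] by auto
  then obtain \<phi> where p: "\<And>n. \<phi> n \<in> test_functions \<Omega>" and d: "\<And>n. H1_norm \<Omega> (u - \<phi> n) < inverse (real (Suc n))"
    by metis
  note pH = test_H1(1)[OF p]
  note pL = test_L2(1)[OF p]
  have i: "integrable (lebesgue_on \<Omega>) (\<lambda>x. (norm ((u - \<phi> n) x))\<^sup>2)" for n
    by (intro L2_spaceD(2) L2_space_diff H1_L2 uH pH)
  have "(\<lambda>n. \<integral>x. norm ((norm ((u - \<phi> n) x))\<^sup>2) \<partial>lebesgue_on \<Omega>) \<longlonglongrightarrow> 0"
  proof (rule tendsto_sandwich[OF _ _ tendsto_const])
    have eq: "(\<integral>x. norm ((norm ((u - \<phi> n) x))\<^sup>2) \<partial>lebesgue_on \<Omega>) = (L2_norm \<Omega> (u - \<phi> n))\<^sup>2" for n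
      by (simp add: L2_norm_power2 L2_inner_def power2_norm_eq_inner)
    have "(L2_norm \<Omega> (u - \<phi> n))\<^sup>2 \<le> (inverse (real (Suc n)))\<^sup>2" for n
      using L2_norm_le_H1_norm(1)[of "u - \<phi> n"] d[of n] by (intro power_mono L2_norm_nonneg) simp
    then show "\<forall>\<^sub>F n in sequentially. (\<integral>x. norm ((norm ((u - \<phi> n) x))\<^sup>2) \<partial>lebesgue_on \<Omega>) \<le> (inverse (real (Suc n)))\<^sup>2"
      unfolding eq by simp
    show "(\<lambda>n. (inverse (real (Suc n)))\<^sup>2) \<longlonglongrightarrow> 0"
      using tendsto_power[OF LIMSEQ_inverse_real_of_nat, of 2] by simp
  qed simp
  from tendsto_L1_AE_subseq[OF i this] obtain r where r: "strict_mono r"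
    "AE x in lebesgue_on \<Omega>. (\<lambda>n. (norm ((u - \<phi> (r n)) x))\<^sup>2) \<longlonglongrightarrow> 0" by auto
  have conv: "AE x in lebesgue_on \<Omega>. ennreal (norm (u x) ^ 6) = liminf (\<lambda>n. ennreal (norm (\<phi> (r n) x) ^ 6))"
    using r(2)
  proof eventually_elim
    case (elim x)
    have "(\<lambda>n. sqrt ((norm ((u - \<phi> (r n)) x))\<^sup>2)) \<longlonglongrightarrow> sqrt 0" by (intro tendsto_intros elim)
    then have "(\<lambda>n. u x - \<phi> (r n) x) \<longlonglongrightarrow> 0" by (simp add: tendsto_norm_zero_iff)
    from tendsto_diff[OF tendsto_const[of "u x"] this] have "(\<lambda>n. \<phi> (r n) x) \<longlonglongrightarrow> u x" by simp
    then have "(\<lambda>n. ennreal (norm (\<phi> (r n) x) ^ 6)) \<longlonglongrightarrow> ennreal (norm (u x) ^ 6)"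
      by (intro tendsto_ennrealI tendsto_intros)
    then show ?case by (intro lim_imp_Liminf[symmetric]) auto
  qed
  have "(\<integral>\<^sup>+x. ennreal (norm (u x) ^ 6) \<partial>lebesgue_on \<Omega>)
      = (\<integral>\<^sup>+x. liminf (\<lambda>n. ennreal (norm (\<phi> (r n) x) ^ 6)) \<partial>lebesgue_on \<Omega>)"
    by (rule nn_integral_cong_AE[OF conv])
  also have "\<dots> \<le> liminf (\<lambda>n. \<integral>\<^sup>+x. ennreal (norm (\<phi> (r n) x) ^ 6) \<partial>lebesgue_on \<Omega>)"
    by (intro nn_integral_liminf measurable_compose[OF _ measurable_ennreal] borel_measurable_power
        measurable_compose[OF L2_spaceD(1)[OF pL] borel_measurable_norm])
  also have "\<dots> \<le> liminf (\<lambda>n. ennreal ((7 * (H1_norm \<Omega> u + inverse (real (Suc n)))) ^ 6))"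
  proof (intro Liminf_mono always_eventually allI)
    fix n
    have "\<phi> (r n) = u - (u - \<phi> (r n))" by (simp add: fun_eq_iff)
    then have "H1_norm \<Omega> (\<phi> (r n)) \<le> H1_norm \<Omega> u + H1_norm \<Omega> (u - \<phi> (r n))"
      using H1_norm_diff_le[OF uH H1_diff(1)[OF uH pH[of "r n"]]] by simp
    also have "H1_norm \<Omega> (u - \<phi> (r n)) \<le> inverse (real (Suc n))"
    proof -
      have "inverse (real (Suc (r n))) \<le> inverse (real (Suc n))"
        using seq_suble[OF r(1), of n] by (intro le_imp_inverse_le) simp_all
      then show ?thesis using d[of "r n"] by linarith
    qed
    finally have "L2_norm \<Omega> (weak_grad \<Omega> (\<phi> (r n))) \<le> H1_norm \<Omega> u + inverse (real (Suc n))"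
      using L2_norm_le_H1_norm(2)[of "\<phi> (r n)"] by simp
    then have "ennreal ((7 * L2_norm \<Omega> (weak_grad \<Omega> (\<phi> (r n)))) ^ 6)
        \<le> ennreal ((7 * (H1_norm \<Omega> u + inverse (real (Suc n)))) ^ 6)"
      by (intro ennreal_leI power_mono) (auto simp: L2_norm_nonneg)
    with test_Sobolev[OF p[of "r n"]]
    show "(\<integral>\<^sup>+x. ennreal (norm (\<phi> (r n) x) ^ 6) \<partial>lebesgue_on \<Omega>)
        \<le> ennreal ((7 * (H1_norm \<Omega> u + inverse (real (Suc n)))) ^ 6)"
      by (rule order.trans)
  qed
  also have "\<dots> = ennreal ((7 * (H1_norm \<Omega> u + 0)) ^ 6)"
    by (intro lim_imp_Liminf tendsto_ennrealI tendsto_intros LIMSEQ_inverse_real_of_nat) simp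
  finally show ?thesis by simp
qed

end

section \<open>The trilinear form\<close>

lemma closure_wrt_lincomb:
  fixes N :: "('a \<Rightarrow> 'b::real_normed_vector) \<Rightarrow> real"
  assumes X: "\<And>a b u v. u \<in> X \<Longrightarrow> v \<in> X \<Longrightarrow> (\<lambda>x. a *\<^sub>R u x - b *\<^sub>R v x) \<in> X"
    and A: "\<And>a b u v. u \<in> A \<Longrightarrow> v \<in> A \<Longrightarrow> (\<lambda>x. a *\<^sub>R u x - b *\<^sub>R v x) \<in> A" "A \<subseteq> X"
    and N: "\<And>a b u v. u \<in> X \<Longrightarrow> v \<in> X \<Longrightarrow> N (\<lambda>x. a *\<^sub>R u x - b *\<^sub>R v x) \<le> \<bar>a\<bar> * N u + \<bar>b\<bar> * N v"
    and u: "u \<in> closure_wrt X N A" and v: "v \<in> closure_wrt X N A"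
  shows "(\<lambda>x. a *\<^sub>R u x - b *\<^sub>R v x) \<in> closure_wrt X N A"
  unfolding closure_wrt_def
proof (intro CollectI conjI allI impI)
  have uX: "u \<in> X" "v \<in> X" using u v by (auto simp: closure_wrt_def)
  then show "(\<lambda>x. a *\<^sub>R u x - b *\<^sub>R v x) \<in> X" by (rule X)
  fix \<epsilon> :: real assume "0 < \<epsilon>"
  \<comment> \<open>The summand 1 keeps the denominator positive when a = b = 0 and makes the final
    inequality strict.\<close>
  define \<delta> where "\<delta> = \<epsilon> / (\<bar>a\<bar> + \<bar>b\<bar> + 1)"
  have \<delta>: "0 < \<delta>" "(\<bar>a\<bar> + \<bar>b\<bar> + 1) * \<delta> = \<epsilon>" using \<open>0 < \<epsilon>\<close> by (auto simp: \<delta>_def)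
  obtain f where f: "f \<in> A" "N (u - f) < \<delta>" using u \<delta>(1) unfolding closure_wrt_def by blast
  obtain g where g: "g \<in> A" "N (v - g) < \<delta>" using v \<delta>(1) unfolding closure_wrt_def by blast
  have d: "u - f \<in> X" "v - g \<in> X"
    using X[of u f 1 1] X[of v g 1 1] uX f(1) g(1) A(2) by (auto simp: fun_diff_def)
  have "(\<lambda>x. a *\<^sub>R u x - b *\<^sub>R v x) - (\<lambda>x. a *\<^sub>R f x - b *\<^sub>R g x) = (\<lambda>x. a *\<^sub>R (u - f) x - b *\<^sub>R (v - g) x)"
    by (simp add: fun_eq_iff algebra_simps)
  then have "N ((\<lambda>x. a *\<^sub>R u x - b *\<^sub>R v x) - (\<lambda>x. a *\<^sub>R f x - b *\<^sub>R g x)) \<le> \<bar>a\<bar> * N (u - f) + \<bar>b\<bar> * N (v - g)"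
    using N[OF d, of a b] by simp
  also have "\<dots> \<le> \<bar>a\<bar> * \<delta> + \<bar>b\<bar> * \<delta>" using f(2) g(2) by (intro add_mono mult_left_mono) auto
  also have "\<dots> < \<epsilon>" using \<delta> by (simp add: algebra_simps)
  finally show "\<exists>h\<in>A. N ((\<lambda>x. a *\<^sub>R u x - b *\<^sub>R v x) - h) < \<epsilon>" using A(1)[OF f(1) g(1)] by blast
qed

lemma div_free_test_lincomb:
  assumes "u \<in> div_free_test \<Omega>" "v \<in> div_free_test \<Omega>"
  shows "(\<lambda>x. a *\<^sub>R u x - b *\<^sub>R v x) \<in> div_free_test \<Omega>"
proof -
  have t: "u \<in> test_functions \<Omega>" "v \<in> test_functions \<Omega>" using assms by (auto simp: div_free_test_def)
  have "((\<lambda>x. a *\<^sub>R u x - b *\<^sub>R v x) has_derivative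
      (\<lambda>h. a *\<^sub>R frechet_derivative u (at x) h - b *\<^sub>R frechet_derivative v (at x) h)) (at x)" for x
    by (intro derivative_intros test_functionD(2)[OF t(1)] test_functionD(2)[OF t(2)])
  from frechet_derivative_at[OF this, symmetric]
  have "divergence (\<lambda>x. a *\<^sub>R u x - b *\<^sub>R v x) x = a * divergence u x - b * divergence v x" for x
    by (simp add: divergence_def sum_subtractf sum_distrib_left)
  then show ?thesis
    using assms test_functions_diff_scaleR[OF t] by (auto simp: div_free_test_def)
qed

context bounded_open_domain
begin

lemma H1_norm_lincomb:
  assumes "u \<in> H1_space \<Omega>" "v \<in> H1_space \<Omega>"
  shows "H1_norm \<Omega> (\<lambda>x. a *\<^sub>R u x - b *\<^sub>R v x) \<le> \<bar>a\<bar> * H1_norm \<Omega> u + \<bar>b\<bar> * H1_norm \<Omega> v"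
  using H1_norm_diff_le[OF H1_scaleR(1)[OF assms(1), of a] H1_scaleR(1)[OF assms(2), of b]]
  by (simp add: H1_norm_scaleR assms fun_diff_def)

lemma H10_lincomb:
  assumes "u \<in> H10_space \<Omega>" "v \<in> H10_space \<Omega>"
  shows "(\<lambda>x. a *\<^sub>R u x - b *\<^sub>R v x) \<in> H10_space \<Omega>"
  using assms unfolding H10_space_def
  by (rule closure_wrt_lincomb[rotated 4]) (auto intro: H1_lincomb test_functions_diff_scaleR test_H1 H1_norm_lincomb)

lemma V_H10: "u \<in> V_space \<Omega> \<Longrightarrow> u \<in> H10_space \<Omega>"
  by (simp add: V_space_def closure_wrt_def)

lemma V_H1: "u \<in> V_space \<Omega> \<Longrightarrow> u \<in> H1_space \<Omega>"
  by (intro H10_H1 V_H10)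

text \<open>\<open>closure_wrt_lincomb\<close> wants the approximating set inside the ambient space,
  which is immediate for \<open>H1_space\<close>. V is therefore written as the intersection of
  \<open>H10_space\<close> with the closure of the divergence-free test fields in
  \<open>H1_space\<close>.\<close>

lemma V_lincomb:
  assumes "u \<in> V_space \<Omega>" "v \<in> V_space \<Omega>"
  shows "(\<lambda>x. a *\<^sub>R u x - b *\<^sub>R v x) \<in> V_space \<Omega>"
proof -
  have V: "V_space \<Omega> = H10_space \<Omega> \<inter> closure_wrt (H1_space \<Omega>) (H1_norm \<Omega>) (div_free_test \<Omega>)"
    by (auto simp: V_space_def closure_wrt_def H10_H1)
  have sub: "div_free_test \<Omega> \<subseteq> H1_space \<Omega>" by (auto simp: div_free_test_def test_H1)
  have "(\<lambda>x. a *\<^sub>R u x - b *\<^sub>R v x) \<in> closure_wrt (H1_space \<Omega>) (H1_norm \<Omega>) (div_free_test \<Omega>)"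
    using assms unfolding V
    by (intro closure_wrt_lincomb[OF H1_lincomb(1) div_free_test_lincomb sub H1_norm_lincomb]) auto
  moreover have "(\<lambda>x. a *\<^sub>R u x - b *\<^sub>R v x) \<in> H10_space \<Omega>"
    using assms by (intro H10_lincomb V_H10)
  ultimately show ?thesis unfolding V by blast
qed

lemma H_L2: "u \<in> H_space \<Omega> \<Longrightarrow> u \<in> L2_space \<Omega>"
  by (simp add: H_space_def closure_wrt_def)

lemma L2_norm_lincomb:
  fixes u v :: "real^3 \<Rightarrow> real^3"
  assumes "u \<in> L2_space \<Omega>" "v \<in> L2_space \<Omega>"
  shows "L2_norm \<Omega> (\<lambda>x. a *\<^sub>R u x - b *\<^sub>R v x) \<le> \<bar>a\<bar> * L2_norm \<Omega> u + \<bar>b\<bar> * L2_norm \<Omega> v"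
  using L2_norm_diff_le[OF L2_space_scaleR[OF assms(1), of a] L2_space_scaleR[OF assms(2), of b]]
  by (simp add: L2_norm_scaleR fun_diff_def)

lemma H_diff:
  assumes "u \<in> H_space \<Omega>" "v \<in> H_space \<Omega>"
  shows "u - v \<in> H_space \<Omega>"
proof -
  have sub: "div_free_test \<Omega> \<subseteq> L2_space \<Omega>" by (auto simp: div_free_test_def test_L2)
  have "(\<lambda>x. 1 *\<^sub>R u x - 1 *\<^sub>R v x) \<in> H_space \<Omega>"
    using assms unfolding H_space_def
    by (intro closure_wrt_lincomb[OF L2_space_lincomb div_free_test_lincomb sub L2_norm_lincomb])
  then show ?thesis by (simp add: fun_diff_def)
qed

text \<open>Hoelder's inequality with exponents 3 and 3/2 for |a|^2 and |p|^4, obtained from a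
  pointwise Young inequality. The weights \<alpha> and \<beta> are scaled so that the two terms
  contribute one third and two thirds of M^2 N^4.\<close>

lemma nn_integral_power2_power4_le:
  fixes a p :: "real^3 \<Rightarrow> real^3"
  assumes m: "a \<in> borel_measurable (lebesgue_on \<Omega>)" "p \<in> borel_measurable (lebesgue_on \<Omega>)"
    and M: "0 < M" "(\<integral>\<^sup>+x. ennreal (norm (a x) ^ 6) \<partial>lebesgue_on \<Omega>) \<le> ennreal (M ^ 6)"
    and N: "0 < N" "(\<integral>\<^sup>+x. ennreal (norm (p x) ^ 6) \<partial>lebesgue_on \<Omega>) \<le> ennreal (N ^ 6)"
  shows "(\<integral>\<^sup>+x. ennreal (norm (a x) ^ 2 * norm (p x) ^ 4) \<partial>lebesgue_on \<Omega>) \<le> ennreal (M ^ 2 * N ^ 4)"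
proof -
  define \<alpha> where "\<alpha> = M ^ 2 * N ^ 4 / (3 * M ^ 6)"
  define \<beta> where "\<beta> = 2 * M ^ 2 * N ^ 4 / (3 * N ^ 6)"
  have pos: "0 \<le> \<alpha>" "0 \<le> \<beta>" using M N by (auto simp: \<alpha>_def \<beta>_def)
  have young: "r ^ 2 * s ^ 4 \<le> \<alpha> * r ^ 6 + \<beta> * s ^ 6" for r s :: real
  proof -
    define X Y where "X = (r / M)\<^sup>2" and "Y = (s / N)\<^sup>2"
    \<comment> \<open>The product expands to X^3 - 3 X Y^2 + 2 Y^3.\<close>
    have "0 \<le> (X - Y)\<^sup>2 * (X + 2 * Y)" by (simp add: X_def Y_def)
    then have "X * Y ^ 2 \<le> (X ^ 3 + 2 * Y ^ 3) / 3"
      by (simp add: power2_eq_square power3_eq_cube algebra_simps)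
    then have "(M ^ 2 * N ^ 4) * (X * Y ^ 2) \<le> (M ^ 2 * N ^ 4) * ((X ^ 3 + 2 * Y ^ 3) / 3)"
      using M(1) N(1) by (intro mult_left_mono) auto
    moreover have "(M ^ 2 * N ^ 4) * (X * Y ^ 2) = r ^ 2 * s ^ 4"
      using M(1) N(1) by (simp add: X_def Y_def power_divide flip: power_mult)
    moreover have "(M ^ 2 * N ^ 4) * ((X ^ 3 + 2 * Y ^ 3) / 3) = \<alpha> * r ^ 6 + \<beta> * s ^ 6"
      by (simp add: X_def Y_def \<alpha>_def \<beta>_def power_divide add_divide_distrib algebra_simps flip: power_mult)
    ultimately show ?thesis by simp
  qed
  have meas: "(\<lambda>x. ennreal (norm (c x) ^ 6)) \<in> borel_measurable (lebesgue_on \<Omega>)"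
    if "c \<in> borel_measurable (lebesgue_on \<Omega>)" for c :: "real^3 \<Rightarrow> real^3"
    by (intro measurable_compose[OF _ measurable_ennreal] borel_measurable_power
        measurable_compose[OF that borel_measurable_norm])
  have "(\<integral>\<^sup>+x. ennreal (norm (a x) ^ 2 * norm (p x) ^ 4) \<partial>lebesgue_on \<Omega>)
      \<le> (\<integral>\<^sup>+x. ennreal \<alpha> * ennreal (norm (a x) ^ 6) + ennreal \<beta> * ennreal (norm (p x) ^ 6) \<partial>lebesgue_on \<Omega>)"
    using young pos by (intro nn_integral_mono) (simp add: ennreal_mult[symmetric] ennreal_plus[symmetric] ennreal_leI del: ennreal_plus)
  also have "\<dots> = ennreal \<alpha> * (\<integral>\<^sup>+x. ennreal (norm (a x) ^ 6) \<partial>lebesgue_on \<Omega>)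
      + ennreal \<beta> * (\<integral>\<^sup>+x. ennreal (norm (p x) ^ 6) \<partial>lebesgue_on \<Omega>)"
    using meas[OF m(1)] meas[OF m(2)] by (simp add: nn_integral_add nn_integral_cmult)
  also have "\<dots> \<le> ennreal \<alpha> * ennreal (M ^ 6) + ennreal \<beta> * ennreal (N ^ 6)"
    by (intro add_mono mult_left_mono M N) auto
  also have "\<dots> = ennreal (\<alpha> * M ^ 6 + \<beta> * N ^ 6)"
    using pos M(1) N(1) by (simp add: ennreal_mult ennreal_plus)
  also have "\<alpha> * M ^ 6 + \<beta> * N ^ 6 = M ^ 2 * N ^ 4"
    using M(1) N(1) by (simp add: \<alpha>_def \<beta>_def)
  finally show ?thesis .
qed

text \<open>Cauchy-Schwarz separates C from |a| |p|. A second Cauchy-Schwarz, applied to |a| times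
  |a| |p|^2, leaves the L2 norm of a and the integral of |a|^2 |p|^4, which Hoelder and Sobolev
  control through the H1 norms.\<close>

lemma trilinear_nn_integral_le:
  fixes C :: "real^3 \<Rightarrow> real^3^3"
  assumes C: "C \<in> L2_space \<Omega>" and a: "a \<in> H10_space \<Omega>" and p: "p \<in> H10_space \<Omega>"
  shows "(\<integral>\<^sup>+x. ennreal (norm (C x) * (norm (a x) * norm (p x))) \<partial>lebesgue_on \<Omega>)
    \<le> ennreal (L2_norm \<Omega> C * sqrt (L2_norm \<Omega> a * (7 * H1_norm \<Omega> a)) * (7 * H1_norm \<Omega> p))"
proof -
  have aL: "a \<in> L2_space \<Omega>" and pL: "p \<in> L2_space \<Omega>" using a p by (simp_all add: H10_H1 H1_L2)
  have n: "(\<lambda>x. norm (C x)) \<in> borel_measurable (lebesgue_on \<Omega>)" "(\<lambda>x. norm (a x)) \<in> borel_measurable (lebesgue_on \<Omega>)"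
    "(\<lambda>x. norm (p x)) \<in> borel_measurable (lebesgue_on \<Omega>)"
    by (rule measurable_compose[OF L2_spaceD(1) borel_measurable_norm], rule C aL pL)+
  define J where "J = (\<integral>\<^sup>+x. ennreal (norm (C x) * (norm (a x) * norm (p x))) \<partial>lebesgue_on \<Omega>)"
  define X where "X = (\<integral>\<^sup>+x. ennreal ((norm (a x) * norm (p x))\<^sup>2) \<partial>lebesgue_on \<Omega>)"
  define Y where "Y = (\<integral>\<^sup>+x. ennreal (norm (a x) ^ 2 * norm (p x) ^ 4) \<partial>lebesgue_on \<Omega>)"
  have CS: "(\<integral>\<^sup>+x. ennreal (f x * g x) \<partial>lebesgue_on \<Omega>)\<^sup>2
      \<le> (\<integral>\<^sup>+x. ennreal ((f x)\<^sup>2) \<partial>lebesgue_on \<Omega>) * (\<integral>\<^sup>+x. ennreal ((g x)\<^sup>2) \<partial>lebesgue_on \<Omega>)"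
    if "f \<in> borel_measurable (lebesgue_on \<Omega>)" "g \<in> borel_measurable (lebesgue_on \<Omega>)"
      "\<And>x. 0 \<le> f x" "\<And>x. 0 \<le> g x" for f g :: "real^3 \<Rightarrow> real"
    using Cauchy_Schwarz_nn_integral[OF measurable_compose[OF that(1) measurable_ennreal]
        measurable_compose[OF that(2) measurable_ennreal]] that(3,4)
    by (simp add: ennreal_power ennreal_mult)
  have J2: "J\<^sup>2 \<le> ennreal ((L2_norm \<Omega> C)\<^sup>2) * X"
    unfolding J_def X_def L2_norm_nn_integral[OF C, symmetric]
    by (intro CS borel_measurable_times n) auto
  have X2: "X\<^sup>2 \<le> ennreal ((L2_norm \<Omega> a)\<^sup>2) * Y"
  proof -
    have "X = (\<integral>\<^sup>+x. ennreal (norm (a x) * (norm (a x) * (norm (p x))\<^sup>2)) \<partial>lebesgue_on \<Omega>)"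
      unfolding X_def by (simp add: power2_eq_square mult_ac)
    moreover have "Y = (\<integral>\<^sup>+x. ennreal ((norm (a x) * (norm (p x))\<^sup>2)\<^sup>2) \<partial>lebesgue_on \<Omega>)"
      unfolding Y_def by (simp add: power_mult_distrib flip: power_mult)
    ultimately show ?thesis
      unfolding L2_norm_nn_integral[OF aL, symmetric]
      by (simp only:) (intro CS borel_measurable_times borel_measurable_power n, auto)
  qed
  \<comment> \<open>The Hoelder step needs strictly positive bounds, while the H1 norms may vanish;
    both are raised by e > 0 and e then tends to 0.\<close>
  define F where "F e = (L2_norm \<Omega> C) ^ 4 * (L2_norm \<Omega> a)\<^sup>2 * ((7 * H1_norm \<Omega> a + e)\<^sup>2 * (7 * H1_norm \<Omega> p + e) ^ 4)" for e
  have JF: "J ^ 4 \<le> ennreal (F e)" if e: "0 < e" for e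
  proof -
    have sob: "(\<integral>\<^sup>+x. ennreal (norm (u x) ^ 6) \<partial>lebesgue_on \<Omega>) \<le> ennreal ((7 * H1_norm \<Omega> u + e) ^ 6)"
      if "u \<in> H10_space \<Omega>" for u
      using e by (intro order.trans[OF Sobolev_embedding[OF that]] ennreal_leI power_mono) (auto simp: H1_norm_nonneg)
    have Y: "Y \<le> ennreal ((7 * H1_norm \<Omega> a + e)\<^sup>2 * (7 * H1_norm \<Omega> p + e) ^ 4)"
      unfolding Y_def using e H1_norm_nonneg
      by (intro nn_integral_power2_power4_le sob a p L2_spaceD(1) aL pL) (auto intro: add_nonneg_pos)
    have "J ^ 4 = (J\<^sup>2)\<^sup>2" by simp
    also have "\<dots> \<le> (ennreal ((L2_norm \<Omega> C)\<^sup>2) * X)\<^sup>2" by (intro power_mono J2) simp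
    also have "\<dots> = ennreal ((L2_norm \<Omega> C) ^ 4) * X\<^sup>2" by (simp add: power_mult_distrib ennreal_power flip: power_mult)
    also have "\<dots> \<le> ennreal ((L2_norm \<Omega> C) ^ 4) * (ennreal ((L2_norm \<Omega> a)\<^sup>2)
        * ennreal ((7 * H1_norm \<Omega> a + e)\<^sup>2 * (7 * H1_norm \<Omega> p + e) ^ 4))"
      by (intro mult_left_mono order.trans[OF X2] Y) auto
    also have "\<dots> = ennreal (F e)"
      using e H1_norm_nonneg by (simp add: F_def ennreal_mult'' mult.assoc)
    finally show ?thesis .
  qed
  have "(\<lambda>n. ennreal (F (inverse (real (Suc n))))) \<longlonglongrightarrow> ennreal (F 0)"
    unfolding F_def by (intro tendsto_ennrealI tendsto_intros LIMSEQ_inverse_real_of_nat)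
  then have "J ^ 4 \<le> ennreal (F 0)"
    by (rule LIMSEQ_le_const) (auto intro!: JF)
  also have "F 0 = (L2_norm \<Omega> C * sqrt (L2_norm \<Omega> a * (7 * H1_norm \<Omega> a)) * (7 * H1_norm \<Omega> p)) ^ 4"
  proof -
    have "sqrt (L2_norm \<Omega> a * (7 * H1_norm \<Omega> a)) ^ 4 = ((sqrt (L2_norm \<Omega> a * (7 * H1_norm \<Omega> a)))\<^sup>2)\<^sup>2" by simp
    also have "\<dots> = (L2_norm \<Omega> a * (7 * H1_norm \<Omega> a))\<^sup>2" by (simp add: L2_norm_nonneg H1_norm_nonneg)
    finally show ?thesis by (simp add: F_def power_mult_distrib)
  qed
  finally have J4: "J ^ 4 \<le> ennreal ((L2_norm \<Omega> C * sqrt (L2_norm \<Omega> a * (7 * H1_norm \<Omega> a)) * (7 * H1_norm \<Omega> p)) ^ 4)" .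
  have R0: "0 \<le> L2_norm \<Omega> C * sqrt (L2_norm \<Omega> a * (7 * H1_norm \<Omega> a)) * (7 * H1_norm \<Omega> p)"
    by (intro mult_nonneg_nonneg) (auto simp: L2_norm_nonneg H1_norm_nonneg)
  have "J ^ 4 < top" using J4 by (rule le_less_trans) simp
  then have "J \<noteq> top" by auto
  then obtain j where j: "J = ennreal j" "0 \<le> j" by (metis ennreal_cases infinity_ennreal_def)
  have "j ^ 4 \<le> (L2_norm \<Omega> C * sqrt (L2_norm \<Omega> a * (7 * H1_norm \<Omega> a)) * (7 * H1_norm \<Omega> p)) ^ 4"
    using J4 j R0 by (simp add: ennreal_power)
  then have "j \<le> L2_norm \<Omega> C * sqrt (L2_norm \<Omega> a * (7 * H1_norm \<Omega> a)) * (7 * H1_norm \<Omega> p)"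
    using R0 by (rule power_le_imp_le_base[where n = 3, unfolded numeral_3_eq_3[symmetric], simplified])
  then show ?thesis unfolding J_def[symmetric] j(1) by (rule ennreal_leI)
qed

lemma trilinear_estimate:
  fixes C :: "real^3 \<Rightarrow> real^3^3"
  assumes C: "C \<in> L2_space \<Omega>" and a: "a \<in> H10_space \<Omega>" and p: "p \<in> H10_space \<Omega>"
  shows "integrable (lebesgue_on \<Omega>) (\<lambda>x. (C x *v a x) \<bullet> p x)"
    and "\<bar>L2_inner \<Omega> (\<lambda>x. C x *v a x) p\<bar>
      \<le> L2_norm \<Omega> C * sqrt (L2_norm \<Omega> a * (7 * H1_norm \<Omega> a)) * (7 * H1_norm \<Omega> p)"
proof -
  let ?R = "L2_norm \<Omega> C * sqrt (L2_norm \<Omega> a * (7 * H1_norm \<Omega> a)) * (7 * H1_norm \<Omega> p)"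
  have aL: "a \<in> L2_space \<Omega>" and pL: "p \<in> L2_space \<Omega>" using a p by (simp_all add: H10_H1 H1_L2)
  have comp: "(\<lambda>x. u x \<bullet> e) \<in> borel_measurable (lebesgue_on \<Omega>)" if "u \<in> L2_space \<Omega>"
    for u :: "real^3 \<Rightarrow> 'b::euclidean_space" and e
    using L2_spaceD(1)[OF that] borel_measurable_const by (rule borel_measurable_inner)
  have comps: "(\<lambda>x. C x $ i $ j) \<in> borel_measurable (lebesgue_on \<Omega>)"
    "(\<lambda>x. a x $ j) \<in> borel_measurable (lebesgue_on \<Omega>)" "(\<lambda>x. p x $ i) \<in> borel_measurable (lebesgue_on \<Omega>)" for i j
    using comp[OF C, of "axis i (axis j 1)"] comp[OF aL, of "axis j 1"] comp[OF pL, of "axis i 1"]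
    by (simp_all add: inner_axis)
  have "(C x *v a x) \<bullet> p x = (\<Sum>i\<in>UNIV. \<Sum>j\<in>UNIV. C x $ i $ j * a x $ j * p x $ i)" for x
    by (simp add: inner_vec_def matrix_vector_mult_def sum_distrib_right)
  then have m: "(\<lambda>x. (C x *v a x) \<bullet> p x) \<in> borel_measurable (lebesgue_on \<Omega>)"
    by (simp only:) (intro borel_measurable_sum borel_measurable_times comps)
  have le: "norm ((C x *v a x) \<bullet> p x) \<le> norm (C x) * (norm (a x) * norm (p x))" for x
  proof -
    have "norm ((C x *v a x) \<bullet> p x) \<le> norm (C x *v a x) * norm (p x)"
      using Cauchy_Schwarz_ineq2 by simp
    also have "\<dots> \<le> (norm (C x) * norm (a x)) * norm (p x)"
      by (intro mult_right_mono norm_matrix_vector_mult_le) simp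
    finally show ?thesis by (simp add: mult.assoc)
  qed
  have nn: "(\<integral>\<^sup>+x. ennreal (norm ((C x *v a x) \<bullet> p x)) \<partial>lebesgue_on \<Omega>) \<le> ennreal ?R"
    by (rule order.trans[OF nn_integral_mono[OF ennreal_leI[OF le]] trilinear_nn_integral_le[OF C a p]])
  show i: "integrable (lebesgue_on \<Omega>) (\<lambda>x. (C x *v a x) \<bullet> p x)"
    using m le_less_trans[OF nn ennreal_less_top] by (simp add: integrable_iff_bounded)
  have R0: "0 \<le> ?R"
    by (intro mult_nonneg_nonneg) (auto simp: L2_norm_nonneg H1_norm_nonneg)
  have "ennreal (norm (L2_inner \<Omega> (\<lambda>x. C x *v a x) p)) \<le> ennreal ?R"
    unfolding L2_inner_def by (rule order.trans[OF integral_norm_bound_ennreal[OF i] nn])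
  then show "\<bar>L2_inner \<Omega> (\<lambda>x. C x *v a x) p\<bar> \<le> ?R" using R0 by simp
qed

end

section \<open>Functions with an integrable weak derivative\<close>

text \<open>On [s, m] the functions \<open>\<psi>' n\<close> are nonnegative densities whose mass
  tends to 1, while their mass on [z, m] tends to 0 for each z > s. The limit is therefore a unit
  mass at s.\<close>

lemma monotone_approximate_delta:
  fixes c :: "real \<Rightarrow> real" and \<psi> \<psi>' :: "nat \<Rightarrow> real \<Rightarrow> real"
  assumes sm: "s < m" and c: "continuous_on {s..m} c"
    and der: "\<And>n x. (\<psi> n has_real_derivative \<psi>' n x) (at x)" and cont: "\<And>n. continuous_on UNIV (\<psi>' n)"
    and pos: "\<And>n x. s \<le> x \<Longrightarrow> x \<le> m \<Longrightarrow> 0 \<le> \<psi>' n x"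
    and start: "\<And>n. \<psi> n s = 0" and lim: "\<And>x. s < x \<Longrightarrow> x \<le> m \<Longrightarrow> (\<lambda>n. \<psi> n x) \<longlonglongrightarrow> 1"
    and le1: "\<And>n x. \<psi> n x \<le> 1"
  shows "(\<lambda>n. integral {s..m} (\<lambda>x. c x * \<psi>' n x)) \<longlonglongrightarrow> c s"
proof -
  have ftc: "(\<psi>' n has_integral \<psi> n y - \<psi> n x) {x..y}" if "x \<le> y" for n x y
    using that der by (intro fundamental_theorem_of_calculus)
      (auto simp: has_real_derivative_iff_has_vector_derivative[symmetric] intro: has_field_derivative_at_within)
  have int: "(\<lambda>x. f x * \<psi>' n x) integrable_on {x..y}" if "continuous_on {s..m} f" "s \<le> x" "y \<le> m" for f n x y
    using that by (intro integrable_continuous_real continuous_intros continuous_on_subset[OF that(1)]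
        continuous_on_subset[OF cont]) auto
  obtain B where B: "\<And>x. x \<in> {s..m} \<Longrightarrow> \<bar>c x - c s\<bar> \<le> B"
  proof -
    have "continuous_on {s..m} (\<lambda>x. c x - c s)" by (intro continuous_intros c)
    then have "bounded ((\<lambda>x. c x - c s) ` {s..m})" by (intro compact_imp_bounded compact_continuous_image) auto
    then have "\<exists>B. \<forall>x\<in>{s..m}. \<bar>c x - c s\<bar> \<le> B" by (auto simp: bounded_iff)
    then show ?thesis using that by blast
  qed
  have "(\<lambda>n. integral {s..m} (\<lambda>x. (c x - c s) * \<psi>' n x)) \<longlonglongrightarrow> 0"
  proof (rule tendstoI)
    fix e :: real assume e: "0 < e"
    obtain h where h: "0 < h" "\<And>x. x \<in> {s..m} \<Longrightarrow> dist x s < h \<Longrightarrow> dist (c x) (c s) < e / 2"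
      using c[unfolded continuous_on_iff, rule_format, of s "e / 2"] sm e by auto
    define z where "z = min m (s + h / 2)"
    have z: "s < z" "z \<le> m" "\<And>x. s \<le> x \<Longrightarrow> x \<le> z \<Longrightarrow> \<bar>c x - c s\<bar> \<le> e / 2"
      using h sm by (auto simp: z_def dist_real_def intro!: less_imp_le)
    have "(\<lambda>n. B * (\<psi> n m - \<psi> n z)) \<longlonglongrightarrow> B * (1 - 1)"
      using z sm by (intro tendsto_intros lim) auto
    then have "\<forall>\<^sub>F n in sequentially. B * (\<psi> n m - \<psi> n z) < e / 2"
      using e by (auto dest: order_tendstoD(2)[where a = "e / 2"])
    then show "\<forall>\<^sub>F n in sequentially. dist (integral {s..m} (\<lambda>x. (c x - c s) * \<psi>' n x)) 0 < e"
    proof eventually_elim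
      case (elim n)
      have ci: "continuous_on {s..m} (\<lambda>x. c x - c s)" by (intro continuous_intros c)
      have le: "norm ((c x - c s) * \<psi>' n x) \<le> b * \<psi>' n x" if "\<bar>c x - c s\<bar> \<le> b" "0 \<le> \<psi>' n x" for x b
        using mult_right_mono[OF that] that(2) by (simp add: abs_mult)
      have split: "integral {s..m} (\<lambda>x. (c x - c s) * \<psi>' n x)
          = integral {s..z} (\<lambda>x. (c x - c s) * \<psi>' n x) + integral {z..m} (\<lambda>x. (c x - c s) * \<psi>' n x)"
        using z by (intro Henstock_Kurzweil_Integration.integral_combine[symmetric] int ci) auto
      have bnd: "norm (integral {x..y} (\<lambda>x. (c x - c s) * \<psi>' n x)) \<le> b * (\<psi> n y - \<psi> n x)"
        if "s \<le> x" "x \<le> y" "y \<le> m" "\<And>r. x \<le> r \<Longrightarrow> r \<le> y \<Longrightarrow> \<bar>c r - c s\<bar> \<le> b" for x y b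
      proof -
        have I: "((\<lambda>r. b * \<psi>' n r) has_integral b * (\<psi> n y - \<psi> n x)) {x..y}"
          by (intro has_integral_mult_right ftc that)
        have "norm (integral {x..y} (\<lambda>x. (c x - c s) * \<psi>' n x)) \<le> integral {x..y} (\<lambda>r. b * \<psi>' n r)"
        proof (rule integral_norm_bound_integral)
          show "(\<lambda>r. b * \<psi>' n r) integrable_on {x..y}" using I by blast
          show "norm ((c r - c s) * \<psi>' n r) \<le> b * \<psi>' n r" if "r \<in> {x..y}" for r
            using that \<open>s \<le> x\<close> \<open>y \<le> m\<close> by (intro le pos \<open>\<And>r. x \<le> r \<Longrightarrow> r \<le> y \<Longrightarrow> \<bar>c r - c s\<bar> \<le> b\<close>) auto
        qed (intro int ci that)
        then show ?thesis unfolding integral_unique[OF I] .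
      qed
      have "norm (integral {s..z} (\<lambda>x. (c x - c s) * \<psi>' n x)) \<le> e / 2 * (\<psi> n z - \<psi> n s)"
        using z by (intro bnd) auto
      moreover have "norm (integral {z..m} (\<lambda>x. (c x - c s) * \<psi>' n x)) \<le> B * (\<psi> n m - \<psi> n z)"
        using z by (intro bnd B) auto
      moreover have "e / 2 * (\<psi> n z - \<psi> n s) \<le> e / 2"
        using e le1[of n z] start[of n] by simp
      ultimately show ?case using elim split by simp
    qed
  qed
  moreover have "(\<lambda>n. c s * (\<psi> n m - \<psi> n s)) \<longlonglongrightarrow> c s * (1 - 0)"
    using sm by (intro tendsto_intros lim) (auto simp: start)
  moreover have "integral {s..m} (\<lambda>x. c x * \<psi>' n x)
      = integral {s..m} (\<lambda>x. (c x - c s) * \<psi>' n x) + c s * (\<psi> n m - \<psi> n s)" for n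
  proof -
    have "((\<lambda>x. (c x - c s) * \<psi>' n x + c s * \<psi>' n x) has_integral
        integral {s..m} (\<lambda>x. (c x - c s) * \<psi>' n x) + c s * (\<psi> n m - \<psi> n s)) {s..m}"
      using sm by (intro has_integral_add has_integral_mult_right ftc integrable_integral int continuous_intros c) auto
    then show ?thesis by (simp add: algebra_simps integral_unique)
  qed
  ultimately show ?thesis using tendsto_add by fastforce
qed

text \<open>\<open>flat_exp (monom 1 2)\<close> is s^(-2) exp(-1/s), the derivative of the profile
  exp(-1/s); the rest is the product and chain rule.\<close>

definition box_bump_deriv :: "nat \<Rightarrow> real \<Rightarrow> real \<Rightarrow> real \<Rightarrow> real" where
  "box_bump_deriv n s t x =
     real (Suc n) * (flat_exp (monom 1 2) (real (Suc n) * (x - s)) * flat_exp 1 (real (Suc n) * (t - x))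
       - flat_exp 1 (real (Suc n) * (x - s)) * flat_exp (monom 1 2) (real (Suc n) * (t - x)))"

lemma box_bump_real: "box_bump n s t x = flat_exp 1 (real (Suc n) * (x - s)) * flat_exp 1 (real (Suc n) * (t - x))"
  for s t x :: real
  by (simp add: box_bump_def)

lemma box_bump_has_real_derivative:
  "(box_bump n s t has_real_derivative box_bump_deriv n s t x) (at x)"
proof -
  have f: "(flat_exp 1 has_real_derivative flat_exp (monom 1 2) y) (at y)" for y
    using flat_exp_has_derivative[of 1 y] by simp
  have "((\<lambda>x. flat_exp 1 (real (Suc n) * (x - s)) * flat_exp 1 (real (Suc n) * (t - x)))
      has_real_derivative box_bump_deriv n s t x) (at x)"
    unfolding box_bump_deriv_def
    by (rule derivative_eq_intros DERIV_chain'[where g = "flat_exp 1", OF _ f] refl)+ (simp add: algebra_simps)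
  then show ?thesis by (simp add: box_bump_real[abs_def])
qed

lemma flat_exp_continuous: "continuous_on A (flat_exp p)"
  by (intro continuous_at_imp_continuous_on ballI DERIV_isCont[OF flat_exp_has_derivative])

lemma box_bump_deriv_continuous: "continuous_on A (box_bump_deriv n s t)"
  unfolding box_bump_deriv_def
  by (intro continuous_intros continuous_on_compose2[OF flat_exp_continuous[of UNIV]]) auto

lemma box_bump_deriv_outside: "x \<notin> {s<..<t} \<Longrightarrow> box_bump_deriv n s t x = 0"
  by (auto simp: box_bump_deriv_def flat_exp_def mult_le_0_iff not_less)

lemma box_bump_deriv_reflect: "box_bump_deriv n s t (s + t - x) = - box_bump_deriv n s t x"
  by (simp add: box_bump_deriv_def algebra_simps)

text \<open>Left of the midpoint a \<le> b for the two scaled distances to the endpoints, and the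
  derivative is a nonnegative multiple of 1/a^2 - 1/b^2.\<close>

lemma box_bump_deriv_nonneg:
  assumes "x \<le> (s + t) / 2" shows "0 \<le> box_bump_deriv n s t x"
proof (cases "x \<in> {s<..<t}")
  case True
  define a b where "a = real (Suc n) * (x - s)" and "b = real (Suc n) * (t - x)"
  have "x - s \<le> t - x" using assms by simp
  then have ab: "0 < a" "a \<le> b" unfolding a_def b_def using True by (auto intro!: mult_left_mono)
  then have "inverse b \<le> inverse a" by simp
  then have "(inverse b)\<^sup>2 \<le> (inverse a)\<^sup>2" using ab by (intro power_mono) auto
  then have "0 \<le> ((inverse a)\<^sup>2 - (inverse b)\<^sup>2) * exp (- inverse a) * exp (- inverse b)" by simp
  also have "\<dots> = flat_exp (monom 1 2) a * flat_exp 1 b - flat_exp 1 a * flat_exp (monom 1 2) b"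
    using ab by (simp add: flat_exp_def poly_monom algebra_simps)
  finally show ?thesis unfolding box_bump_deriv_def a_def[symmetric] b_def[symmetric] by simp
qed (simp add: box_bump_deriv_outside)

text \<open>Up to the midpoint the derivative approximates a unit mass at s. The reflection of x to
  s + t - x maps the right half onto the left one and reverses the sign, which produces the negative
  mass at t.\<close>

lemma box_bump_deriv_delta:
  fixes c :: "real \<Rightarrow> real"
  assumes st: "s < t" and c: "continuous_on {s..t} c"
  shows "(\<lambda>n. integral {s..t} (\<lambda>x. c x * box_bump_deriv n s t x)) \<longlonglongrightarrow> c s - c t"
proof -
  define m where "m = (s + t) / 2"
  have "s < m" "m < t" using st by (auto simp: m_def)
  moreover have "s + t - m = m" unfolding m_def by argo
  ultimately have m: "s < m" "m < t" "s + t - m = m" by auto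
  have half: "(\<lambda>n. integral {s..m} (\<lambda>x. d x * box_bump_deriv n s t x)) \<longlonglongrightarrow> d s"
    if "continuous_on {s..m} d" for d :: "real \<Rightarrow> real"
  proof (rule monotone_approximate_delta[OF m(1) that])
    show "(\<lambda>n. box_bump n s t x) \<longlonglongrightarrow> 1" if "s < x" "x \<le> m" for x
      using that m by (intro box_bump_tendsto) auto
    show "0 \<le> box_bump_deriv n s t x" if "s \<le> x" "x \<le> m" for n x
      using that by (intro box_bump_deriv_nonneg) (simp add: m_def)
  qed (auto intro: box_bump_has_real_derivative box_bump_deriv_continuous box_bump_range box_bump_outside)
  have left: "(\<lambda>n. integral {s..m} (\<lambda>x. c x * box_bump_deriv n s t x)) \<longlonglongrightarrow> c s"
    using m by (intro half continuous_on_subset[OF c]) auto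
  have right: "(\<lambda>n. integral {s..m} (\<lambda>x. c (s + t - x) * box_bump_deriv n s t x)) \<longlonglongrightarrow> c (s + t - s)"
    using m by (intro half continuous_on_compose2[OF c] continuous_intros) auto
  have int: "(\<lambda>x. c x * box_bump_deriv n s t x) integrable_on {x..y}" if "s \<le> x" "y \<le> t" for n x y
    using that by (intro integrable_continuous_real continuous_intros box_bump_deriv_continuous continuous_on_subset[OF c]) auto
  have refl: "integral {m..t} (\<lambda>x. c x * box_bump_deriv n s t x)
      = - integral {s..m} (\<lambda>x. c (s + t - x) * box_bump_deriv n s t x)" for n
  proof -
    let ?f = "\<lambda>x. c x * box_bump_deriv n s t x"
    have "((\<lambda>x. ?f (- x)) has_integral integral {m..t} ?f) {- t..- m}"
      by (rule has_integral_reflect_real[THEN iffD2, OF integrable_integral[OF int]]) (use m in auto)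
    from has_integral_shift_real_ivl[OF this, of "- (s + t)"]
    have "((\<lambda>x. ?f (s + t - x)) has_integral integral {m..t} ?f) {s..m}"
      using m by (simp add: algebra_simps)
    then have "((\<lambda>x. - (c (s + t - x) * box_bump_deriv n s t x)) has_integral integral {m..t} ?f) {s..m}"
      by (simp add: box_bump_deriv_reflect)
    from has_integral_neg[OF this] show ?thesis by (simp add: integral_unique)
  qed
  have "integral {s..t} (\<lambda>x. c x * box_bump_deriv n s t x)
      = integral {s..m} (\<lambda>x. c x * box_bump_deriv n s t x)
        - integral {s..m} (\<lambda>x. c (s + t - x) * box_bump_deriv n s t x)" for n
    using Henstock_Kurzweil_Integration.integral_combine[of s m t "\<lambda>x. c x * box_bump_deriv n s t x"] m int[of s t] refl[of n]
    by simp
  then show ?thesis using tendsto_diff[OF left right] by simp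
qed

text \<open>The bumps tend to the indicator of \<open>(s, t)\<close> and their derivatives to \<open>\<delta>\<^sub>s - \<delta>\<^sub>t\<close>.\<close>

lemma weak_derivative_increment:
  fixes c g :: "real \<Rightarrow> real"
  assumes c: "continuous_on {0..T} c" and g: "integrable (lebesgue_on {0<..<T}) g"
    and weak: "\<And>\<psi>. \<psi> \<in> test_functions {0<..<T} \<Longrightarrow>
      (\<integral>t. c t * deriv \<psi> t \<partial>lebesgue_on {0<..<T}) = - (\<integral>t. g t * \<psi> t \<partial>lebesgue_on {0<..<T})"
    and st: "0 < s" "s < t" "t < T"
  shows "c t - c s = (\<integral>x. indicator {s<..<t} x * g x \<partial>lebesgue_on {0<..<T})"
proof -
  let ?M = "lebesgue_on {0<..<T}"
  have b: "box_bump n s t \<in> borel_measurable ?M" for n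
    using box_bump_smooth[of n s t]
    by (intro measurable_restrict_space1 measurable_completion)
       (auto simp: smooth_on_def dest!: spec[of _ 0] intro: borel_measurable_continuous_onI)
  have cs: "continuous_on {s..t} c" using st by (intro continuous_on_subset[OF c]) auto
  have 1: "(\<lambda>n. \<integral>x. g x * box_bump n s t x \<partial>?M) \<longlonglongrightarrow> (\<integral>x. indicator {s<..<t} x * g x \<partial>?M)"
  proof (rule integral_dominated_convergence[where w = "\<lambda>x. norm (g x)"])
    show "integrable ?M (\<lambda>x. norm (g x))" using g by (rule integrable_norm)
    show "(\<lambda>x. g x * box_bump n s t x) \<in> borel_measurable ?M" for n
      by (intro borel_measurable_times borel_measurable_integrable[OF g] b)
    show "(\<lambda>x. indicator {s<..<t} x * g x) \<in> borel_measurable ?M"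
      by (intro borel_measurable_times borel_measurable_integrable[OF g] borel_measurable_indicator')
         (auto intro: measurable_restrict_space1 sets_restrict_space_iff[THEN iffD2])
    show "AE x in ?M. norm (g x * box_bump n s t x) \<le> norm (g x)" for n
      using box_bump_range[of n s t] by (auto simp: abs_mult mult_right_le_one_le)
    show "AE x in ?M. (\<lambda>n. g x * box_bump n s t x) \<longlonglongrightarrow> indicator {s<..<t} x * g x"
    proof (intro AE_I2)
      fix x
      show "(\<lambda>n. g x * box_bump n s t x) \<longlonglongrightarrow> indicator {s<..<t} x * g x"
        using tendsto_mult[OF tendsto_const box_bump_tendsto, of x s t "g x"]
        by (cases "x \<in> {s<..<t}") (auto simp: box_bump_outside)
    qed
  qed
  have 2: "(\<integral>x. g x * box_bump n s t x \<partial>?M) = - integral {s..t} (\<lambda>x. c x * box_bump_deriv n s t x)" for n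
  proof -
    have d: "deriv (box_bump n s t) = box_bump_deriv n s t"
      by (auto intro!: DERIV_imp_deriv box_bump_has_real_derivative)
    let ?f = "\<lambda>x. c x * box_bump_deriv n s t x"
    have z: "?f x = 0" if "x \<notin> {s..t}" for x using that by (subst box_bump_deriv_outside) auto
    have fi: "?f absolutely_integrable_on {s..t}"
      by (intro absolutely_integrable_continuous_real continuous_intros cs box_bump_deriv_continuous)
    have "(\<integral>x. ?f x \<partial>?M) = (\<integral>x. indicator {0<..<T} x *\<^sub>R ?f x \<partial>lebesgue)"
      by (rule integral_restrict_space) simp
    also have "(\<lambda>x. indicator {0<..<T} x *\<^sub>R ?f x) = (\<lambda>x. indicator {s..t} x *\<^sub>R ?f x)"
      using z st by (auto simp: fun_eq_iff indicator_def)
    also have "(\<integral>x. indicator {s..t} x *\<^sub>R ?f x \<partial>lebesgue) = integral {s..t} ?f"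
      using set_lebesgue_integral_eq_integral(2)[OF fi] by (simp add: set_lebesgue_integral_def)
    finally show ?thesis
      using weak[OF box_bump_test_function[of s t "{0<..<T}" n]] st unfolding d by (simp add: subset_iff)
  qed
  have "(\<lambda>n. - integral {s..t} (\<lambda>x. c x * box_bump_deriv n s t x)) \<longlonglongrightarrow> - (c s - c t)"
    by (intro tendsto_minus box_bump_deriv_delta st cs)
  then show ?thesis using LIMSEQ_unique[OF 1] unfolding 2 by auto
qed

section \<open>Strong continuity from the Gram kernel\<close>

lemma integral_le_negligible:
  fixes f g :: "'a::euclidean_space \<Rightarrow> real"
  assumes "f integrable_on S" "g integrable_on S" "negligible N" "\<And>x. x \<in> S - N \<Longrightarrow> f x \<le> g x"
  shows "integral S f \<le> integral S g"
proof -
  let ?g = "\<lambda>x. if x \<in> N then f x else g x"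
  have "integral S f \<le> integral S ?g"
    by (rule integral_le[OF assms(1) integrable_spike[OF assms(2,3)]]) (use assms(4) in auto)
  also have "\<dots> = integral S g"
    by (rule integral_spike[OF assms(3)]) auto
  finally show ?thesis .
qed

text \<open>Weak continuity makes the Gram kernel only separately continuous, so its diagonal, the
  squared norm, need not be continuous. Rounding the second argument down to a grid leaves countably
  many continuous functions of the first, and refining the grid converges by continuity in the
  second argument.\<close>

lemma separately_continuous_diagonal_measurable:
  fixes k :: "real \<Rightarrow> real \<Rightarrow> real"
  assumes "\<And>y. continuous_on UNIV (\<lambda>x. k x y)" "\<And>x. continuous_on UNIV (k x)"
  shows "(\<lambda>x. k (x + a) (x + b)) \<in> borel_measurable borel"
proof (rule borel_measurable_LIMSEQ_real)
  let ?q = "\<lambda>n x. \<lfloor>real (Suc n) * (x + b)\<rfloor>"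
  show "(\<lambda>n. k (x + a) (of_int (?q n x) / real (Suc n))) \<longlonglongrightarrow> k (x + a) (x + b)" for x
  proof -
    have "(\<lambda>n. of_int (?q n x) / real (Suc n)) \<longlonglongrightarrow> x + b"
    proof (rule tendsto_sandwich[where f = "\<lambda>n. x + b - inverse (real (Suc n))" and h = "\<lambda>n. x + b"])
      show "(\<lambda>n. x + b - inverse (real (Suc n))) \<longlonglongrightarrow> x + b"
        using tendsto_diff[OF tendsto_const LIMSEQ_inverse_real_of_nat, of "x + b"] by simp
      have l: "real (Suc n) * (x + b) - 1 \<le> of_int (?q n x)" and u: "of_int (?q n x) \<le> real (Suc n) * (x + b)" for n
        by linarith+
      show "\<forall>\<^sub>F n in sequentially. x + b - inverse (real (Suc n)) \<le> of_int (?q n x) / real (Suc n)"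
      proof (intro always_eventually allI)
        fix n
        have "(real (Suc n) * (x + b) - 1) / real (Suc n) \<le> of_int (?q n x) / real (Suc n)"
          by (intro divide_right_mono l) simp
        then show "x + b - inverse (real (Suc n)) \<le> of_int (?q n x) / real (Suc n)"
          by (simp add: diff_divide_distrib inverse_eq_divide del: of_nat_Suc)
      qed
      show "\<forall>\<^sub>F n in sequentially. of_int (?q n x) / real (Suc n) \<le> x + b"
        using u by (intro always_eventually allI) (simp add: field_simps del: of_nat_Suc)
    qed auto
    moreover have "isCont (k (x + a)) (x + b)"
      using assms(2) by (simp add: continuous_on_eq_continuous_at)
    ultimately show ?thesis by (rule isCont_tendsto_compose[rotated])
  qed
  show "(\<lambda>x. k (x + a) (of_int (?q n x) / real (Suc n))) \<in> borel_measurable borel" for n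
  proof (rule measurable_compose_countable[where f = "\<lambda>i x. k (x + a) (of_int i / real (Suc n))"])
    show "(\<lambda>x. k (x + a) (real_of_int i / real (Suc n))) \<in> borel_measurable borel" for i
      by (intro borel_measurable_continuous_onI continuous_on_compose2[OF assms(1)] continuous_intros) auto
  qed measurable
qed

text \<open>After exchanging the integrals, each point of [s, s + d + h] is covered by the moving
  window for a time of at most h. The proof expresses this through the monotone primitive P.\<close>

lemma Steklov_average_le:
  fixes g :: "real \<Rightarrow> real"
  assumes g: "\<And>a b. g integrable_on {a..b}" "\<And>x. 0 \<le> g x" and "0 \<le> h" "0 \<le> d"
  shows "(\<lambda>t. integral {s + t..s + t + h} g) integrable_on {0..d}"
    and "integral {0..d} (\<lambda>t. integral {s + t..s + t + h} g) \<le> h * integral {s..s + d + h} g"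
proof -
  define P where "P t = integral {s..t} g" for t
  have diff: "integral {x..y} g = P y - P x" if "s \<le> x" "x \<le> y" for x y
    using Henstock_Kurzweil_Integration.integral_combine[OF that g(1)] by (simp add: P_def)
  have cont: "continuous_on {s..y} P" for y
    unfolding P_def by (rule indefinite_integral_continuous_1[OF g(1)])
  have int: "P integrable_on {x..y}" if "s \<le> x" for x y
    using continuous_on_subset[OF cont[of y], of "{x..y}"] that by (intro integrable_continuous_real) auto
  have mono: "P x \<le> P y" if "s \<le> x" "x \<le> y" for x y
    using diff[OF that] integral_nonneg[OF g(1)] g(2) by (metis diff_ge_0_iff_ge)
  have eq: "integral {s + t..s + t + h} g = (P \<circ> (+) (s + h)) t - (P \<circ> (+) s) t" if "t \<in> {0..d}" for t
    using that assms by (simp add: diff algebra_simps)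
  have i1: "(P \<circ> (+) s) integrable_on {0..d}" "(P \<circ> (+) (s + h)) integrable_on {0..d}"
    unfolding integrable_on_def has_integral_shift_Icc_real
    using int assms by (auto simp: integrable_on_def algebra_simps)
  from integrable_diff[OF i1(2,1)]
  show "(\<lambda>t. integral {s + t..s + t + h} g) integrable_on {0..d}"
    by (rule integrable_eq) (use eq in auto)
  have "integral {0..d} (\<lambda>t. integral {s + t..s + t + h} g)
      = integral {0..d} (\<lambda>t. (P \<circ> (+) (s + h)) t - (P \<circ> (+) s) t)"
    by (rule integral_cong) (use eq in auto)
  also have "\<dots> = integral {s + h..s + d + h} P - integral {s..s + d} P"
    by (subst integral_diff[OF i1(2,1)], simp add: integral_shift_Icc_real algebra_simps)
  \<comment> \<open>Both differences arise from the integral of P over [s, s + d + h], split once at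
    s + h and once at s + d.\<close>
  also have "\<dots> = integral {s + d..s + d + h} P - integral {s..s + h} P"
    using Henstock_Kurzweil_Integration.integral_combine[of s "s + h" "s + d + h" P]
      Henstock_Kurzweil_Integration.integral_combine[of s "s + d" "s + d + h" P] assms int[of s] by simp
  also have "\<dots> \<le> h * P (s + d + h) - h * P s"
  proof (rule diff_mono)
    have "integral {s + d..s + d + h} P \<le> integral {s + d..s + d + h} (\<lambda>_. P (s + d + h))"
      using assms by (intro integral_le int) (auto intro: mono)
    then show "integral {s + d..s + d + h} P \<le> h * P (s + d + h)" using assms by simp
    have "integral {s..s + h} (\<lambda>_. P s) \<le> integral {s..s + h} P"
      using assms by (intro integral_le int) (auto intro: mono)
    then show "h * P s \<le> integral {s..s + h} P" using assms by simp
  qed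
  also have "\<dots> = h * integral {s..s + d + h} g" by (simp add: P_def algebra_simps)
  finally show "integral {0..d} (\<lambda>t. integral {s + t..s + t + h} g) \<le> h * integral {s..s + d + h} g" .
qed

text \<open>Used for \<open>k s t = (u(s), u(t))\<close> and \<open>U s = \<parallel>u(s)\<parallel>\<^bsub>H1\<^esub>\<close>, so that \<open>D s t = \<parallel>u(s) - u(t)\<parallel>\<^bsub>L2\<^esub>\<^sup>2\<close> below.
  The set \<open>N\<close> contains the times at which \<open>u\<close> is not in \<open>V\<close>.\<close>

locale weak_gram_kernel =
  fixes k :: "real \<Rightarrow> real \<Rightarrow> real" and U G :: "real \<Rightarrow> real" and T M :: real and N :: "real set"
  assumes sym: "k s t = k t s"
    and psd: "2 * (k a c - k a d - k b c + k b d) \<le> (k a a - 2 * k a b + k b b) + (k c c - 2 * k c d + k d d)"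
    and cont: "continuous_on UNIV (k s)"
    and bound: "\<bar>k s t\<bar> \<le> M"
    and negl: "negligible N"
    and good: "s \<in> {0..T} - N \<Longrightarrow> 0 \<le> t' \<Longrightarrow> t' \<le> t \<Longrightarrow> t \<le> T \<Longrightarrow>
      \<bar>k t s - k t' s\<bar> \<le> U s * integral {t'..t} G"
    and G_int: "G integrable_on {a..b}"
    and G2_int: "(\<lambda>t. (G t)\<^sup>2) integrable_on {a..b}"
    and U2_int: "(\<lambda>t. (U t)\<^sup>2) integrable_on {a..b}"
begin

definition D :: "real \<Rightarrow> real \<Rightarrow> real" where "D s t = k s s - 2 * k s t + k t t"

lemma D_sym: "D s t = D t s" by (simp add: D_def sym)

lemma D_bound: "\<bar>D s t\<bar> \<le> 4 * M"
  using bound[of s s] bound[of s t] bound[of t t] unfolding D_def by linarith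

text \<open>\<open>psd\<close> is the expansion of 0 \<le> |(a - b) - (c - d)|^2 in Gram form. Here
  c - d is the negative of a - b, so the expression is 4 D.\<close>

lemma D_nonneg: "0 \<le> D s t"
  using psd[of s t s t] by (simp add: D_def sym)

lemma D_integrable: "(\<lambda>t. D (x + t) (y + t)) integrable_on {a..b}"
proof (rule measurable_bounded_by_integrable_imp_integrable[where g = "\<lambda>_. 4 * M"])
  have m: "(\<lambda>t. k (t + x) (t + y)) \<in> borel_measurable borel" for x y
    using cont by (intro separately_continuous_diagonal_measurable) (auto simp: sym[of _ y for y])
  have "(\<lambda>t. D (x + t) (y + t)) \<in> borel_measurable borel"
    unfolding D_def using m[of x x] m[of x y] m[of y y] by (simp add: add.commute)
  then show "(\<lambda>t. D (x + t) (y + t)) \<in> borel_measurable (lebesgue_on {a..b})"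
    by (intro measurable_restrict_space1 measurable_completion) simp
qed (use D_bound in auto)

text \<open>Integrate (G - c)^2 \<ge> 0 over the window. It replaces the product of a frozen value
  U(s) with the integral of G by a sum in U(s)^2 and G^2, which can be integrated over s
  afterwards.\<close>

lemma amgm: "0 \<le> h \<Longrightarrow> c * integral {a..a + h} G \<le> (h * c\<^sup>2 + integral {a..a + h} (\<lambda>t. (G t)\<^sup>2)) / 2"
proof -
  assume "0 \<le> h"
  have "((\<lambda>t. (G t)\<^sup>2 - (2 * c) * G t + c\<^sup>2) has_integral
      integral {a..a + h} (\<lambda>t. (G t)\<^sup>2) - (2 * c) * integral {a..a + h} G + (a + h - a) *\<^sub>R c\<^sup>2) {a..a + h}"
    using \<open>0 \<le> h\<close>
    using has_integral_const_real[of "c\<^sup>2" a "a + h"]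
    by (intro has_integral_add has_integral_diff has_integral_mult_right integrable_integral G2_int G_int) simp
  from has_integral_nonneg[OF this]
  have "0 \<le> integral {a..a + h} (\<lambda>t. (G t)\<^sup>2) - (2 * c) * integral {a..a + h} G + (a + h - a) *\<^sub>R c\<^sup>2"
    using zero_le_power2[of "G _ - c"] by (auto simp: power2_diff algebra_simps)
  then show ?thesis by (simp add: algebra_simps)
qed

text \<open>For p = u(x + h) - u(y + h) and q = u(x) - u(y) one has |p|^2 - |q|^2 = (p - q, p + q).
  This is a signed sum of eight kernel increments, in x or y, each tested at one of the four times:
  every time is tested twice and every increment four times.\<close>

lemma D_increment:
  assumes "0 \<le> h" and x: "x \<in> {0..T} - N" "x + h \<in> {0..T} - N"
    and y: "y \<in> {0..T} - N" "y + h \<in> {0..T} - N"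
  shows "\<bar>D (x + h) (y + h) - D x y\<bar> \<le> h * ((U x)\<^sup>2 + (U (x + h))\<^sup>2 + (U y)\<^sup>2 + (U (y + h))\<^sup>2)
     + 2 * (integral {x..x + h} (\<lambda>t. (G t)\<^sup>2) + integral {y..y + h} (\<lambda>t. (G t)\<^sup>2))"
proof -
  have *: "\<bar>k (a + h) s - k a s\<bar> \<le> (h * (U s)\<^sup>2 + integral {a..a + h} (\<lambda>t. (G t)\<^sup>2)) / 2"
    if "s \<in> {0..T} - N" "a \<in> {0..T} - N" "a + h \<in> {0..T} - N" for s a
    using good[OF that(1), of a "a + h"] amgm[OF \<open>0 \<le> h\<close>, of "U s" a] that \<open>0 \<le> h\<close> by auto
  have up: "k (a + h) s - k a s \<le> (h * (U s)\<^sup>2 + integral {a..a + h} (\<lambda>t. (G t)\<^sup>2)) / 2"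
    and lo: "k a s - k (a + h) s \<le> (h * (U s)\<^sup>2 + integral {a..a + h} (\<lambda>t. (G t)\<^sup>2)) / 2"
    if "s \<in> {0..T} - N" "a \<in> {0..T} - N" "a + h \<in> {0..T} - N" for s a
    using *[OF that] by linarith+
  note syms = sym[of x "x + h"] sym[of y "y + h"] sym[of y x] sym[of "y + h" x] sym[of y "x + h"]
      sym[of "y + h" "x + h"]
  have "D (x + h) (y + h) - D x y \<le> h * ((U x)\<^sup>2 + (U (x + h))\<^sup>2 + (U y)\<^sup>2 + (U (y + h))\<^sup>2)
     + 2 * (integral {x..x + h} (\<lambda>t. (G t)\<^sup>2) + integral {y..y + h} (\<lambda>t. (G t)\<^sup>2))"
    using up[OF x(1) x] up[OF x(2) x] lo[OF y(1) x] lo[OF y(2) x] lo[OF x(1) y] lo[OF x(2) y] up[OF y(1) y] up[OF y(2) y]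
    unfolding D_def syms distrib_left by argo
  moreover have "D x y - D (x + h) (y + h) \<le> h * ((U x)\<^sup>2 + (U (x + h))\<^sup>2 + (U y)\<^sup>2 + (U (y + h))\<^sup>2)
     + 2 * (integral {x..x + h} (\<lambda>t. (G t)\<^sup>2) + integral {y..y + h} (\<lambda>t. (G t)\<^sup>2))"
    using lo[OF x(1) x] lo[OF x(2) x] up[OF y(1) x] up[OF y(2) x] up[OF x(1) y] up[OF x(2) y] lo[OF y(1) y] lo[OF y(2) y]
    unfolding D_def syms distrib_left by argo
  ultimately show ?thesis by linarith
qed


text \<open>The increment estimate for step h is integrated over the shifts t in [0, d]. The terms
  with G^2 are moving-window integrals, so they too gain a factor h; after division by h the
  averages over the first and the last short window differ by at most 2 w in this direction.\<close>

lemma D_window_increment: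
  assumes d: "0 \<le> d" and h: "0 \<le> h" and x: "0 \<le> x" "x + d + h \<le> T" and y: "0 \<le> y" "y + d + h \<le> T"
    and w: "integral {x..x + d + h} (\<lambda>t. (U t)\<^sup>2) + integral {x..x + d + h} (\<lambda>t. (G t)\<^sup>2)
      + integral {y..y + d + h} (\<lambda>t. (U t)\<^sup>2) + integral {y..y + d + h} (\<lambda>t. (G t)\<^sup>2) \<le> w"
  shows "integral {0..h} (\<lambda>t. D (x + t) (y + t)) \<le> integral {d..d + h} (\<lambda>t. D (x + t) (y + t)) + 2 * h * w"
proof -
  define f where "f t = D (x + t) (y + t)" for t
  have f_int: "f integrable_on {a..b}" for a b
    unfolding f_def by (rule D_integrable)
  define A where "A t = (U t)\<^sup>2" for t
  define B where "B t = (G t)\<^sup>2" for t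
  have A_int: "A integrable_on {a..b}" and B_int: "B integrable_on {a..b}" for a b
    unfolding A_def B_def by (rule U2_int G2_int)+
  have nonneg: "0 \<le> A t" "0 \<le> B t" for t by (simp_all add: A_def B_def)
  define S where "S z t = integral {z + t..z + t + h} B" for z t
  have S: "S z integrable_on {0..d}" "integral {0..d} (S z) \<le> h * integral {z..z + d + h} B" for z
    unfolding S_def by (intro Steklov_average_le B_int nonneg h d)+
  have As: "(A \<circ> (+) z) integrable_on {0..d}" for z
    using A_int[of z "z + d"] unfolding integrable_on_def has_integral_shift_Icc_real by (simp add: add.commute)
  have Ale: "integral {0..d} (A \<circ> (+) z) \<le> integral {z'..z' + d + h} A" if "z' \<le> z" "z \<le> z' + h" for z z'
    unfolding integral_shift_Icc_real using that by (intro integral_subset_le A_int) (auto simp: nonneg)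
  define R where "R t = h * ((A \<circ> (+) x) t + (A \<circ> (+) (x + h)) t + (A \<circ> (+) y) t + (A \<circ> (+) (y + h)) t)
      + 2 * (S x t + S y t)" for t
  have R: "(R has_integral h * (integral {0..d} (A \<circ> (+) x) + integral {0..d} (A \<circ> (+) (x + h))
      + integral {0..d} (A \<circ> (+) y) + integral {0..d} (A \<circ> (+) (y + h)))
      + 2 * (integral {0..d} (S x) + integral {0..d} (S y))) {0..d}"
    unfolding R_def
    by (intro has_integral_add has_integral_mult_right integrable_integral As S)
  \<comment> \<open>The shifts t for which one of the four times x + t, x + t + h, y + t, y + t + h
    falls into N.\<close>
  define N' where "N' = (\<lambda>z. - x + z) ` N \<union> (\<lambda>z. - (x + h) + z) ` N \<union> (\<lambda>z. - y + z) ` N \<union> (\<lambda>z. - (y + h) + z) ` N"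
  have N': "negligible N'"
    unfolding N'_def by (intro negligible_Un negligible_translation negl)
  have good': "x + t \<notin> N" "x + t + h \<notin> N" "y + t \<notin> N" "y + t + h \<notin> N" if "t \<notin> N'" for t
    using that unfolding N'_def by (auto simp: image_iff algebra_simps)
  have fs: "(f \<circ> (+) h) integrable_on {0..d}"
    using f_int[of h "h + d"] unfolding integrable_on_def has_integral_shift_Icc_real by (simp add: add.commute)
  have "integral {0..d} (\<lambda>t. f t - (f \<circ> (+) h) t) \<le> integral {0..d} R"
  proof (rule integral_le_negligible[OF _ _ N'])
    show "(\<lambda>t. f t - (f \<circ> (+) h) t) integrable_on {0..d}" by (intro integrable_diff f_int fs)
    show "R integrable_on {0..d}" using R by blast
    show "f t - (f \<circ> (+) h) t \<le> R t" if t: "t \<in> {0..d} - N'" for t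
      using D_increment[OF h, of "x + t" "y + t"] good'[of t] t x y h d
      unfolding R_def f_def S_def A_def B_def o_def by (simp add: algebra_simps)
  qed
  also have "integral {0..d} R \<le> 2 * h * w"
  proof -
    have "integral {0..d} R \<le> h * (integral {x..x + d + h} A + integral {x..x + d + h} A
        + integral {y..y + d + h} A + integral {y..y + d + h} A)
      + 2 * (h * integral {x..x + d + h} B + h * integral {y..y + d + h} B)"
      unfolding integral_unique[OF R]
      by (intro add_mono mult_left_mono Ale S) (use h in auto)
    also have "\<dots> = 2 * h * (integral {x..x + d + h} A + integral {x..x + d + h} B
        + integral {y..y + d + h} A + integral {y..y + d + h} B)" by (simp add: algebra_simps)
    also have "\<dots> \<le> 2 * h * w" using w h unfolding A_def B_def by (intro mult_left_mono) auto
    finally show ?thesis .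
  qed
  finally have "integral {0..d} f - integral {h..d + h} f \<le> 2 * h * w"
    by (subst (asm) Henstock_Kurzweil_Integration.integral_diff[OF f_int fs]) (simp add: integral_shift_Icc_real add.commute)
  \<comment> \<open>Both sums equal the integral over [0, d + h]. The exchange turns a comparison of
    windows of length d into one of windows of length h, also when h exceeds d.\<close>
  moreover have "integral {0..d} f + integral {d..d + h} f = integral {0..h} f + integral {h..d + h} f"
    using Henstock_Kurzweil_Integration.integral_combine[of 0 d "d + h" f]
      Henstock_Kurzweil_Integration.integral_combine[of 0 h "d + h" f] d h f_int by simp
  ultimately show ?thesis unfolding f_def by linarith
qed

text \<open>Weak lower semicontinuity of \<open>t \<mapsto> D (x + t) (y + t)\<close> at \<open>0\<close>.\<close>

lemma D_initial_window:
  assumes "0 < e"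
  shows "\<exists>h0>0. \<forall>h. 0 < h \<longrightarrow> h \<le> h0 \<longrightarrow> h * (D x y - e) \<le> integral {0..h} (\<lambda>t. D (x + t) (y + t))"
proof -
  \<comment> \<open>With d(t) = u(x + t) - u(y + t) this is the scalar product (d(0), d(t)). It is
    continuous in t, and |d(t)|^2 \<ge> 2 (d(0), d(t)) - |d(0)|^2 by \<open>psd\<close>.\<close>
  define q where "q t = k x (x + t) - k y (x + t) - k x (y + t) + k y (y + t)" for t
  have "continuous_on UNIV q"
    unfolding q_def by (intro continuous_intros continuous_on_compose2[OF cont]) auto
  moreover have "q 0 = D x y" by (simp add: q_def D_def sym[of y x])
  ultimately have "(q \<longlongrightarrow> D x y) (at 0)"
    by (metis continuous_on_eq_continuous_at isCont_def open_UNIV UNIV_I)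
  then have "\<exists>h0>0. \<forall>t. t \<noteq> 0 \<and> norm (t - 0) < h0 \<longrightarrow> norm (q t - D x y) < e / 2"
    using assms unfolding LIM_eq by (meson half_gt_zero)
  then obtain h0 where h0: "h0 > 0" "\<And>t. t \<noteq> 0 \<Longrightarrow> \<bar>t\<bar> < h0 \<Longrightarrow> \<bar>q t - D x y\<bar> < e / 2"
    by auto
  have low: "D x y - e \<le> D (x + t) (y + t)" if "0 \<le> t" "t < h0" for t
  proof -
    have "2 * q t - D x y \<le> D (x + t) (y + t)"
      using psd[where a = x and b = y and c = "x + t" and d = "y + t"] unfolding q_def D_def by argo
    moreover have "\<bar>q t - D x y\<bar> \<le> e / 2"
      using h0(2)[of t] that \<open>q 0 = D x y\<close> assms by (cases "t = 0") auto
    ultimately show ?thesis by argo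
  qed
  have "h * (D x y - e) \<le> integral {0..h} (\<lambda>t. D (x + t) (y + t))" if h: "0 < h" "h \<le> h0 / 2" for h
  proof -
    have "integral {0..h} (\<lambda>t. D x y - e) \<le> integral {0..h} (\<lambda>t. D (x + t) (y + t))"
      using h h0(1) by (intro integral_le D_integrable) (auto intro!: low)
    then show ?thesis using h by simp
  qed
  then show ?thesis using h0(1) by (intro exI[of _ "h0 / 2"]) auto
qed

text \<open>The interval [0, d] is tiled by windows of a small length h. The first has average at
  least D x y - e/d, and no later average falls below the first by more than 2 w; summing over the
  tiles gives the bound with an error e that is arbitrary.\<close>

lemma D_le_average:
  assumes d: "0 < d" and x: "0 \<le> x" "x + 2 * d \<le> T" and y: "0 \<le> y" "y + 2 * d \<le> T"
    and w: "integral {x..x + 2 * d} (\<lambda>t. (U t)\<^sup>2) + integral {x..x + 2 * d} (\<lambda>t. (G t)\<^sup>2)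
      + integral {y..y + 2 * d} (\<lambda>t. (U t)\<^sup>2) + integral {y..y + 2 * d} (\<lambda>t. (G t)\<^sup>2) \<le> w"
  shows "d * (D x y - 2 * w) \<le> integral {0..d} (\<lambda>t. D (x + t) (y + t))"
proof (rule field_le_epsilon)
  fix e :: real assume e: "0 < e"
  define f where "f t = D (x + t) (y + t)" for t
  obtain h0 where h0: "h0 > 0"
    "\<And>h. 0 < h \<Longrightarrow> h \<le> h0 \<Longrightarrow> h * (D x y - e / d) \<le> integral {0..h} f"
    using D_initial_window[of "e / d" x y] e d unfolding f_def by auto
  obtain K :: nat where K: "d / h0 < real K" using reals_Archimedean2 by blast
  with d h0(1) have K0: "0 < real K" by (smt (verit) divide_pos_pos)
  \<comment> \<open>An exact fraction of d, so that the windows tile [0, d] without remainder, with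
    K large enough for h \<le> h0.\<close>
  define h where "h = d / real K"
  have h: "0 < h" "h \<le> h0" "h * real K = d" using K K0 d h0(1) by (auto simp: h_def field_simps)
  have combine: "(\<Sum>j<n. integral {real j * h..real j * h + h} f) = integral {0..real n * h} f" for n
  proof (induction n)
    case (Suc n)
    then show ?case
      using Henstock_Kurzweil_Integration.integral_combine[of 0 "real n * h" "real (Suc n) * h" f] h(1)
        D_integrable[of x y] by (simp add: f_def[abs_def] algebra_simps)
  qed simp
  have "h * (D x y - e / d) - 2 * h * w \<le> integral {real j * h..real j * h + h} f" if "j < K" for j
  proof -
    have jh: "real j * h + h \<le> d"
    proof -
      have "(real j + 1) * h \<le> real K * h" using that h(1) by (intro mult_right_mono) auto
      then show ?thesis using h(3) by (simp add: algebra_simps)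
    qed
    have sub: "integral {z..z + real j * h + h} (\<lambda>t. (V t)\<^sup>2) \<le> integral {z..z + 2 * d} (\<lambda>t. (V t)\<^sup>2)"
      if "\<And>a b. (\<lambda>t. (V t)\<^sup>2) integrable_on {a..b}" for z and V :: "real \<Rightarrow> real"
      by (rule integral_subset_le) (use jh d that in auto)
    have "integral {0..h} f \<le> integral {real j * h..real j * h + h} f + 2 * h * w"
      unfolding f_def
      using sub[OF U2_int, of x] sub[OF U2_int, of y] sub[OF G2_int, of x] sub[OF G2_int, of y] w jh h(1) x y d
      by (intro D_window_increment) auto
    then show ?thesis using h0(2)[OF h(1,2)] by linarith
  qed
  then have "(\<Sum>j<K. h * (D x y - e / d) - 2 * h * w) \<le> (\<Sum>j<K. integral {real j * h..real j * h + h} f)"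
    by (intro sum_mono) auto
  then have "real K * (h * (D x y - e / d) - 2 * h * w) \<le> integral {0..d} f"
    unfolding combine using h(3) by (simp add: mult.commute)
  moreover have "real K * (h * (D x y - e / d) - 2 * h * w) = (h * real K) * (D x y - 2 * w) - (h * real K) * (e / d)"
    by (simp add: algebra_simps)
  ultimately show "d * (D x y - 2 * w) \<le> integral {0..d} (\<lambda>t. D (x + t) (y + t)) + e"
    unfolding h(3) f_def using d by simp
qed

text \<open>Here d(t) is not followed in time: u(y + t) - u(x + t) is tested with its own two terms.
  The smallness comes from the integral of G between x + t and y + t, that is from the closeness of
  x and y.\<close>

lemma average_le:
  assumes d: "0 \<le> d" and x: "0 \<le> x" "x \<le> y" "y + d \<le> T"
    and e: "\<And>t. 0 \<le> t \<Longrightarrow> t \<le> d \<Longrightarrow> \<bar>integral {x + t..y + t} G\<bar> \<le> e"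
  shows "integral {0..d} (\<lambda>t. D (x + t) (y + t)) \<le>
    e * (2 * d + integral {x..x + d} (\<lambda>t. (U t)\<^sup>2) + integral {y..y + d} (\<lambda>t. (U t)\<^sup>2))"
proof -
  define A where "A t = (U t)\<^sup>2" for t
  have As: "(A \<circ> (+) z) integrable_on {0..d}" for z
    using U2_int[of z "z + d"] unfolding integrable_on_def has_integral_shift_Icc_real A_def[symmetric]
    by (simp add: add.commute)
  define N' where "N' = (\<lambda>z. - x + z) ` N \<union> (\<lambda>z. - y + z) ` N"
  have N': "negligible N'" unfolding N'_def by (intro negligible_Un negligible_translation negl)
  have good': "x + t \<notin> N" "y + t \<notin> N" if "t \<notin> N'" for t
    using that unfolding N'_def by (auto simp: image_iff algebra_simps)
  have R: "((\<lambda>t. e * (2 + (A \<circ> (+) x) t + (A \<circ> (+) y) t)) has_integral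
      e * (2 * d + integral {0..d} (A \<circ> (+) x) + integral {0..d} (A \<circ> (+) y))) {0..d}"
    using has_integral_const_real[of "2::real" 0 d] d
    by (intro has_integral_add has_integral_mult_right integrable_integral As) (simp add: mult.commute)
  have "integral {0..d} (\<lambda>t. D (x + t) (y + t)) \<le> integral {0..d} (\<lambda>t. e * (2 + (A \<circ> (+) x) t + (A \<circ> (+) y) t))"
  proof (rule integral_le_negligible[OF D_integrable _ N'])
    show "(\<lambda>t. e * (2 + (A \<circ> (+) x) t + (A \<circ> (+) y) t)) integrable_on {0..d}" using R by blast
    fix t assume t: "t \<in> {0..d} - N'"
    have e0: "\<bar>integral {x + t..y + t} G\<bar> \<le> e" using e t by auto
    have *: "\<bar>k (y + t) s - k (x + t) s\<bar> \<le> e * (1 + A s)" if "s \<in> {0..T} - N" for s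
    proof -
      have "\<bar>k (y + t) s - k (x + t) s\<bar> \<le> U s * integral {x + t..y + t} G"
        using good[OF that, of "x + t" "y + t"] t x by auto
      also have "\<dots> \<le> \<bar>U s\<bar> * \<bar>integral {x + t..y + t} G\<bar>" by (metis abs_ge_self abs_mult)
      also have "\<dots> \<le> (1 + A s) * e"
      proof (intro mult_mono e0)
        \<comment> \<open>Yields |U s| \<le> 1/4 + (U s)^2.\<close>
        have "0 \<le> (\<bar>U s\<bar> - 1 / 2)\<^sup>2" by simp
        then show "\<bar>U s\<bar> \<le> 1 + A s" unfolding A_def power2_diff by (simp add: power2_eq_square)
      qed (auto simp: A_def)
      finally show ?thesis by (simp add: mult.commute)
    qed
    show "D (x + t) (y + t) \<le> e * (2 + (A \<circ> (+) x) t + (A \<circ> (+) y) t)"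
    proof -
      have "x + t \<in> {0..T} - N" "y + t \<in> {0..T} - N" using good'[of t] t x d by auto
      from *[OF this(1)] *[OF this(2)] have
        "k (x + t) (x + t) - k (y + t) (x + t) \<le> e * (1 + A (x + t))"
        "k (y + t) (y + t) - k (x + t) (y + t) \<le> e * (1 + A (y + t))" by linarith+
      then show ?thesis
        unfolding D_def sym[of "y + t" "x + t"] o_def distrib_left by linarith
    qed
  qed
  also have "\<dots> = e * (2 * d + integral {0..d} (A \<circ> (+) x) + integral {0..d} (A \<circ> (+) y))"
    by (rule integral_unique[OF R])
  finally show ?thesis by (simp add: integral_shift_Icc_real A_def[abs_def] add.commute)
qed

text \<open>The order of choices matters: the window length d is fixed by the absolute continuity of
  the integrals of U^2 and G^2, independently of x and y, and only then is y brought close enough to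
  x for the average over [0, d] to be small.\<close>

lemma D_small_forward:
  assumes T: "0 < T" and e: "0 < e"
  shows "\<exists>\<eta>>0. \<forall>x y. 0 \<le> x \<longrightarrow> x \<le> y \<longrightarrow> y \<le> 3 * T / 4 \<longrightarrow> y < x + \<eta> \<longrightarrow> D x y < e"
proof -
  have modulus: "\<exists>\<eta>>0. \<forall>x y. 0 \<le> x \<longrightarrow> x \<le> y \<longrightarrow> y \<le> T \<longrightarrow> y \<le> x + \<eta> \<longrightarrow> \<bar>integral {x..y} g\<bar> \<le> c"
    if g: "\<And>a b. g integrable_on {a..b}" and "0 < c" for g :: "real \<Rightarrow> real" and c :: real
  proof -
    have "uniformly_continuous_on {0..T} (\<lambda>t. integral {0..t} g)"
      by (intro compact_uniformly_continuous indefinite_integral_continuous_1 g) simp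
    then obtain h where h: "h > 0" "\<And>x y. x \<in> {0..T} \<Longrightarrow> y \<in> {0..T} \<Longrightarrow> dist y x < h \<Longrightarrow>
        dist (integral {0..y} g) (integral {0..x} g) < c"
      using \<open>0 < c\<close> unfolding uniformly_continuous_on_def by metis
    have "\<bar>integral {x..y} g\<bar> \<le> c" if "0 \<le> x" "x \<le> y" "y \<le> T" "y \<le> x + h / 2" for x y
      using h(2)[of x y] h(1) that Henstock_Kurzweil_Integration.integral_combine[of 0 x y g] g
      by (auto simp: dist_real_def abs_if split: if_splits)
    then show ?thesis using h(1) by (intro exI[of _ "h / 2"]) auto
  qed
  \<comment> \<open>Four window integrals of at most c each give w = 4 c and the loss 2 w = 8 c; the
    average adds 4 c, and 12 c < e.\<close>
  define c where "c = e / 20"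
  have c: "0 < c" using e by (simp add: c_def)
  obtain h1 where h1: "h1 > 0" "\<And>x y. 0 \<le> x \<Longrightarrow> x \<le> y \<Longrightarrow> y \<le> T \<Longrightarrow> y \<le> x + h1 \<Longrightarrow> \<bar>integral {x..y} (\<lambda>t. (U t)\<^sup>2)\<bar> \<le> c"
    using modulus[OF U2_int c] by blast
  obtain h2 where h2: "h2 > 0" "\<And>x y. 0 \<le> x \<Longrightarrow> x \<le> y \<Longrightarrow> y \<le> T \<Longrightarrow> y \<le> x + h2 \<Longrightarrow> \<bar>integral {x..y} (\<lambda>t. (G t)\<^sup>2)\<bar> \<le> c"
    using modulus[OF G2_int c] by blast
  \<comment> \<open>With \<open>2 * d \<le> T / 4\<close> the forward windows starting at any time
    up to 3 T / 4 stay inside [0, T].\<close>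
  define d where "d = min (T / 8) (min (h1 / 2) (h2 / 2))"
  have d: "0 < d" "2 * d \<le> T / 4" "2 * d \<le> h1" "2 * d \<le> h2" using T h1(1) h2(1) by (auto simp: d_def)
  \<comment> \<open>Solves the bound of \<open>average_le\<close> for the value 4 c of the
    average.\<close>
  define e' where "e' = d * (4 * c) / (2 * d + c + c)"
  have e': "0 < e'" "e' * (2 * d + c + c) = d * (4 * c)" using d c by (simp_all add: e'_def)
  obtain h3 where h3: "h3 > 0" "\<And>x y. 0 \<le> x \<Longrightarrow> x \<le> y \<Longrightarrow> y \<le> T \<Longrightarrow> y \<le> x + h3 \<Longrightarrow> \<bar>integral {x..y} G\<bar> \<le> e'"
    using modulus[OF G_int e'(1)] by blast
  have "D x y < e" if xy: "0 \<le> x" "x \<le> y" "y \<le> 3 * T / 4" "y < x + h3" for x y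
  proof -
    have "d * (D x y - 2 * (4 * c)) \<le> integral {0..d} (\<lambda>t. D (x + t) (y + t))"
      using h1(2)[of x "x + 2 * d"] h1(2)[of y "y + 2 * d"] h2(2)[of x "x + 2 * d"] h2(2)[of y "y + 2 * d"] d xy
      by (intro D_le_average) auto
    also have "\<dots> \<le> e' * (2 * d + integral {x..x + d} (\<lambda>t. (U t)\<^sup>2) + integral {y..y + d} (\<lambda>t. (U t)\<^sup>2))"
      using d xy by (intro average_le h3(2)) auto
    also have "\<dots> \<le> e' * (2 * d + c + c)"
      using h1(2)[of x "x + d"] h1(2)[of y "y + d"] d xy e' by (intro mult_left_mono add_mono) auto
    finally have "D x y - 2 * (4 * c) \<le> 4 * c" unfolding e'(2) using d(1) by simp
    then show ?thesis using c by (simp add: c_def)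
  qed
  then show ?thesis using h3(1) by blast
qed

text \<open>The increment bound is an absolute value over an interval and therefore symmetric under
  reversal. The reversed kernel serves the times in the last quarter of [0, T], where forward
  windows would leave the interval.\<close>

lemma time_reversal:
  "weak_gram_kernel (\<lambda>s t. k (T - s) (T - t)) (\<lambda>t. U (T - t)) (\<lambda>t. G (T - t)) T M ((\<lambda>t. T - t) ` N)"
proof
  have integrable: "(\<lambda>t. g (T - t)) integrable_on {a..b}"
    and integral: "integral {a..b} (\<lambda>t. g (T - t)) = integral {T - b..T - a} g"
    if "\<And>a b. g integrable_on {a..b}" for g :: "real \<Rightarrow> real" and a b
  proof -
    have "((\<lambda>t. g (T - t)) has_integral integral {T - b..T - a} g) {a..b}"
      using has_integral_shift_real_ivl[of "\<lambda>t. g (- t)" _ "- (T - a)" "- (T - b)" "- T"]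
        has_integral_reflect_real[THEN iffD2, OF integrable_integral[OF that, of "T - b" "T - a"]] by simp
    then show "(\<lambda>t. g (T - t)) integrable_on {a..b}"
      "integral {a..b} (\<lambda>t. g (T - t)) = integral {T - b..T - a} g" by auto
  qed
  show "continuous_on UNIV (\<lambda>t. k (T - s) (T - t))" for s
    by (intro continuous_on_compose2[OF cont] continuous_intros) auto
  have "(\<lambda>t. T - t) ` N = (+) T ` ((\<lambda>t. - t) ` N)" by (auto simp: image_iff)
  then show "negligible ((\<lambda>t. T - t) ` N)"
    using negl by (simp add: negligible_translation
      negligible_differentiable_image_negligible differentiable_on_def)
  show "\<bar>k (T - t) (T - s) - k (T - t') (T - s)\<bar> \<le> U (T - s) * integral {t'..t} (\<lambda>t. G (T - t))"
    if "s \<in> {0..T} - (\<lambda>t. T - t) ` N" "0 \<le> t'" "t' \<le> t" "t \<le> T" for s t t'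
  proof -
    have "T - s \<in> {0..T} - N" using that(1) by (auto simp: image_iff)
    from good[OF this, of "T - t" "T - t'"] show ?thesis
      using that by (subst integral[OF G_int]) (simp add: abs_minus_commute)
  qed
  show "(\<lambda>t. G (T - t)) integrable_on {a..b}" for a b by (intro integrable G_int)
  show "(\<lambda>t. (G (T - t))\<^sup>2) integrable_on {a..b}" for a b by (rule integrable[OF G2_int])
  show "(\<lambda>t. (U (T - t))\<^sup>2) integrable_on {a..b}" for a b by (rule integrable[OF U2_int])
  show "2 * (k (T - a) (T - c) - k (T - a) (T - d) - k (T - b) (T - c) + k (T - b) (T - d))
      \<le> (k (T - a) (T - a) - 2 * k (T - a) (T - b) + k (T - b) (T - b))
        + (k (T - c) (T - c) - 2 * k (T - c) (T - d) + k (T - d) (T - d))" for a b c d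
    by (rule psd)
qed (rule sym bound)+

lemma strong_continuity:
  assumes T: "0 < T" and t: "t \<in> {0..T}"
  shows "((\<lambda>s. D s t) \<longlongrightarrow> 0) (at t within {0..T})"
proof (rule tendstoI)
  fix e :: real assume e: "0 < e"
  interpret r: weak_gram_kernel "\<lambda>s t. k (T - s) (T - t)" "\<lambda>t. U (T - t)" "\<lambda>t. G (T - t)" T M "(\<lambda>t. T - t) ` N"
    by (rule time_reversal)
  have r: "r.D x y = D (T - x) (T - y)" for x y by (simp add: r.D_def D_def)
  obtain h1 where h1: "h1 > 0" "\<And>x y. 0 \<le> x \<Longrightarrow> x \<le> y \<Longrightarrow> y \<le> 3 * T / 4 \<Longrightarrow> y < x + h1 \<Longrightarrow> D x y < e"
    using D_small_forward[OF T e] by blast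
  obtain h2 where h2: "h2 > 0" "\<And>x y. 0 \<le> x \<Longrightarrow> x \<le> y \<Longrightarrow> y \<le> 3 * T / 4 \<Longrightarrow> y < x + h2 \<Longrightarrow> D (T - x) (T - y) < e"
    using r.D_small_forward[OF T e] unfolding r by blast
  define h where "h = min (T / 4) (min h1 h2)"
  have h: "0 < h" "h \<le> h1" "h \<le> h2" "h \<le> T / 4" using h1(1) h2(1) T by (auto simp: h_def)
  have *: "D x y < e" if "0 \<le> x" "x \<le> y" "y \<le> T" "y < x + h" for x y
  proof (cases "y \<le> 3 * T / 4")
    case True
    then show ?thesis using that h by (intro h1(2)) auto
  next
    case False
    \<comment> \<open>From y > 3 T / 4 and y < x + h with h \<le> T / 4 follows T - x < T / 2, so
      the reversed times lie in the admissible range.\<close>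
    then have "D (T - (T - y)) (T - (T - x)) < e" using that h by (intro h2(2)) auto
    then show ?thesis by (simp add: D_sym)
  qed
  have "D s t < e" if "s \<in> {0..T}" "dist s t < h" for s
    using *[of s t] *[of t s] that t D_sym[of s t] by (cases "s \<le> t") (auto simp: dist_real_def)
  then show "\<forall>\<^sub>F s in at t within {0..T}. dist (D s t) 0 < e"
    using h(1) D_nonneg by (auto simp: eventually_at dist_real_def intro!: exI[of _ h])
qed

end

section \<open>Measurability and duality in time\<close>

lemma AE_lebesgue_on_negligible:
  assumes "S \<in> sets lebesgue" "AE t in lebesgue_on S. P t"
  obtains N where "negligible N" "\<And>t. t \<in> S - N \<Longrightarrow> P t"
proof -
  have "AE t in lebesgue. t \<in> S \<longrightarrow> P t"
    using assms AE_restrict_space_iff[of S lebesgue P] by simp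
  then obtain N where "\<And>t. t \<in> space lebesgue - N \<Longrightarrow> t \<in> S \<longrightarrow> P t" "N \<in> null_sets lebesgue"
    by (rule AE_E3) blast
  then show ?thesis by (intro that[of N]) (auto simp: negligible_iff_null_sets)
qed

lemma borel_measurable_lebesgue_on_AE_limit:
  fixes h :: "real \<Rightarrow> real"
  assumes S: "S \<in> sets lebesgue" and m: "\<And>n. s n \<in> borel_measurable (lebesgue_on S)"
    and lim: "AE t in lebesgue_on S. (\<lambda>n. s n t) \<longlonglongrightarrow> h t"
  shows "h \<in> borel_measurable (lebesgue_on S)"
proof -
  obtain N where N: "negligible N" "\<And>t. t \<in> S - N \<Longrightarrow> (\<lambda>n. s n t) \<longlonglongrightarrow> h t"
    using AE_lebesgue_on_negligible[OF S lim] by blast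
  have "h measurable_on S"
    by (rule measurable_on_limit[OF _ N]) (simp add: measurable_on_iff_borel_measurable S m)
  then show ?thesis by (rule measurable_on_imp_borel_measurable_lebesgue[OF _ S])
qed

text \<open>The approximating simple functions take values in X, so sequential continuity of L on X
  with respect to N is enough. L need not be linear, which admits the quadratic convection
  term.\<close>

lemma strongly_measurable_continuous_real:
  fixes L :: "'a::minus \<Rightarrow> real"
  assumes u: "strongly_measurable I X N u" "AE t in lebesgue_on I. u t \<in> X" and I: "I \<in> sets lebesgue"
    and L: "\<And>w x. w \<in> X \<Longrightarrow> (\<And>n. x n \<in> X) \<Longrightarrow> (\<lambda>n. N (x n - w)) \<longlonglongrightarrow> 0 \<Longrightarrow> (\<lambda>n. L (x n)) \<longlonglongrightarrow> L w"
  shows "(\<lambda>t. L (u t)) \<in> borel_measurable (lebesgue_on I)"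
proof -
  obtain s where s: "\<And>n. simple_function (lebesgue_on I) (s n)" "\<And>n. s n ` I \<subseteq> X"
    "AE t in lebesgue_on I. (\<lambda>n. N (s n t - u t)) \<longlonglongrightarrow> 0"
    using u(1) unfolding strongly_measurable_def by blast
  show ?thesis
  proof (rule borel_measurable_lebesgue_on_AE_limit[OF I])
    show "(\<lambda>t. L (s n t)) \<in> borel_measurable (lebesgue_on I)" for n
      by (intro borel_measurable_simple_function simple_function_compose1[OF s(1)])
    have "AE t in lebesgue_on I. t \<in> space (lebesgue_on I)" by (rule AE_space)
    with s(3) u(2) show "AE t in lebesgue_on I. (\<lambda>n. L (s n t)) \<longlonglongrightarrow> L (u t)"
    proof eventually_elim
      case (elim t)
      then have "t \<in> I" by (simp add: space_restrict_space)
      then show ?case using s(2) elim by (intro L) auto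
    qed
  qed
qed

text \<open>A null set contains no nonempty open set, so its complement is dense in the
  interval.\<close>

lemma continuous_AE_le_everywhere:
  fixes h :: "real \<Rightarrow> real"
  assumes T: "0 < T" and h: "continuous_on {0..T} h" and le: "AE t in lebesgue_on {0..T}. h t \<le> K"
    and t: "t \<in> {0..T}"
  shows "h t \<le> K"
proof -
  obtain N where N: "negligible N" "\<And>t. t \<in> {0..T} - N \<Longrightarrow> h t \<le> K"
    using AE_lebesgue_on_negligible[OF _ le] by auto
  have dense: "{0..T} \<subseteq> closure ({0<..<T} - N)"
  proof -
    have "{0<..<T} \<subseteq> closure ({0<..<T} - N)"
    proof
      fix x assume x: "x \<in> {0<..<T}"
      show "x \<in> closure ({0<..<T} - N)"
        unfolding closure_iff_nhds_not_empty
      proof (intro allI impI)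
        fix A U assume U: "U \<subseteq> A" "open U" "x \<in> U"
        have "\<not> negligible (U \<inter> {0<..<T})" using U x by (intro open_not_negligible) auto
        then have "\<not> U \<inter> {0<..<T} \<subseteq> N" using N(1) negligible_subset by blast
        then show "({0<..<T} - N) \<inter> A \<noteq> {}" using U(1) by blast
      qed
    qed
    then have "closure {0<..<T} \<subseteq> closure ({0<..<T} - N)" by (simp add: closure_minimal)
    then show ?thesis using T by simp
  qed
  have "closure ({0<..<T} - N) \<subseteq> {0..T}" by (intro closure_minimal) auto
  then have "continuous_on (closure ({0<..<T} - N)) h" using h by (rule continuous_on_subset[rotated])
  then show ?thesis
    by (rule continuous_le_on_closure) (use dense t N(2) in auto)
qed

lemma integrable_lebesgue_on_subset:
  fixes F :: "real \<Rightarrow> real"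
  assumes "integrable (lebesgue_on S) F" "S \<in> sets lebesgue" "S' \<in> sets lebesgue" "S' \<subseteq> S"
  shows "integrable (lebesgue_on S') F"
  using assms set_integrable_subset[of lebesgue S F S']
  by (simp add: integrable_restrict_space set_integrable_def)

text \<open>The kernel locale asks for integrability on every compact interval; extension by zero
  supplies it for functions given on [0, T] only.\<close>

lemma integrable_lebesgue_on_zero_extension:
  fixes F :: "real \<Rightarrow> real"
  assumes "integrable (lebesgue_on S) F" "S \<in> sets lebesgue"
  shows "(\<lambda>t. if t \<in> S then F t else 0) integrable_on {a..b}"
proof -
  have "F absolutely_integrable_on S"
    using assms by (simp add: integrable_restrict_space set_integrable_def)
  then have "(\<lambda>t. if t \<in> S then F t else 0) absolutely_integrable_on UNIV"
    by (simp add: absolutely_integrable_restrict_UNIV)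
  then have "(\<lambda>t. if t \<in> S then F t else 0) absolutely_integrable_on {a..b}"
    by (rule set_integrable_subset) auto
  then show ?thesis by (rule set_lebesgue_integral_eq_integral(1))
qed

lemma integral_zero_extension:
  fixes F :: "real \<Rightarrow> real"
  assumes F: "integrable (lebesgue_on {0<..<T}) F" and st: "0 < s" "t < T"
  shows "(\<integral>x. indicator {s<..<t} x * F x \<partial>lebesgue_on {0<..<T}) = integral {s..t} F"
proof -
  have "{s<..<t} \<subseteq> {0<..<T}" using st by auto
  then have Fi: "F absolutely_integrable_on {s<..<t}"
    using integrable_lebesgue_on_subset[OF F, of "{s<..<t}"]
    by (simp add: integrable_restrict_space set_integrable_def)
  have "(\<integral>x. indicator {s<..<t} x * F x \<partial>lebesgue_on {0<..<T})
      = (\<integral>x. indicator {0<..<T} x *\<^sub>R (indicator {s<..<t} x * F x) \<partial>lebesgue)"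
    by (rule integral_restrict_space) simp
  also have "\<dots> = (LINT x:{s<..<t}|lebesgue. F x)"
    unfolding set_lebesgue_integral_def
    by (intro Bochner_Integration.integral_cong) (use st in \<open>auto simp: indicator_def\<close>)
  also have "\<dots> = integral {s<..<t} F" by (rule set_lebesgue_integral_eq_integral(2)[OF Fi])
  also have "\<dots> = integral {s..t} F" by (rule integral_open_interval_real[symmetric])
  finally show ?thesis .
qed

text \<open>Normalise p. As N is only a seminorm, N p = 0 has to be treated apart, where the bound
  on F forces F p = 0. That bound also makes the \<open>SUP\<close> in \<open>dual_norm\<close> a
  genuine supremum.\<close>

lemma dual_space_bound:
  fixes X :: "('a \<Rightarrow> 'b::real_vector) set"
  assumes F: "F \<in> dual_space X N" and p: "p \<in> X" and N0: "\<And>u. 0 \<le> N u"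
    and sc: "\<And>c u. u \<in> X \<Longrightarrow> (\<lambda>x. c *\<^sub>R u x) \<in> X" "\<And>c u. u \<in> X \<Longrightarrow> N (\<lambda>x. c *\<^sub>R u x) = \<bar>c\<bar> * N u"
  shows "\<bar>F p\<bar> \<le> dual_norm X N F * N p"
proof -
  obtain C where C: "\<forall>u\<in>X. \<bar>F u\<bar> \<le> C * N u" using F by (auto simp: dual_space_def)
  have hom: "F (\<lambda>x. c *\<^sub>R p x) = c * F p" for c using F p by (auto simp: dual_space_def)
  show ?thesis
  proof (cases "N p = 0")
    case True
    then show ?thesis using C p by fastforce
  next
    case False
    then have pos: "0 < N p" using N0[of p] by simp
    let ?w = "\<lambda>x. (1 / N p) *\<^sub>R p x"
    have w: "?w \<in> {u\<in>X. N u \<le> 1}" using pos sc p by simp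
    have "\<bar>F u\<bar> \<le> \<bar>C\<bar>" if "u \<in> {u\<in>X. N u \<le> 1}" for u
    proof -
      have "\<bar>F u\<bar> \<le> C * N u" using C that by simp
      also have "\<dots> \<le> \<bar>C\<bar> * N u" using N0[of u] by (intro mult_right_mono) auto
      also have "\<bar>C\<bar> * N u \<le> \<bar>C\<bar> * 1" using that by (intro mult_left_mono) auto
      finally show ?thesis by simp
    qed
    then have "bdd_above ((\<lambda>u. \<bar>F u\<bar>) ` {u\<in>X. N u \<le> 1})" by (intro bdd_aboveI2)
    from cSUP_upper[OF w this] have "\<bar>F ?w\<bar> \<le> dual_norm X N F" unfolding dual_norm_def .
    then show ?thesis using pos hom[of "1 / N p"] by (simp add: abs_mult field_simps)
  qed
qed

lemma dual_space_diff:
  assumes "F \<in> dual_space X N" "G \<in> dual_space X N"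
  shows "F - G \<in> dual_space X N"
proof -
  obtain C where C: "\<forall>u\<in>X. \<bar>F u\<bar> \<le> C * N u" using assms(1) by (auto simp: dual_space_def)
  obtain D where D: "\<forall>u\<in>X. \<bar>G u\<bar> \<le> D * N u" using assms(2) by (auto simp: dual_space_def)
  have "\<bar>F u - G u\<bar> \<le> (C + D) * N u" if "u \<in> X" for u
    using bspec[OF C that] bspec[OF D that] unfolding distrib_right by linarith
  then show ?thesis using assms by (auto simp: dual_space_def fun_diff_def right_diff_distrib)
qed

section \<open>Weak solutions\<close>

context bounded_open_domain
begin

lemma V_scaleR: "u \<in> V_space \<Omega> \<Longrightarrow> (\<lambda>x. c *\<^sub>R u x) \<in> V_space \<Omega>"
  using V_lincomb[of u u c 0] by simp

lemma V_diff: "u \<in> V_space \<Omega> \<Longrightarrow> v \<in> V_space \<Omega> \<Longrightarrow> u - v \<in> V_space \<Omega>"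
  using V_lincomb[of u v 1 1] by (simp add: fun_diff_def)

lemma V_dual_bound:
  assumes "F \<in> V_dual \<Omega>" "p \<in> V_space \<Omega>"
  shows "\<bar>F p\<bar> \<le> V_dual_norm \<Omega> F * H1_norm \<Omega> p"
  using assms H1_norm_nonneg by (intro dual_space_bound) (auto intro: V_scaleR H1_norm_scaleR V_H1)

text \<open>Weak continuity is formulated with \<open>dual_space\<close>; this turns it into
  continuity in time of scalar products with fixed fields.\<close>

lemma L2_inner_dual:
  assumes p: "p \<in> L2_space \<Omega>"
  shows "(\<lambda>w. L2_inner \<Omega> w p) \<in> dual_space (H_space \<Omega>) (L2_norm \<Omega>)"
  unfolding dual_space_def
proof (intro CollectI conjI ballI allI exI)
  fix u v assume u: "u \<in> H_space \<Omega>"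
  show "L2_inner \<Omega> (\<lambda>x. u x + v x) p = L2_inner \<Omega> u p + L2_inner \<Omega> v p" if "v \<in> H_space \<Omega>"
    by (rule L2_inner_add_left[OF H_L2[OF u] H_L2[OF that] p])
  show "L2_inner \<Omega> (\<lambda>x. c *\<^sub>R u x) p = c * L2_inner \<Omega> u p" for c
    by (rule L2_inner_scaleR_left)
  show "\<bar>L2_inner \<Omega> u p\<bar> \<le> L2_norm \<Omega> p * L2_norm \<Omega> u"
    using L2_Cauchy_Schwarz[OF H_L2[OF u] p] by (simp add: mult.commute)
qed

text \<open>A coarser form of the trilinear estimate with the L2 norm of a absorbed into its H1
  norm. It is meant for continuity of the convection term on V, where the sharp exponents do not
  matter.\<close>

lemma convection_inner_bound:
  assumes "C \<in> L2_space \<Omega>" "a \<in> V_space \<Omega>" "p \<in> V_space \<Omega>"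
  shows "\<bar>L2_inner \<Omega> (\<lambda>x. C x *v a x) p\<bar> \<le> L2_norm \<Omega> C * (7 * H1_norm \<Omega> a) * (7 * H1_norm \<Omega> p)"
proof -
  have "sqrt (L2_norm \<Omega> a * (7 * H1_norm \<Omega> a)) \<le> sqrt ((7 * H1_norm \<Omega> a)\<^sup>2)"
    unfolding power2_eq_square
    using L2_norm_le_H1_norm(1)[of a] H1_norm_nonneg[of a] L2_norm_nonneg[of \<Omega> a]
    by (intro real_sqrt_le_mono mult_right_mono) auto
  also have "sqrt ((7 * H1_norm \<Omega> a)\<^sup>2) = 7 * H1_norm \<Omega> a"
    unfolding real_sqrt_abs using H1_norm_nonneg[of a] by simp
  finally have "L2_norm \<Omega> C * sqrt (L2_norm \<Omega> a * (7 * H1_norm \<Omega> a)) * (7 * H1_norm \<Omega> p)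
      \<le> L2_norm \<Omega> C * (7 * H1_norm \<Omega> a) * (7 * H1_norm \<Omega> p)"
    using H1_norm_nonneg[of p] L2_norm_nonneg[of \<Omega> C] by (intro mult_right_mono mult_left_mono) auto
  with trilinear_estimate(2)[OF assms(1) V_H10[OF assms(2)] V_H10[OF assms(3)]] show ?thesis by (rule order.trans)
qed

text \<open>Bilinear splitting: the gradient of x applied to x - w, plus the difference of the
  gradients applied to w.\<close>

lemma convection_inner_diff:
  assumes x: "x \<in> V_space \<Omega>" and w: "w \<in> V_space \<Omega>" and p: "p \<in> V_space \<Omega>"
  shows "\<bar>L2_inner \<Omega> (convection \<Omega> x) p - L2_inner \<Omega> (convection \<Omega> w) p\<bar>
    \<le> 49 * H1_norm \<Omega> p * (H1_norm \<Omega> x + H1_norm \<Omega> w) * H1_norm \<Omega> (x - w)"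
proof -
  let ?gx = "weak_grad \<Omega> x" and ?gw = "weak_grad \<Omega> w" and ?d = "x - w"
  note g = weak_grad_spec(1)[OF V_H1[OF x]] weak_grad_spec(1)[OF V_H1[OF w]]
  note d = V_diff[OF x w]
  have gd: "?gx - ?gw \<in> L2_space \<Omega>" using g by (intro L2_space_diff)
  have gn: "L2_norm \<Omega> (?gx - ?gw) \<le> H1_norm \<Omega> ?d"
    using L2_norm_cong_AE[OF H1_diff(2)[OF V_H1[OF x] V_H1[OF w]] weak_grad_spec(1)[OF V_H1[OF d]] gd]
      L2_norm_le_H1_norm(2)[of ?d] by simp
  note i = trilinear_estimate(1)[OF _ V_H10 V_H10[OF p]]
  have "L2_inner \<Omega> (convection \<Omega> x) p - L2_inner \<Omega> (convection \<Omega> w) p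
      = (\<integral>y. (?gx y *v x y) \<bullet> p y - (?gw y *v w y) \<bullet> p y \<partial>lebesgue_on \<Omega>)"
    unfolding L2_inner_def convection_def
    by (intro Bochner_Integration.integral_diff[symmetric] i g x w)
  also have "\<dots> = (\<integral>y. (?gx y *v ?d y) \<bullet> p y + ((?gx - ?gw) y *v w y) \<bullet> p y \<partial>lebesgue_on \<Omega>)"
    by (simp add: matrix_vector_mult_diff_distrib matrix_vector_mult_diff_rdistrib inner_diff_left)
  also have "\<dots> = L2_inner \<Omega> (\<lambda>y. ?gx y *v ?d y) p + L2_inner \<Omega> (\<lambda>y. (?gx - ?gw) y *v w y) p"
    unfolding L2_inner_def by (intro Bochner_Integration.integral_add i g gd d w)
  finally have "\<bar>L2_inner \<Omega> (convection \<Omega> x) p - L2_inner \<Omega> (convection \<Omega> w) p\<bar>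
      \<le> \<bar>L2_inner \<Omega> (\<lambda>y. ?gx y *v ?d y) p\<bar> + \<bar>L2_inner \<Omega> (\<lambda>y. (?gx - ?gw) y *v w y) p\<bar>" by simp
  also have "\<dots> \<le> L2_norm \<Omega> ?gx * (7 * H1_norm \<Omega> ?d) * (7 * H1_norm \<Omega> p)
      + L2_norm \<Omega> (?gx - ?gw) * (7 * H1_norm \<Omega> w) * (7 * H1_norm \<Omega> p)"
    by (intro add_mono convection_inner_bound g gd d w p)
  also have "\<dots> \<le> H1_norm \<Omega> x * (7 * H1_norm \<Omega> ?d) * (7 * H1_norm \<Omega> p)
      + H1_norm \<Omega> ?d * (7 * H1_norm \<Omega> w) * (7 * H1_norm \<Omega> p)"
    using H1_norm_nonneg by (intro add_mono mult_right_mono gn L2_norm_le_H1_norm(2)) auto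
  also have "\<dots> = 49 * H1_norm \<Omega> p * (H1_norm \<Omega> x + H1_norm \<Omega> w) * H1_norm \<Omega> ?d"
    by (simp add: algebra_simps)
  finally show ?thesis .
qed

section \<open>Measurability in time of the terms of the equation, and a pointwise norm
  bound\<close>

lemma dual_pairing_measurable:
  assumes f: "f \<in> Bochner_Lp q {0..T} (V_dual \<Omega>) (V_dual_norm \<Omega>)" and p: "p \<in> V_space \<Omega>"
  shows "(\<lambda>t. f t p) \<in> borel_measurable (lebesgue_on {0..T})"
proof -
  have "strongly_measurable {0..T} (V_dual \<Omega>) (V_dual_norm \<Omega>) f" "AE t in lebesgue_on {0..T}. f t \<in> V_dual \<Omega>"
    using f by (auto simp: Bochner_Lp_def)
  then show ?thesis
  proof (rule strongly_measurable_continuous_real[where L = "\<lambda>F. F p"])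
    fix F :: "(real^3 \<Rightarrow> real^3) \<Rightarrow> real" and x
    assume F: "F \<in> V_dual \<Omega>" and x: "\<And>n. x n \<in> V_dual \<Omega>"
      and lim: "(\<lambda>n. V_dual_norm \<Omega> (x n - F)) \<longlonglongrightarrow> 0"
    have "(\<lambda>n. x n p - F p) \<longlonglongrightarrow> 0"
    proof (rule Lim_null_comparison)
      show "\<forall>\<^sub>F n in sequentially. norm (x n p - F p) \<le> V_dual_norm \<Omega> (x n - F) * H1_norm \<Omega> p"
        using V_dual_bound[OF dual_space_diff[OF x F] p] by (intro always_eventually) simp
      show "(\<lambda>n. V_dual_norm \<Omega> (x n - F) * H1_norm \<Omega> p) \<longlonglongrightarrow> 0"
        by (rule tendsto_mult_left_zero[OF lim])
    qed
    then show "(\<lambda>n. x n p) \<longlonglongrightarrow> F p" by (simp add: LIM_zero_iff)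
  qed simp
qed

lemma gradient_inner_measurable:
  assumes u: "u \<in> Bochner_Lp q {0..T} (V_space \<Omega>) (H1_norm \<Omega>)" and p: "p \<in> V_space \<Omega>"
  shows "(\<lambda>t. L2_inner \<Omega> (weak_grad \<Omega> (u t)) (weak_grad \<Omega> p)) \<in> borel_measurable (lebesgue_on {0..T})"
proof -
  have "strongly_measurable {0..T} (V_space \<Omega>) (H1_norm \<Omega>) u" "AE t in lebesgue_on {0..T}. u t \<in> V_space \<Omega>"
    using u by (auto simp: Bochner_Lp_def)
  then show ?thesis
  proof (rule strongly_measurable_continuous_real[where L = "\<lambda>w. L2_inner \<Omega> (weak_grad \<Omega> w) (weak_grad \<Omega> p)"])
    fix w :: "real^3 \<Rightarrow> real^3" and x
    assume w: "w \<in> V_space \<Omega>" and x: "\<And>n. x n \<in> V_space \<Omega>" and lim: "(\<lambda>n. H1_norm \<Omega> (x n - w)) \<longlonglongrightarrow> 0"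
    note g = weak_grad_spec(1)[OF V_H1]
    have "(\<lambda>n. L2_inner \<Omega> (weak_grad \<Omega> (x n)) (weak_grad \<Omega> p) - L2_inner \<Omega> (weak_grad \<Omega> w) (weak_grad \<Omega> p)) \<longlonglongrightarrow> 0"
    proof (rule Lim_null_comparison)
      have "\<bar>L2_inner \<Omega> (weak_grad \<Omega> (x n)) (weak_grad \<Omega> p) - L2_inner \<Omega> (weak_grad \<Omega> w) (weak_grad \<Omega> p)\<bar>
          \<le> H1_norm \<Omega> (x n - w) * L2_norm \<Omega> (weak_grad \<Omega> p)" for n
      proof -
        have "L2_inner \<Omega> (weak_grad \<Omega> (x n)) (weak_grad \<Omega> p) - L2_inner \<Omega> (weak_grad \<Omega> w) (weak_grad \<Omega> p)
            = L2_inner \<Omega> (weak_grad \<Omega> (x n) - weak_grad \<Omega> w) (weak_grad \<Omega> p)"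
          by (intro L2_inner_diff_left[symmetric] g x w p)
        also have "\<dots> = L2_inner \<Omega> (weak_grad \<Omega> (x n - w)) (weak_grad \<Omega> p)"
          by (rule L2_inner_cong_AE[symmetric, OF H1_diff(2)[OF V_H1[OF x] V_H1[OF w]] AE_I2[OF refl]
                g[OF V_diff[OF x w]] L2_space_diff[OF g[OF x] g[OF w]] g[OF p] g[OF p]])
        also have "\<bar>\<dots>\<bar> \<le> L2_norm \<Omega> (weak_grad \<Omega> (x n - w)) * L2_norm \<Omega> (weak_grad \<Omega> p)"
          by (intro L2_Cauchy_Schwarz g V_diff x w p)
        also have "\<dots> \<le> H1_norm \<Omega> (x n - w) * L2_norm \<Omega> (weak_grad \<Omega> p)"
          by (intro mult_right_mono L2_norm_le_H1_norm(2) L2_norm_nonneg)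
        finally show ?thesis .
      qed
      then show "\<forall>\<^sub>F n in sequentially. norm (L2_inner \<Omega> (weak_grad \<Omega> (x n)) (weak_grad \<Omega> p)
          - L2_inner \<Omega> (weak_grad \<Omega> w) (weak_grad \<Omega> p)) \<le> H1_norm \<Omega> (x n - w) * L2_norm \<Omega> (weak_grad \<Omega> p)"
        by (intro always_eventually) simp
      show "(\<lambda>n. H1_norm \<Omega> (x n - w) * L2_norm \<Omega> (weak_grad \<Omega> p)) \<longlonglongrightarrow> 0"
        by (rule tendsto_mult_left_zero[OF lim])
    qed
    then show "(\<lambda>n. L2_inner \<Omega> (weak_grad \<Omega> (x n)) (weak_grad \<Omega> p)) \<longlonglongrightarrow> L2_inner \<Omega> (weak_grad \<Omega> w) (weak_grad \<Omega> p)"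
      by (simp add: LIM_zero_iff)
  qed simp
qed

lemma convection_inner_measurable:
  assumes u: "u \<in> Bochner_Lp q {0..T} (V_space \<Omega>) (H1_norm \<Omega>)" and p: "p \<in> V_space \<Omega>"
  shows "(\<lambda>t. L2_inner \<Omega> (convection \<Omega> (u t)) p) \<in> borel_measurable (lebesgue_on {0..T})"
proof -
  have "strongly_measurable {0..T} (V_space \<Omega>) (H1_norm \<Omega>) u" "AE t in lebesgue_on {0..T}. u t \<in> V_space \<Omega>"
    using u by (auto simp: Bochner_Lp_def)
  then show ?thesis
  proof (rule strongly_measurable_continuous_real[where L = "\<lambda>w. L2_inner \<Omega> (convection \<Omega> w) p"])
    fix w :: "real^3 \<Rightarrow> real^3" and x
    assume w: "w \<in> V_space \<Omega>" and x: "\<And>n. x n \<in> V_space \<Omega>" and lim: "(\<lambda>n. H1_norm \<Omega> (x n - w)) \<longlonglongrightarrow> 0"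
    \<comment> \<open>The norm of \<open>x n\<close> is replaced by that of \<open>x n - w\<close>
      plus that of w, so that the bound depends on n only through a quantity tending to 0.\<close>
    let ?B = "\<lambda>n. 49 * H1_norm \<Omega> p * ((H1_norm \<Omega> (x n - w) + H1_norm \<Omega> w) + H1_norm \<Omega> w) * H1_norm \<Omega> (x n - w)"
    have "(\<lambda>n. L2_inner \<Omega> (convection \<Omega> (x n)) p - L2_inner \<Omega> (convection \<Omega> w) p) \<longlonglongrightarrow> 0"
    proof (rule Lim_null_comparison)
      have "\<bar>L2_inner \<Omega> (convection \<Omega> (x n)) p - L2_inner \<Omega> (convection \<Omega> w) p\<bar> \<le> ?B n" for n
      proof -
        have "H1_norm \<Omega> (x n) \<le> H1_norm \<Omega> (x n - w) + H1_norm \<Omega> w"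
        proof -
          have z: "(\<lambda>y. (-1) *\<^sub>R w y) \<in> H1_space \<Omega>" by (rule H1_scaleR(1)[OF V_H1[OF w]])
          have "(x n - w) - (\<lambda>y. (-1) *\<^sub>R w y) = x n" by (simp add: fun_eq_iff)
          then show ?thesis
            using H1_norm_diff_le[OF V_H1[OF V_diff[OF x[of n] w]] z] H1_norm_scaleR[OF V_H1[OF w], of "-1"] by simp
        qed
        then have "49 * H1_norm \<Omega> p * (H1_norm \<Omega> (x n) + H1_norm \<Omega> w) * H1_norm \<Omega> (x n - w) \<le> ?B n"
          using H1_norm_nonneg by (intro mult_right_mono mult_left_mono add_right_mono) auto
        with convection_inner_diff[OF x w p, of n] show ?thesis by simp
      qed
      then show "\<forall>\<^sub>F n in sequentially. norm (L2_inner \<Omega> (convection \<Omega> (x n)) p - L2_inner \<Omega> (convection \<Omega> w) p) \<le> ?B n"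
        by (intro always_eventually) simp
      have "?B \<longlonglongrightarrow> 49 * H1_norm \<Omega> p * ((0 + H1_norm \<Omega> w) + H1_norm \<Omega> w) * 0"
        by (intro tendsto_intros lim)
      then show "?B \<longlonglongrightarrow> 0" by simp
    qed
    then show "(\<lambda>n. L2_inner \<Omega> (convection \<Omega> (x n)) p) \<longlonglongrightarrow> L2_inner \<Omega> (convection \<Omega> w) p"
      by (simp add: LIM_zero_iff)
  qed simp
qed

lemma weakly_continuous_inner:
  assumes "weakly_continuous_into {0..T} (H_space \<Omega>) (L2_norm \<Omega>) u" "p \<in> L2_space \<Omega>"
  shows "continuous_on {0..T} (\<lambda>t. L2_inner \<Omega> (u t) p)"
  using assms(1) L2_inner_dual[OF assms(2)] by (auto simp: weakly_continuous_into_def)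

text \<open>For fixed t the bound (u(s), u(t)) \<le> M |u(t)| holds for almost every s. The left
  side is continuous in s, so s = t is allowed, and one factor |u(t)| is cancelled.\<close>

lemma weakly_continuous_norm_bound:
  assumes T: "0 < T" and wc: "weakly_continuous_into {0..T} (H_space \<Omega>) (L2_norm \<Omega>) u"
    and M: "AE t in lebesgue_on {0..T}. L2_norm \<Omega> (u t) \<le> M" and t: "t \<in> {0..T}"
  shows "L2_norm \<Omega> (u t) \<le> M"
proof -
  have L2: "u s \<in> L2_space \<Omega>" if "s \<in> {0..T}" for s
    using wc that by (auto simp: weakly_continuous_into_def H_L2)
  have "AE s in lebesgue_on {0..T}. s \<in> space (lebesgue_on {0..T})" by (rule AE_space)
  with M have "AE s in lebesgue_on {0..T}. L2_inner \<Omega> (u s) (u t) \<le> M * L2_norm \<Omega> (u t)"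
  proof eventually_elim
    case (elim s)
    then have "s \<in> {0..T}" by (simp add: space_restrict_space)
    then have "L2_inner \<Omega> (u s) (u t) \<le> L2_norm \<Omega> (u s) * L2_norm \<Omega> (u t)"
      using L2_Cauchy_Schwarz[OF L2 L2[OF t]] by fastforce
    also have "\<dots> \<le> M * L2_norm \<Omega> (u t)" using elim(1) by (intro mult_right_mono L2_norm_nonneg)
    finally show ?case .
  qed
  from continuous_AE_le_everywhere[OF T weakly_continuous_inner[OF wc L2[OF t]] this t]
  have "L2_norm \<Omega> (u t) * L2_norm \<Omega> (u t) \<le> M * L2_norm \<Omega> (u t)"
    using L2_norm_power2[of \<Omega> "u t"] by (simp add: power2_eq_square)
  \<comment> \<open>Needed where u(t) has norm 0 and cancellation is impossible; it follows because
    the almost everywhere bound holds at some time.\<close>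
  moreover have "0 \<le> M"
  proof -
    obtain N where N: "negligible N" "\<And>s. s \<in> {0..T} - N \<Longrightarrow> L2_norm \<Omega> (u s) \<le> M"
      using AE_lebesgue_on_negligible[OF _ M] by auto
    have "\<not> negligible {0<..<T}" using T by (intro open_not_negligible) auto
    then have "\<not> {0<..<T} \<subseteq> N" using N(1) negligible_subset by blast
    then obtain s where "s \<in> {0..T} - N" by force
    then show ?thesis using N(2) L2_norm_nonneg order.trans by blast
  qed
  ultimately show ?thesis
    using L2_norm_nonneg[of \<Omega> "u t"] by (cases "L2_norm \<Omega> (u t) = 0") (auto simp: mult_le_cancel_right)
qed

end

section \<open>Increment estimate and strong continuity of a weak solution\<close>

context bounded_open_domain
begin

text \<open>Expansion of the nonnegative squared norm of (a - b) - (c - d); this is the assumption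
  \<open>psd\<close> of the kernel locale.\<close>

lemma L2_inner_psd:
  assumes "a \<in> L2_space \<Omega>" "b \<in> L2_space \<Omega>" "c \<in> L2_space \<Omega>" "d \<in> L2_space \<Omega>"
  shows "2 * (L2_inner \<Omega> a c - L2_inner \<Omega> a d - L2_inner \<Omega> b c + L2_inner \<Omega> b d)
    \<le> (L2_inner \<Omega> a a - 2 * L2_inner \<Omega> a b + L2_inner \<Omega> b b) + (L2_inner \<Omega> c c - 2 * L2_inner \<Omega> c d + L2_inner \<Omega> d d)"
proof -
  note ab = L2_space_diff[OF assms(1,2)] and cd = L2_space_diff[OF assms(3,4)]
  have "0 \<le> (L2_norm \<Omega> ((a - b) - (c - d)))\<^sup>2" by simp
  also have "\<dots> = (L2_norm \<Omega> (a - b))\<^sup>2 - 2 * L2_inner \<Omega> (a - b) (c - d) + (L2_norm \<Omega> (c - d))\<^sup>2"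
    by (simp only: L2_norm_diff_power2[OF ab cd]) (simp only: L2_norm_power2)
  also have "L2_inner \<Omega> (a - b) (c - d) = L2_inner \<Omega> a c - L2_inner \<Omega> a d - L2_inner \<Omega> b c + L2_inner \<Omega> b d"
    using assms by (simp add: L2_inner_diff_left[OF _ _ cd] L2_inner_diff_right)
  finally show ?thesis
    unfolding L2_norm_diff_power2[OF assms(1,2)] L2_norm_diff_power2[OF assms(3,4)] by simp
qed

text \<open>The hypothesis \<open>u \<in> L\<^sup>3(V)\<close> enters here: it makes the bound \<open>B\<close> of the convection term in \<open>V'\<close>
  square integrable in time.\<close>

lemma weak_solution_increment:
  assumes T: "0 < T" and f: "f \<in> Bochner_Lp 2 {0..T} (V_dual \<Omega>) (V_dual_norm \<Omega>)"
    and sol: "NS_weak_solution \<Omega> T \<nu> f u0 u"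
    and u3: "u \<in> Bochner_Lp 3 {0..T} (V_space \<Omega>) (H1_norm \<Omega>)"
  obtains G M where "integrable (lebesgue_on {0..T}) G" "integrable (lebesgue_on {0..T}) (\<lambda>t. (G t)\<^sup>2)"
    "\<And>t. t \<in> {0..T} \<Longrightarrow> L2_norm \<Omega> (u t) \<le> M"
    "\<And>p s t. p \<in> V_space \<Omega> \<Longrightarrow> 0 \<le> s \<Longrightarrow> s \<le> t \<Longrightarrow> t \<le> T \<Longrightarrow>
      \<bar>L2_inner \<Omega> (u t) p - L2_inner \<Omega> (u s) p\<bar> \<le> H1_norm \<Omega> p * integral {s..t} G"
proof -
  let ?M = "lebesgue_on {0..T}" and ?I = "lebesgue_on {0<..<T}"
  have sub: "{0<..<T} \<subseteq> {0..T}" by auto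
  have fin: "finite_measure ?M" by (intro finite_measure_lebesgue_on) simp
  have u2: "u \<in> Bochner_Lp 2 {0..T} (V_space \<Omega>) (H1_norm \<Omega>)"
    and uinf: "u \<in> Bochner_Linf {0..T} (H_space \<Omega>) (L2_norm \<Omega>)"
    and wc: "weakly_continuous_into {0..T} (H_space \<Omega>) (L2_norm \<Omega>) u"
    and eqn: "\<And>p \<psi>. p \<in> V_space \<Omega> \<Longrightarrow> \<psi> \<in> test_functions {0<..<T} \<Longrightarrow>
        distr_deriv (regular_distr T (\<lambda>t. L2_inner \<Omega> (u t) p)) \<psi>
        + \<nu> * regular_distr T (\<lambda>t. L2_inner \<Omega> (weak_grad \<Omega> (u t)) (weak_grad \<Omega> p)) \<psi>
        + regular_distr T (\<lambda>t. L2_inner \<Omega> (convection \<Omega> (u t)) p) \<psi>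
        = regular_distr T (\<lambda>t. f t p) \<psi>"
    using sol unfolding NS_weak_solution_def by blast+
  obtain M where M: "\<And>t. t \<in> {0..T} \<Longrightarrow> L2_norm \<Omega> (u t) \<le> M"
    using uinf weakly_continuous_norm_bound[OF T wc] unfolding Bochner_Linf_def by blast
  have M0: "0 \<le> M" using M[of 0] T L2_norm_nonneg[of \<Omega> "u 0"] by auto
  define U where "U t = H1_norm \<Omega> (u t)" for t
  have U0: "0 \<le> U t" for t by (simp add: U_def H1_norm_nonneg)
  have U2: "integrable ?M (\<lambda>t. (U t)\<^sup>2)" and U3: "integrable ?M (\<lambda>t. (U t) ^ 3)"
    using u2 u3 by (auto simp: Bochner_Lp_def U_def)
  have F2: "integrable ?M (\<lambda>t. (V_dual_norm \<Omega> (f t))\<^sup>2)" using f by (auto simp: Bochner_Lp_def)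
  have Um: "U \<in> borel_measurable ?M"
  proof -
    have "(\<lambda>t. sqrt ((U t)\<^sup>2)) \<in> borel_measurable ?M"
      by (rule measurable_compose[OF borel_measurable_integrable[OF U2] borel_measurable_sqrt])
    then show ?thesis using U0 by simp
  qed
  have Fm: "(\<lambda>t. \<bar>V_dual_norm \<Omega> (f t)\<bar>) \<in> borel_measurable ?M"
    using measurable_compose[OF borel_measurable_integrable[OF F2] borel_measurable_sqrt] by simp
  \<comment> \<open>The trilinear bound for the convection term, with the gradient norm bounded by
    U, the L2 norm by M, and the factor 7 of the test field pulled out. Its square is 49 * 7 * M *
    U^3.\<close>
  define B where "B t = 7 * (U t * sqrt (M * (7 * U t)))" for t
  \<comment> \<open>A majorant of the V' norm of the time derivative: force, viscous term and
    convection. Only the square of the norm of f is known to be measurable, and its root is the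
    absolute value; this also keeps G nonnegative at times where f t is not in V'.\<close>
  define G where "G t = \<bar>V_dual_norm \<Omega> (f t)\<bar> + \<bar>\<nu>\<bar> * U t + B t" for t
  have Bm: "B \<in> borel_measurable ?M"
    unfolding B_def
    by (intro borel_measurable_times borel_measurable_const measurable_compose[OF _ borel_measurable_sqrt] Um)
  have Gm: "G \<in> borel_measurable ?M"
    unfolding G_def by (intro borel_measurable_add borel_measurable_times borel_measurable_const Fm Um Bm)
  have B2: "(B t)\<^sup>2 = 343 * M * U t ^ 3" for t
  proof -
    have "(B t)\<^sup>2 = 49 * (U t)\<^sup>2 * (sqrt (M * (7 * U t)))\<^sup>2"
      unfolding B_def by (simp add: power_mult_distrib)
    also have "(sqrt (M * (7 * U t)))\<^sup>2 = M * (7 * U t)" using M0 U0[of t] by simp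
    finally show ?thesis by (simp add: power2_eq_square power3_eq_cube)
  qed
  have G2: "integrable ?M (\<lambda>t. (G t)\<^sup>2)"
  proof (rule Bochner_Integration.integrable_bound)
    show "integrable ?M (\<lambda>t. 3 * ((V_dual_norm \<Omega> (f t))\<^sup>2 + \<nu>\<^sup>2 * (U t)\<^sup>2 + 343 * M * U t ^ 3))"
      using F2 U2 U3 by (intro integrable_mult_right Bochner_Integration.integrable_add)
    show "(\<lambda>t. (G t)\<^sup>2) \<in> borel_measurable ?M" by (intro borel_measurable_power Gm)
    have "(x + y + z)\<^sup>2 \<le> 3 * (x\<^sup>2 + y\<^sup>2 + z\<^sup>2)" for x y z :: real
      using zero_le_power2[of "x - y"] zero_le_power2[of "y - z"] zero_le_power2[of "x - z"]
      by (simp add: power2_eq_square algebra_simps)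
    then have "(G t)\<^sup>2 \<le> 3 * (\<bar>V_dual_norm \<Omega> (f t)\<bar>\<^sup>2 + (\<bar>\<nu>\<bar> * U t)\<^sup>2 + (B t)\<^sup>2)" for t
      unfolding G_def .
    then have "(G t)\<^sup>2 \<le> 3 * ((V_dual_norm \<Omega> (f t))\<^sup>2 + \<nu>\<^sup>2 * (U t)\<^sup>2 + 343 * M * U t ^ 3)" for t
      by (simp add: B2 power_mult_distrib)
    then show "AE t in ?M. norm ((G t)\<^sup>2) \<le> norm (3 * ((V_dual_norm \<Omega> (f t))\<^sup>2 + \<nu>\<^sup>2 * (U t)\<^sup>2 + 343 * M * U t ^ 3))"
      by (intro AE_I2) (simp add: order.trans[OF _ abs_ge_self])
  qed
  have G1: "integrable ?M G"
    by (rule finite_measure.square_integrable_imp_integrable[OF fin Gm G2])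
  have incr: "\<bar>L2_inner \<Omega> (u t) p - L2_inner \<Omega> (u s) p\<bar> \<le> H1_norm \<Omega> p * integral {s..t} G"
    if p: "p \<in> V_space \<Omega>" and st: "0 \<le> s" "s \<le> t" "t \<le> T" for p s t
  proof -
    define c where "c t = L2_inner \<Omega> (u t) p" for t
    define a where "a t = L2_inner \<Omega> (weak_grad \<Omega> (u t)) (weak_grad \<Omega> p)" for t
    define b where "b t = L2_inner \<Omega> (convection \<Omega> (u t)) p" for t
    define P where "P = H1_norm \<Omega> p"
    have P0: "0 \<le> P" by (simp add: P_def H1_norm_nonneg)
    have c: "continuous_on {0..T} c"
      unfolding c_def by (rule weakly_continuous_inner[OF wc H1_L2[OF V_H1[OF p]]])
    have am: "a \<in> borel_measurable ?M" unfolding a_def by (rule gradient_inner_measurable[OF u2 p])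
    have bm: "b \<in> borel_measurable ?M" unfolding b_def by (rule convection_inner_measurable[OF u2 p])
    have fm: "(\<lambda>t. f t p) \<in> borel_measurable ?M" by (rule dual_pairing_measurable[OF f p])
    have uV: "AE t in ?M. u t \<in> V_space \<Omega>" and fV: "AE t in ?M. f t \<in> V_dual \<Omega>"
      using u2 f by (auto simp: Bochner_Lp_def)
    have sp: "AE t in ?M. t \<in> {0..T}" using AE_space[of ?M] by (simp add: space_restrict_space)
    have bounds: "AE t in ?M. \<bar>f t p\<bar> \<le> P * \<bar>V_dual_norm \<Omega> (f t)\<bar> \<and> \<bar>a t\<bar> \<le> P * U t \<and> \<bar>b t\<bar> \<le> P * B t"
      using uV fV sp
    proof eventually_elim
      case (elim t)
      note g = weak_grad_spec(1)[OF V_H1]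
      have "\<bar>f t p\<bar> \<le> V_dual_norm \<Omega> (f t) * P" unfolding P_def by (rule V_dual_bound[OF elim(2) p])
      also have "\<dots> \<le> \<bar>V_dual_norm \<Omega> (f t)\<bar> * P" using P0 by (intro mult_right_mono) auto
      finally have 1: "\<bar>f t p\<bar> \<le> P * \<bar>V_dual_norm \<Omega> (f t)\<bar>" by (simp add: mult.commute)
      have "\<bar>a t\<bar> \<le> L2_norm \<Omega> (weak_grad \<Omega> (u t)) * L2_norm \<Omega> (weak_grad \<Omega> p)"
        unfolding a_def by (intro L2_Cauchy_Schwarz g elim p)
      also have "\<dots> \<le> U t * P"
        unfolding U_def P_def by (intro mult_mono L2_norm_le_H1_norm(2) L2_norm_nonneg H1_norm_nonneg)
      finally have 2: "\<bar>a t\<bar> \<le> P * U t" by (simp add: mult.commute)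
      have "\<bar>b t\<bar> \<le> L2_norm \<Omega> (weak_grad \<Omega> (u t)) * sqrt (L2_norm \<Omega> (u t) * (7 * U t)) * (7 * P)"
        unfolding b_def convection_def U_def P_def
        by (rule trilinear_estimate(2)[OF g[OF elim(1)] V_H10[OF elim(1)] V_H10[OF p]])
      also have "\<dots> \<le> U t * sqrt (M * (7 * U t)) * (7 * P)"
        using P0 U0[of t] M[OF elim(3)] M0 L2_norm_le_H1_norm(2)[of "u t"] L2_norm_nonneg
        by (intro mult_right_mono mult_mono real_sqrt_le_mono) (auto simp: U_def intro!: mult_nonneg_nonneg)
      finally have 3: "\<bar>b t\<bar> \<le> P * B t" by (simp add: B_def mult_ac)
      show ?case using 1 2 3 by blast
    qed
    have PG: "integrable ?M (\<lambda>t. P * G t)" using G1 by (rule integrable_mult_right)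
    have G_ge: "\<bar>V_dual_norm \<Omega> (f t)\<bar> \<le> G t" "B t \<le> G t" "0 \<le> G t" for t
      using U0[of t] M0 by (auto simp: G_def B_def)
    have fi: "integrable ?M (\<lambda>t. f t p)"
      using bounds
      by (intro Bochner_Integration.integrable_bound[OF PG fm]) (elim eventually_mono, use P0 G_ge mult_left_mono[OF G_ge(1) P0] in \<open>fastforce simp: abs_mult intro: order.trans\<close>)
    have bi: "integrable ?M b"
      using bounds
      by (intro Bochner_Integration.integrable_bound[OF PG bm]) (elim eventually_mono, use P0 G_ge mult_left_mono[OF G_ge(2) P0] in \<open>fastforce simp: abs_mult intro: order.trans\<close>)
    have PU: "integrable ?M (\<lambda>t. P * U t)"
      by (intro integrable_mult_right finite_measure.square_integrable_imp_integrable[OF fin Um U2])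
    have ai: "integrable ?M a"
      using bounds
      by (intro Bochner_Integration.integrable_bound[OF PU am]) (elim eventually_mono, use P0 U0 in \<open>auto simp: abs_mult\<close>)
    \<comment> \<open>The weak time derivative of c, read off from the equation tested with
      p.\<close>
    define g where "g t = f t p - \<nu> * a t - b t" for t
    note restr = integrable_lebesgue_on_subset[OF _ _ _ sub, simplified]
    have gi: "integrable ?I g"
      unfolding g_def by (intro Bochner_Integration.integrable_diff integrable_mult_right restr fi ai bi)
    \<comment> \<open>A nonintegrable function has integral 0 by convention, so the integral of g
      \<psi> may be split into the terms of the equation only after each is known to be
      integrable.\<close>
    have tested: "integrable ?I (\<lambda>t. h t * \<psi> t)"
      if h: "integrable ?I h" and psi: "\<psi> \<in> test_functions {0<..<T}" for h \<psi> :: "real \<Rightarrow> real"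
    proof -
      obtain K where K: "\<And>x. norm (\<psi> x) \<le> K" using test_function_bounds(1)[OF psi] by blast
      have "\<psi> \<in> borel_measurable ?I"
        using test_functionD(1)[OF psi]
        by (intro measurable_restrict_space1 measurable_completion) (simp add: borel_measurable_continuous_onI)
      moreover have "norm (h t * \<psi> t) \<le> norm (K * h t)" for t
        using mult_left_mono[OF order.trans[OF K abs_ge_self], of "\<bar>h t\<bar>" t] by (simp add: abs_mult mult.commute)
      ultimately show ?thesis
        using h by (intro Bochner_Integration.integrable_bound[OF integrable_mult_right[OF h, of K]] AE_I2) auto
    qed
    have weak: "(\<integral>t. c t * deriv \<psi> t \<partial>?I) = - (\<integral>t. g t * \<psi> t \<partial>?I)" if psi: "\<psi> \<in> test_functions {0<..<T}" for \<psi>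
    proof -
      note t = tested[OF restr[OF fi] psi] tested[OF restr[OF ai] psi] tested[OF restr[OF bi] psi]
      have "(\<integral>t. g t * \<psi> t \<partial>?I) = (\<integral>t. f t p * \<psi> t - \<nu> * (a t * \<psi> t) - b t * \<psi> t \<partial>?I)"
        by (simp add: g_def algebra_simps)
      also have "\<dots> = (\<integral>t. f t p * \<psi> t \<partial>?I) - \<nu> * (\<integral>t. a t * \<psi> t \<partial>?I) - (\<integral>t. b t * \<psi> t \<partial>?I)"
        using t by (simp add: Bochner_Integration.integral_diff Bochner_Integration.integrable_diff)
      finally show ?thesis
        using eqn[OF p psi] unfolding distr_deriv_def regular_distr_def a_def b_def c_def by simp
    qed
    define Q where "Q t = integral {0..t} G" for t
    have G_hk: "G integrable_on {x..y}" if "{x..y} \<subseteq> {0..T}" for x y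
    proof -
      have "(\<lambda>t. if t \<in> {0..T} then G t else 0) integrable_on {x..y}"
        by (rule integrable_lebesgue_on_zero_extension[OF G1]) simp
      then show ?thesis by (rule integrable_eq) (use that in auto)
    qed
    have Q_diff: "integral {x..y} G = Q y - Q x" if "0 \<le> x" "x \<le> y" "y \<le> T" for x y
      using Henstock_Kurzweil_Integration.integral_combine[of 0 x y G] that G_hk[of 0 y] by (simp add: Q_def)
    have Q: "continuous_on {0..T} Q"
      unfolding Q_def by (rule indefinite_integral_continuous_1[OF G_hk]) simp
    have inner: "\<bar>c y - c x\<bar> - P * (Q y - Q x) \<le> 0" if xy: "0 < x" "x < y" "y < T" for x y
    proof -
      have "AE t in ?I. \<bar>g t\<bar> \<le> P * G t"
      proof -
        have "AE t in ?M. \<bar>g t\<bar> \<le> P * G t"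
          using bounds
        proof eventually_elim
          case (elim t)
          have "\<bar>g t\<bar> \<le> \<bar>f t p\<bar> + \<bar>\<nu>\<bar> * \<bar>a t\<bar> + \<bar>b t\<bar>"
            unfolding g_def abs_mult[symmetric] by linarith
          also have "\<dots> \<le> P * \<bar>V_dual_norm \<Omega> (f t)\<bar> + \<bar>\<nu>\<bar> * (P * U t) + P * B t"
            using elim by (intro add_mono mult_left_mono) auto
          also have "\<dots> = P * G t" by (simp add: G_def algebra_simps)
          finally show ?case .
        qed
        then show ?thesis using sub by (auto simp: AE_restrict_space_iff elim!: eventually_mono)
      qed
      then have le: "AE t in ?I. norm (indicator {x<..<y} t * g t) \<le> indicator {x<..<y} t * (P * G t)"
        by eventually_elim (auto simp: indicator_def)
      have ind: "integrable ?I (\<lambda>t. indicator {x<..<y} t * (P * G t))"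
        using integrable_mult_indicator[OF _ integrable_mult_right[OF restr[OF G1], of P], of "{x<..<y}"] xy
        by (simp add: sets_restrict_space_iff greaterThanLessThan_subseteq_greaterThanLessThan)
      have "\<bar>c y - c x\<bar> = norm (\<integral>t. indicator {x<..<y} t * g t \<partial>?I)"
        using weak_derivative_increment[OF c gi weak xy] by simp
      also have "\<dots> \<le> (\<integral>t. indicator {x<..<y} t * (P * G t) \<partial>?I)"
        by (rule order.trans[OF integral_norm_bound integral_mono_AE'[OF ind le]])
           (use P0 G_ge(3) in simp)
      also have "\<dots> = integral {x..y} (\<lambda>t. P * G t)"
        by (rule integral_zero_extension) (use xy restr[OF PG] in auto)
      also have "\<dots> = P * (Q y - Q x)" using Q_diff[of x y] xy by simp
      finally show ?thesis by simp
    qed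
    \<comment> \<open>The distributional equation speaks about the open interval only. The endpoints
      are reached by continuity, first the left one at 0 and afterwards the right one at T.\<close>
    have step1: "\<bar>c y - c x\<bar> - P * (Q y - Q x) \<le> 0" if xy: "0 \<le> x" "x \<le> y" "0 < y" "y < T" for x y
    proof (rule continuous_le_on_closure[of "{0<..<y}" "\<lambda>x. \<bar>c y - c x\<bar> - P * (Q y - Q x)" x])
      show "continuous_on (closure {0<..<y}) (\<lambda>x. \<bar>c y - c x\<bar> - P * (Q y - Q x))"
        using xy by (intro continuous_intros continuous_on_subset[OF c] continuous_on_subset[OF Q]) auto
    qed (use xy inner in auto)
    have "\<bar>c t - c s\<bar> - P * (Q t - Q s) \<le> 0"
    proof (cases "s = T")
      case True
      then show ?thesis using st by simp
    next
      case False
      then have sT: "s < T" using st by simp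
      show ?thesis
      proof (rule continuous_le_on_closure[of "{s<..<T}" "\<lambda>t. \<bar>c t - c s\<bar> - P * (Q t - Q s)" t])
        show "continuous_on (closure {s<..<T}) (\<lambda>t. \<bar>c t - c s\<bar> - P * (Q t - Q s))"
          using st sT by (intro continuous_intros continuous_on_subset[OF c] continuous_on_subset[OF Q]) auto
      qed (use st sT step1 in auto)
    qed
    then show ?thesis using Q_diff[OF st] by (simp add: c_def P_def)
  qed
  show ?thesis using that[OF G1 G2 M incr] by blast
qed

lemma weak_solution_strongly_continuous:
  assumes T: "0 < T" and f: "f \<in> Bochner_Lp 2 {0..T} (V_dual \<Omega>) (V_dual_norm \<Omega>)"
    and sol: "NS_weak_solution \<Omega> T \<nu> f u0 u"
    and u3: "u \<in> Bochner_Lp 3 {0..T} (V_space \<Omega>) (H1_norm \<Omega>)"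
    and t: "t \<in> {0..T}"
  shows "((\<lambda>s. L2_norm \<Omega> (u s - u t)) \<longlongrightarrow> 0) (at t within {0..T})"
proof -
  obtain G M where G: "integrable (lebesgue_on {0..T}) G" "integrable (lebesgue_on {0..T}) (\<lambda>t. (G t)\<^sup>2)"
    and M: "\<And>t. t \<in> {0..T} \<Longrightarrow> L2_norm \<Omega> (u t) \<le> M"
    and incr: "\<And>p s t. p \<in> V_space \<Omega> \<Longrightarrow> 0 \<le> s \<Longrightarrow> s \<le> t \<Longrightarrow> t \<le> T \<Longrightarrow>
      \<bar>L2_inner \<Omega> (u t) p - L2_inner \<Omega> (u s) p\<bar> \<le> H1_norm \<Omega> p * integral {s..t} G"
    using weak_solution_increment[OF T f sol u3] by blast
  have u2: "u \<in> Bochner_Lp 2 {0..T} (V_space \<Omega>) (H1_norm \<Omega>)"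
    and wc: "weakly_continuous_into {0..T} (H_space \<Omega>) (L2_norm \<Omega>) u"
    using sol unfolding NS_weak_solution_def by blast+
  have L2: "u s \<in> L2_space \<Omega>" if "s \<in> {0..T}" for s
    using wc that by (auto simp: weakly_continuous_into_def H_L2)
  obtain N where N: "negligible N" "\<And>s. s \<in> {0..T} - N \<Longrightarrow> u s \<in> V_space \<Omega>"
    using u2 AE_lebesgue_on_negligible[of "{0..T}" "\<lambda>s. u s \<in> V_space \<Omega>"] unfolding Bochner_Lp_def by auto
  \<comment> \<open>The kernel locale works on the whole time line. Clamping time to [0, T]
    preserves the continuity of the kernel there; U and G, which only have to be integrable, are
    instead extended by zero through \<open>ext\<close>.\<close>
  define cl where "cl s = max 0 (min T s)" for s :: real
  have cl: "cl s \<in> {0..T}" for s using T by (auto simp: cl_def)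
  have cl_id: "cl s = s" if "s \<in> {0..T}" for s using that by (auto simp: cl_def)
  define ext where "ext F t = (if t \<in> {0..T} then F t else 0)" for F :: "real \<Rightarrow> real" and t
  define k where "k s t = L2_inner \<Omega> (u (cl s)) (u (cl t))" for s t
  have int: "ext F integrable_on {a..b}" if "integrable (lebesgue_on {0..T}) F" for F a b
    unfolding ext_def[abs_def] by (rule integrable_lebesgue_on_zero_extension[OF that]) simp
  have sq: "(\<lambda>t. (ext F t)\<^sup>2) = ext (\<lambda>t. (F t)\<^sup>2)" for F by (auto simp: ext_def)
  interpret weak_gram_kernel k "ext (\<lambda>t. H1_norm \<Omega> (u t))" "ext G" T "M * M" N
  proof
    show "k s t = k t s" for s t by (simp add: k_def L2_inner_commute)
    show "2 * (k a c - k a d - k b c + k b d) \<le> (k a a - 2 * k a b + k b b) + (k c c - 2 * k c d + k d d)" for a b c d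
      unfolding k_def by (intro L2_inner_psd L2 cl)
    show "continuous_on UNIV (k s)" for s
    proof -
      have "continuous_on UNIV cl" unfolding cl_def by (intro continuous_intros)
      then have "continuous_on UNIV (\<lambda>t. L2_inner \<Omega> (u (cl t)) (u (cl s)))"
        using cl by (intro continuous_on_compose2[OF weakly_continuous_inner[OF wc L2[OF cl]]]) auto
      then show ?thesis by (simp add: k_def[abs_def] L2_inner_commute)
    qed
    show "\<bar>k s t\<bar> \<le> M * M" for s t
    proof -
      have "\<bar>k s t\<bar> \<le> L2_norm \<Omega> (u (cl s)) * L2_norm \<Omega> (u (cl t))"
        unfolding k_def by (intro L2_Cauchy_Schwarz L2 cl)
      also have "\<dots> \<le> M * M"
        using L2_norm_nonneg order.trans[OF L2_norm_nonneg M[OF cl]] by (intro mult_mono M cl) auto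
      finally show ?thesis .
    qed
    show "negligible N" by (rule N)
    show "\<bar>k t s - k t' s\<bar> \<le> ext (\<lambda>t. H1_norm \<Omega> (u t)) s * integral {t'..t} (ext G)"
      if "s \<in> {0..T} - N" "0 \<le> t'" "t' \<le> t" "t \<le> T" for s t t'
    proof -
      have "integral {t'..t} (ext G) = integral {t'..t} G"
        using that by (intro integral_cong) (auto simp: ext_def)
      then show ?thesis
        using incr[OF N(2)[OF that(1)] that(2-4)] that by (simp add: k_def cl_id ext_def)
    qed
    show "ext G integrable_on {a..b}" for a b by (rule int[OF G(1)])
    show "(\<lambda>t. (ext G t)\<^sup>2) integrable_on {a..b}" for a b unfolding sq by (rule int[OF G(2)])
    show "(\<lambda>t. (ext (\<lambda>t. H1_norm \<Omega> (u t)) t)\<^sup>2) integrable_on {a..b}" for a b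
      unfolding sq using u2 by (intro int) (auto simp: Bochner_Lp_def)
  qed
  have D: "sqrt (D s t) = L2_norm \<Omega> (u s - u t)" if "s \<in> {0..T}" for s
  proof -
    have "D s t = (L2_norm \<Omega> (u s - u t))\<^sup>2"
      unfolding L2_norm_diff_power2[OF L2[OF that] L2[OF t]] D_def k_def cl_id[OF that] cl_id[OF t] by simp
    then show ?thesis by (simp add: L2_norm_nonneg)
  qed
  have "((\<lambda>s. sqrt (D s t)) \<longlongrightarrow> sqrt 0) (at t within {0..T})"
    by (intro tendsto_intros strong_continuity T t)
  then have "((\<lambda>s. sqrt (D s t)) \<longlongrightarrow> 0) (at t within {0..T})" by simp
  then show ?thesis
    by (rule Lim_transform_eventually) (auto simp: eventually_at_filter D)
qed

end

theorem lemma2p3: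
  fixes \<Omega> :: "(real^3) set"
    and T \<nu> :: real
    and f :: "real \<Rightarrow> (real^3 \<Rightarrow> real^3) \<Rightarrow> real"
    and u0 v0 :: "real^3 \<Rightarrow> real^3"
    and u v :: "real \<Rightarrow> real^3 \<Rightarrow> real^3"
  assumes "T > 0" and "\<nu> > 0"
    and "open \<Omega>" and "bounded \<Omega>" and "smooth_boundary \<Omega>"
    and "f \<in> Bochner_Lp 2 {0..T} (V_dual \<Omega>) (V_dual_norm \<Omega>)"
    and "u0 \<in> H_space \<Omega>" and "v0 \<in> H_space \<Omega>"
    and "NS_weak_solution \<Omega> T \<nu> f u0 u"
    and "NS_weak_solution \<Omega> T \<nu> f v0 v"
    and "u \<in> Bochner_Lp 3 {0..T} (V_space \<Omega>) (H1_norm \<Omega>)"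
    and "v \<in> Bochner_Lp 3 {0..T} (V_space \<Omega>) (H1_norm \<Omega>)"
  shows "continuous_into {0..T} (H_space \<Omega>) (L2_norm \<Omega>) (u - v)"
proof -
  interpret bounded_open_domain \<Omega> using assms by unfold_locales
  have H: "u t \<in> H_space \<Omega>" "v t \<in> H_space \<Omega>" if "t \<in> {0..T}" for t
    using assms(9,10) that unfolding NS_weak_solution_def weakly_continuous_into_def by blast+
  show ?thesis
    unfolding continuous_into_def
  proof (intro conjI ballI)
    fix t assume t: "t \<in> {0..T}"
    show "(u - v) t \<in> H_space \<Omega>" using H_diff[OF H[OF t]] by simp
    note lim = tendsto_add[OF weak_solution_strongly_continuous[OF assms(1,6,9,11) t]
        weak_solution_strongly_continuous[OF assms(1,6,10,12) t]]
    show "((\<lambda>s. L2_norm \<Omega> ((u - v) s - (u - v) t)) \<longlongrightarrow> 0) (at t within {0..T})"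
    proof (rule tendsto_sandwich[OF _ _ tendsto_const])
      show "((\<lambda>s. L2_norm \<Omega> (u s - u t) + L2_norm \<Omega> (v s - v t)) \<longlongrightarrow> 0) (at t within {0..T})"
        using lim by simp
      have "L2_norm \<Omega> ((u - v) s - (u - v) t) \<le> L2_norm \<Omega> (u s - u t) + L2_norm \<Omega> (v s - v t)"
        if s: "s \<in> {0..T}" for s
      proof -
        have "(u - v) s - (u - v) t = (u s - u t) - (v s - v t)" by (simp add: fun_eq_iff)
        then show ?thesis
          using L2_norm_diff_le[OF L2_space_diff[OF H_L2[OF H(1)[OF s]] H_L2[OF H(1)[OF t]]]
              L2_space_diff[OF H_L2[OF H(2)[OF s]] H_L2[OF H(2)[OF t]]]] by simp
      qed
      then show "\<forall>\<^sub>F s in at t within {0..T}.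
          L2_norm \<Omega> ((u - v) s - (u - v) t) \<le> L2_norm \<Omega> (u s - u t) + L2_norm \<Omega> (v s - v t)"
        by (simp add: eventually_at_filter)
    qed (simp add: L2_norm_nonneg)
  qed
qed

end
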